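(* Let $S$ be a closed, bounded from below, densely defined symmetric operator on a separable Hilbert space $\mathcal H$ with finite and equal defect numbers $(n,n)$, and let $(\mathcal K,\Gamma_0,\Gamma_1)$ be a boundary triplet for $S$. Let $\mathcal L_1,\mathcal L_2$ and $\mathcal F$ be the Lagrangian planes in $(\mathcal K\oplus\mathcal K,\omega)$ corresponding to self-adjoint extensions $H_1$, $H_2$ and the Friedrichs extension $H_F$ of $S$, respectively. Define $$\sigma_- := \iota(\mathcal L_1,\mathcal L_2,\mathcal F),\qquad \sigma_+ := \iota(\mathcal L_2,\mathcal L_1,\mathcal F),$$ where $\iota$ is the Duistermaat index. Then the bounds $$-\sigma_-\le \sigma(H_1,H_2;\lambda)\le \sigma_+$$ hold for all $\lambda\in\mathbb R$ below $\operatorname{Spec}_{\mathrm{ess}}(S)$. Equivalently, each of the inequalities $$\lambda_{k-\sigma_-}(H_1)\le\lambda_k(H_2)\le\lambda_{k+\sigma_+}(H_1)$$ holds for all $k$ such that the eigenvalues in question are below $\operatorname{Spec}_{\mathrm{ess}}(S)$.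
   Context: All inner products are linear in the second argument. A boundary triplet $(\mathcal K,\Gamma_0,\Gamma_1)$ for $S$ consists of an $n$-dimensional complex Hilbert space $\mathcal K$ and linear maps $\Gamma_0,\Gamma_1:\operatorname{dom}(S^* )\to\mathcal K$ such that $\mathbf\Gamma f:=(\Gamma_0f,\Gamma_1f)$ defines a surjection $\operatorname{dom}(S^* )\to\mathcal K\oplus\mathcal K$ and $\langle f,S^*g\rangle_{\mathcal H}-\langle S^*f,g\rangle_{\mathcal H}=\langle\Gamma_0f,\Gamma_1g\rangle_{\mathcal K}-\langle\Gamma_1f,\Gamma_0g\rangle_{\mathcal K}$ for all $f,g\in\operatorname{dom}(S^* )$. The symplectic form on $\mathcal K\oplus\mathcal K$ is $\omega(u,v)=\langle u_0,v_1\rangle_{\mathcal K}-\langle u_1,v_0\rangle_{\mathcal K}$. A subspace $\mathcal L\subset\mathcal K\oplus\mathcal K$ is a Lagrangian plane if $\mathcal L=\{u:\omega(u,v)=0\ \forall v\in\mathcal L\}$. Self-adjoint extensions $H$ of $S$ are in one-to-one correspondence with Lagrangian planes $\mathcal L$ via $\operatorname{dom}(H)=\{f\in\operatorname{dom}(S^* ):\mathbf\Gamma f\in\mathcal L\}$ (and $H=S^*|_{\operatorname{dom}(H)}$); in particular $\mathcal F=\mathbf\Gamma(\operatorname{dom}(H_F))$. $\operatorname{Spec}_{\mathrm{ess}}(S):=\{z\in\mathbb C: S-z\text{ is not Fredholm}\}$; it equals $\operatorname{Spec}_{\mathrm{ess}}(H)$ for every self-adjoint extension $H$ of $S$. For an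 interval $I$ whose closure is disjoint from this set, $N(H;I):=\sum_{\lambda\in I}\dim\ker(H-\lambda)$. For $\lambda\in\mathbb R$ below the essential spectrum, the spectral shift is $\sigma(H_1,H_2;\lambda):=N(H_1;(-\infty,\lambda])-N(H_2;(-\infty,\lambda])$. The eigenvalues of $H$ below the essential spectrum are labelled $\lambda_1(H)\le\lambda_2(H)\le\cdots$ in increasing order, repeated according to multiplicity. Duistermaat index: for Lagrangian planes $\alpha,\beta,\gamma$ with $\alpha\cap\beta=0=\beta\cap\gamma$, $\gamma$ is the graph $\{u+Lu:u\in\alpha\}$ of a linear map $L:\alpha\to\beta$; let $Q(\alpha,\beta;\gamma)$ be the Hermitian form $(u_1,u_2)\mapsto\omega(u_1,Lu_2)$ on $\alpha$, and let $n_-$ of a Hermitian form be the maximal dimension of a subspace on which it is negative definite. For arbitrary Lagrangian planes $\mathcal L_1,\mathcal L_2,\mathcal L_3$, choose a Lagrangian plane $\hat{\mathcal L}$ transversal to all three and set $\iota(\mathcal L_1,\mathcal L_2,\mathcal L_3):=n_-(Q(\mathcal L_2,\hat{\mathcal L};\mathcal L_3))-n_-(Q(\mathcal L_1,\hat{\mathcal L};\mathcal L_3))+n_-(Q(\mathcal L_1,\hat{\mathcal L};\mathcal L_2))$, which does not depend on the choice of $\hat{\mathcal L}$. *)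

theory Defs
  imports "HOL-Analysis.Analysis"
begin

section \<open>Complex Hilbert spaces\<close>

class complex_vector = real_vector +
  fixes scaleC :: "complex \<Rightarrow> 'a \<Rightarrow> 'a"  (infixr \<open>*c\<close> 75)
  assumes scaleC_add_right: "a *c (x + y) = a *c x + a *c y"
    and scaleC_add_left: "(a + b) *c x = a *c x + b *c x"
    and scaleC_scaleC: "a *c (b *c x) = (a * b) *c x"
    and scaleC_of_real: "complex_of_real r *c x = r *\<^sub>R x"

text \<open>The inner product is linear in the second argument.  Its real part is the real inner
  product of \<^class>\<open>real_inner\<close>, so norm and topology are the library's.\<close>

class complex_inner = complex_vector + real_inner +
  fixes cinner :: "'a \<Rightarrow> 'a \<Rightarrow> complex"
  assumes cinner_commute: "cinner x y = cnj (cinner y x)"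
    and cinner_add_right: "cinner x (y + z) = cinner x y + cinner x z"
    and cinner_scaleC_right: "cinner x (a *c y) = a * cinner x y"
    and inner_eq_Re_cinner: "inner x y = Re (cinner x y)"

class chilbert_space = complex_inner + complete_space

global_interpretation cvec: vector_space "scaleC :: complex \<Rightarrow> 'a \<Rightarrow> 'a::complex_vector"
proof
  fix a b :: complex and x y :: 'a
  show "a *c (x + y) = a *c x + a *c y" by (rule scaleC_add_right)
  show "(a + b) *c x = a *c x + b *c x" by (rule scaleC_add_left)
  show "a *c (b *c x) = (a * b) *c x" by (rule scaleC_scaleC)
  show "1 *c x = x" using scaleC_of_real[of 1 x] by simp
qed

instantiation prod :: (complex_vector, complex_vector) complex_vector
begin

definition scaleC_prod_def: "a *c p = (a *c fst p, a *c snd p)"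

instance
  by standard
    (simp_all add: scaleC_prod_def scaleC_add_right scaleC_add_left scaleC_scaleC
      scaleC_of_real scaleR_prod_def)

end

text \<open>\<open>cvec.dim\<close> is 0 on infinite-dimensional subspaces; hence the separate predicate.\<close>

definition finite_cdim :: "'a::complex_vector set \<Rightarrow> bool" where
  "finite_cdim V \<longleftrightarrow> (\<exists>B. finite B \<and> V \<subseteq> cvec.span B)"


section \<open>Unbounded operators\<close>

text \<open>Operators are identified with their graphs, so that \<open>A \<subseteq> B\<close> means that \<open>B\<close> extends \<open>A\<close>.\<close>

definition linear_operator :: "('h::chilbert_space \<times> 'h) set \<Rightarrow> bool" where
  "linear_operator A \<longleftrightarrow> cvec.subspace A \<and> single_valued A"

definition densely_defined :: "('h::chilbert_space \<times> 'h) set \<Rightarrow> bool" where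
  "densely_defined A \<longleftrightarrow> closure (Domain A) = UNIV"

definition symmetric_operator :: "('h::chilbert_space \<times> 'h) set \<Rightarrow> bool" where
  "symmetric_operator A \<longleftrightarrow> linear_operator A \<and>
     (\<forall>(f, Af) \<in> A. \<forall>(g, Ag) \<in> A. cinner f Ag = cinner Af g)"

text \<open>For symmetric \<open>A\<close> the number \<open>\<langle>f, A f\<rangle>\<close> is real.\<close>

definition bounded_from_below :: "('h::chilbert_space \<times> 'h) set \<Rightarrow> bool" where
  "bounded_from_below A \<longleftrightarrow> (\<exists>m. \<forall>(f, Af) \<in> A. m * (norm f)\<^sup>2 \<le> Re (cinner f Af))"

definition adjoint_op :: "('h::chilbert_space \<times> 'h) set \<Rightarrow> ('h \<times> 'h) set" where
  "adjoint_op A = {(g, h). \<forall>(f, Af) \<in> A. cinner g Af = cinner h f}"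

definition self_adjoint :: "('h::chilbert_space \<times> 'h) set \<Rightarrow> bool" where
  "self_adjoint A \<longleftrightarrow> linear_operator A \<and> densely_defined A \<and> adjoint_op A = A"

definition self_adjoint_extension ::
    "('h::chilbert_space \<times> 'h) set \<Rightarrow> ('h \<times> 'h) set \<Rightarrow> bool" where
  "self_adjoint_extension S H \<longleftrightarrow> self_adjoint H \<and> S \<subseteq> H"

definition shift_op :: "('h::chilbert_space \<times> 'h) set \<Rightarrow> complex \<Rightarrow> ('h \<times> 'h) set" where
  "shift_op A z = {(f, Af - z *c f) | f Af. (f, Af) \<in> A}"

definition ker_op :: "('h::chilbert_space \<times> 'h) set \<Rightarrow> 'h set" where
  "ker_op A = {f. (f, 0) \<in> A}"

definition defect_numbers :: "('h::chilbert_space \<times> 'h) set \<Rightarrow> nat \<Rightarrow> nat \<Rightarrow> bool" where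
  "defect_numbers S n m \<longleftrightarrow>
     finite_cdim (ker_op (shift_op (adjoint_op S) \<i>)) \<and>
     cvec.dim (ker_op (shift_op (adjoint_op S) \<i>)) = n \<and>
     finite_cdim (ker_op (shift_op (adjoint_op S) (- \<i>))) \<and>
     cvec.dim (ker_op (shift_op (adjoint_op S) (- \<i>))) = m"

definition fredholm :: "('h::chilbert_space \<times> 'h) set \<Rightarrow> bool" where
  "fredholm A \<longleftrightarrow> linear_operator A \<and> closed A \<and> densely_defined A \<and>
     finite_cdim (ker_op A) \<and> closed (Range A) \<and>
     (\<exists>W. finite_cdim W \<and> (\<forall>h. \<exists>r \<in> Range A. \<exists>w \<in> W. h = r + w))"

definition spec_ess :: "('h::chilbert_space \<times> 'h) set \<Rightarrow> complex set" where
  "spec_ess A = {z. \<not> fredholm (shift_op A z)}"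

text \<open>For the operators of interest \<^const>\<open>spec_ess\<close> is a closed subset of the real line.\<close>

definition below_spec_ess :: "real \<Rightarrow> ('h::chilbert_space \<times> 'h) set \<Rightarrow> bool" where
  "below_spec_ess t A \<longleftrightarrow> (\<forall>z \<in> spec_ess A. t < Re z)"

text \<open>Friedrichs extension: the restriction of \<open>S\<^sup>*\<close> to those elements of its domain that lie
  in the domain of the closure of the form \<open>\<langle>f, S g\<rangle>\<close>, i.e. are limits of sequences in
  \<open>dom(S)\<close> that are Cauchy with respect to this form.\<close>

definition form_closure_dom :: "('h::chilbert_space \<times> 'h) set \<Rightarrow> 'h set" where
  "form_closure_dom S = {f. \<exists>u Su. (\<forall>k. (u k, Su k) \<in> S) \<and> u \<longlonglongrightarrow> f \<and>
     ((\<lambda>(k, l). cinner (u k - u l) (Su k - Su l)) \<longlongrightarrow> 0) (sequentially \<times>\<^sub>F sequentially)}"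

definition friedrichs_extension :: "('h::chilbert_space \<times> 'h) set \<Rightarrow> ('h \<times> 'h) set" where
  "friedrichs_extension S = {(f, g) \<in> adjoint_op S. f \<in> form_closure_dom S}"


section \<open>Eigenvalue counting below the essential spectrum\<close>

definition multiplicity_op :: "('h::chilbert_space \<times> 'h) set \<Rightarrow> real \<Rightarrow> nat" where
  "multiplicity_op H \<mu> = cvec.dim (ker_op (shift_op H (complex_of_real \<mu>)))"

text \<open>Only finitely many summands of \<open>\<Sum>\<mu>\<in>I. dim ker (H - \<mu>)\<close> are nonzero when \<open>I\<close> is a half-line
  \<open>(-\<infinity>, t]\<close> below the essential spectrum and \<open>H\<close> is bounded from below; the sum is over these.\<close>

definition eigenvalue_count :: "('h::chilbert_space \<times> 'h) set \<Rightarrow> real set \<Rightarrow> nat" where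
  "eigenvalue_count H I = (\<Sum>\<mu> \<in> {\<mu> \<in> I. multiplicity_op H \<mu> \<noteq> 0}. multiplicity_op H \<mu>)"

definition spectral_shift ::
    "('h::chilbert_space \<times> 'h) set \<Rightarrow> ('h \<times> 'h) set \<Rightarrow> real \<Rightarrow> int" where
  "spectral_shift H\<^sub>1 H\<^sub>2 t =
     int (eigenvalue_count H\<^sub>1 {..t}) - int (eigenvalue_count H\<^sub>2 {..t})"

text \<open>\<open>l\<close> lists, in increasing order and repeated according to multiplicity, the eigenvalues of
  \<open>H\<close> below the essential spectrum of \<open>S\<close> (which is that of \<open>H\<close> if \<open>H\<close> is a self-adjoint extension
  of \<open>S\<close>); the index set \<open>J\<close> is \<open>{1..m}\<close> or \<open>{1..}\<close>, according to their number.\<close>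

definition eigenvalue_labelling ::
    "('h::chilbert_space \<times> 'h) set \<Rightarrow> ('h \<times> 'h) set \<Rightarrow> nat set \<Rightarrow> (nat \<Rightarrow> real) \<Rightarrow> bool" where
  "eigenvalue_labelling S H J l \<longleftrightarrow>
     ((\<exists>m. J = {1..m}) \<or> J = {1..}) \<and> mono_on J l \<and>
     (\<forall>k \<in> J. below_spec_ess (l k) S) \<and>
     (\<forall>\<mu>. below_spec_ess \<mu> S \<longrightarrow>
        finite {k \<in> J. l k = \<mu>} \<and> card {k \<in> J. l k = \<mu>} = multiplicity_op H \<mu>)"


section \<open>Lagrangian planes and the Duistermaat index\<close>

definition omega :: "'k::chilbert_space \<times> 'k \<Rightarrow> 'k \<times> 'k \<Rightarrow> complex" where
  "omega u v = cinner (fst u) (snd v) - cinner (snd u) (fst v)"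

definition lagrangian :: "('k::chilbert_space \<times> 'k) set \<Rightarrow> bool" where
  "lagrangian L \<longleftrightarrow> cvec.subspace L \<and> L = {u. \<forall>v \<in> L. omega u v = 0}"

text \<open>The map \<open>L : \<alpha> \<rightarrow> \<beta>\<close> with \<open>\<gamma> = {u + L u | u \<in> \<alpha>}\<close>; unique if \<open>\<alpha>\<close>, \<open>\<beta>\<close> and \<open>\<beta>\<close>, \<open>\<gamma>\<close> are
  transversal.\<close>

definition graph_map :: "('k::chilbert_space \<times> 'k) set \<Rightarrow> ('k \<times> 'k) set \<Rightarrow> ('k \<times> 'k) set \<Rightarrow>
    'k \<times> 'k \<Rightarrow> 'k \<times> 'k" where
  "graph_map \<alpha> \<beta> \<gamma> u = (THE w. w \<in> \<beta> \<and> u + w \<in> \<gamma>)"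

definition Q_form :: "('k::chilbert_space \<times> 'k) set \<Rightarrow> ('k \<times> 'k) set \<Rightarrow> ('k \<times> 'k) set \<Rightarrow>
    'k \<times> 'k \<Rightarrow> 'k \<times> 'k \<Rightarrow> complex" where
  "Q_form \<alpha> \<beta> \<gamma> u\<^sub>1 u\<^sub>2 = omega u\<^sub>1 (graph_map \<alpha> \<beta> \<gamma> u\<^sub>2)"

text \<open>\<open>q\<close> is meant to be Hermitian on the finite-dimensional space \<open>V\<close>, so that \<open>q u u\<close> is real.\<close>

definition n_minus :: "'a::complex_vector set \<Rightarrow> ('a \<Rightarrow> 'a \<Rightarrow> complex) \<Rightarrow> nat" where
  "n_minus V q = Max {cvec.dim W | W. cvec.subspace W \<and> W \<subseteq> V \<and>
     (\<forall>u \<in> W. u \<noteq> 0 \<longrightarrow> Re (q u u) < 0)}"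

definition n_minus_Q :: "('k::chilbert_space \<times> 'k) set \<Rightarrow> ('k \<times> 'k) set \<Rightarrow> ('k \<times> 'k) set \<Rightarrow> nat"
  where "n_minus_Q \<alpha> \<beta> \<gamma> = n_minus \<alpha> (Q_form \<alpha> \<beta> \<gamma>)"

text \<open>The value does not depend on the choice of the auxiliary plane \<open>M\<close>.\<close>

definition duistermaat_index ::
    "('k::chilbert_space \<times> 'k) set \<Rightarrow> ('k \<times> 'k) set \<Rightarrow> ('k \<times> 'k) set \<Rightarrow> int" where
  "duistermaat_index L\<^sub>1 L\<^sub>2 L\<^sub>3 =
     (let M = (SOME M. lagrangian M \<and> M \<inter> L\<^sub>1 = {0} \<and> M \<inter> L\<^sub>2 = {0} \<and> M \<inter> L\<^sub>3 = {0})
      in int (n_minus_Q L\<^sub>2 M L\<^sub>3) - int (n_minus_Q L\<^sub>1 M L\<^sub>3) + int (n_minus_Q L\<^sub>1 M L\<^sub>2))"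


section \<open>Boundary triplets\<close>

text \<open>The boundary space is the whole type \<open>'k\<close>; only the values of \<open>\<Gamma>\<^sub>0\<close>, \<open>\<Gamma>\<^sub>1\<close> on \<open>dom(S\<^sup>*)\<close> matter.\<close>

definition clinear_on :: "'a::complex_vector set \<Rightarrow> ('a \<Rightarrow> 'b::complex_vector) \<Rightarrow> bool" where
  "clinear_on V T \<longleftrightarrow> (\<forall>x \<in> V. \<forall>y \<in> V. T (x + y) = T x + T y) \<and> (\<forall>a. \<forall>x \<in> V. T (a *c x) = a *c T x)"

definition boundary_triplet :: "('h::chilbert_space \<times> 'h) set \<Rightarrow> nat \<Rightarrow>
    ('h \<Rightarrow> 'k::chilbert_space) \<Rightarrow> ('h \<Rightarrow> 'k) \<Rightarrow> bool" where
  "boundary_triplet S n \<Gamma>\<^sub>0 \<Gamma>\<^sub>1 \<longleftrightarrow>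
     finite_cdim (UNIV :: 'k set) \<and> cvec.dim (UNIV :: 'k set) = n \<and>
     clinear_on (Domain (adjoint_op S)) \<Gamma>\<^sub>0 \<and> clinear_on (Domain (adjoint_op S)) \<Gamma>\<^sub>1 \<and>
     (\<lambda>f. (\<Gamma>\<^sub>0 f, \<Gamma>\<^sub>1 f)) ` Domain (adjoint_op S) = UNIV \<and>
     (\<forall>(f, f') \<in> adjoint_op S. \<forall>(g, g') \<in> adjoint_op S.
        cinner f g' - cinner f' g = cinner (\<Gamma>\<^sub>0 f) (\<Gamma>\<^sub>1 g) - cinner (\<Gamma>\<^sub>1 f) (\<Gamma>\<^sub>0 g))"

definition corresponding_plane :: "('h::chilbert_space \<times> 'h) set \<Rightarrow>
    ('h \<Rightarrow> 'k::chilbert_space) \<Rightarrow> ('h \<Rightarrow> 'k) \<Rightarrow> ('h \<times> 'h) set \<Rightarrow> ('k \<times> 'k) set \<Rightarrow> bool" where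
  "corresponding_plane S \<Gamma>\<^sub>0 \<Gamma>\<^sub>1 H L \<longleftrightarrow>
     lagrangian L \<and> H = {(f, g) \<in> adjoint_op S. (\<Gamma>\<^sub>0 f, \<Gamma>\<^sub>1 f) \<in> L}"

end

theory Submission
  imports Defs
begin

text \<open>Let \<open>V\<^sub>i\<close> be the span of the eigenvectors of \<open>H\<^sub>i\<close> with eigenvalue at most \<open>\<lambda>\<close>.  If \<open>f \<in> V\<^sub>1\<close> has
  boundary value \<open>p + r\<close> with \<open>p \<in> L\<^sub>2\<close> and \<open>r \<in> F\<close>, then \<open>f\<close> is the sum of an element of
  \<open>dom(H\<^sub>2)\<close> and one of \<open>dom(H\<^sub>F)\<close>, so it lies in the form domain of \<open>H\<^sub>2\<close>, and by Green's identity
  its \<open>H\<^sub>2\<close>-form is \<open>\<langle>f, H\<^sub>1 f\<rangle> - Re \<omega>(p, r)\<close>.  The conditions that \<open>f\<close> be orthogonal to \<open>V\<^sub>2\<close>, that its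
  boundary value split in this way and that \<open>Re \<omega>(p, r) \<ge> 0\<close> cost at most
  \<open>dim V\<^sub>2 + \<iota>(L\<^sub>2, L\<^sub>1, F)\<close> dimensions.  A nonzero \<open>f\<close> satisfying them would violate the variational
  principle for \<open>H\<^sub>2\<close>, whence \<open>dim V\<^sub>1 \<le> dim V\<^sub>2 + \<iota>(L\<^sub>2, L\<^sub>1, F)\<close>; the other bound follows by exchanging
  \<open>H\<^sub>1\<close> and \<open>H\<^sub>2\<close>.\<close>

section \<open>Finite-dimensional complex linear algebra\<close>

text \<open>Two obstacles shape the argument. The sign condition
  \<open>Re (omega p r) \<ge> 0\<close> is not linear in f, and the splitting p + r is not unique.
  Both are therefore imposed together, by linear conditions on a pair (f, y) in which y in
  \<open>L\<^sub>2\<close> is an auxiliary unknown; the price is that f = 0 has to be excluded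
  separately. The second obstacle is strictness. Forms on \<open>V\<^sub>1\<close> are at most
  \<lambda>, so the form of \<open>H\<^sub>2\<close> on the complement of \<open>V\<^sub>2\<close>
  must be bounded below by a number strictly above \<lambda>. This gap is derived directly: for s
  \<le> \<lambda> the range of S - s is closed with finite codimension, uniform boundedness turns
  this into a bounded inverse of \<open>H\<^sub>2\<close> - s off its eigenspace, and such an
  inverse at the infimum of the form would push that infimum up. Semiboundedness of the extensions
  is derived as well, since the form is bounded below on the kernel of the boundary map, which has
  finite codimension. The Friedrichs plane enters because elements of \<open>dom(H\<^sub>F)\<close>
  are limits from dom(S) along which the forms converge too; adding them to elements of
  \<open>dom(H\<^sub>2)\<close> keeps the lower bound available.\<close>

definition functional_on :: "'a::complex_vector set \<Rightarrow> ('a \<Rightarrow> complex) \<Rightarrow> bool" where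
  "functional_on V \<phi> \<longleftrightarrow>
     (\<forall>x \<in> V. \<forall>y \<in> V. \<phi> (x + y) = \<phi> x + \<phi> y) \<and> (\<forall>a. \<forall>x \<in> V. \<phi> (a *c x) = a * \<phi> x)"

text \<open>Linearity is demanded in the second argument only; conjugate linearity in the first
  follows from the symmetry.\<close>

definition hermitian_on :: "'a::complex_vector set \<Rightarrow> ('a \<Rightarrow> 'a \<Rightarrow> complex) \<Rightarrow> bool" where
  "hermitian_on V q \<longleftrightarrow>
     (\<forall>x \<in> V. functional_on V (q x)) \<and> (\<forall>x \<in> V. \<forall>y \<in> V. q x y = cnj (q y x))"

lemma functional_onD:
  assumes "functional_on V \<phi>"
  shows "x \<in> V \<Longrightarrow> y \<in> V \<Longrightarrow> \<phi> (x + y) = \<phi> x + \<phi> y"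
    and "x \<in> V \<Longrightarrow> \<phi> (a *c x) = a * \<phi> x"
  using assms by (auto simp: functional_on_def)

lemma functional_on_mono: "functional_on V \<phi> \<Longrightarrow> U \<subseteq> V \<Longrightarrow> functional_on U \<phi>"
  unfolding functional_on_def by blast

lemma functional_on_zero:
  assumes "functional_on V \<phi>" "0 \<in> V"
  shows "\<phi> 0 = 0"
  using functional_onD(2)[OF assms, of 0] by simp

lemma functional_on_diff:
  assumes "functional_on V \<phi>" "cvec.subspace V" "x \<in> V" "y \<in> V"
  shows "\<phi> (x - y) = \<phi> x - \<phi> y"
  using functional_onD(1)[OF assms(1), of "x - y" y] assms cvec.subspace_diff by force

lemma subspace_kernel_functional:
  assumes "functional_on V \<phi>" "cvec.subspace V"
  shows "cvec.subspace {x \<in> V. \<phi> x = 0}"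
  using assms functional_on_zero[OF assms(1)]
  by (auto simp: cvec.subspace_def functional_on_def)

lemma hermitian_onD:
  assumes "hermitian_on V q" "x \<in> V" "y \<in> V"
  shows "q x y = cnj (q y x)" "functional_on V (q x)"
  using assms unfolding hermitian_on_def by blast+

lemma hermitian_on_add_left:
  assumes "hermitian_on V q" "cvec.subspace V" "x \<in> V" "y \<in> V" "z \<in> V"
  shows "q (x + y) z = q x z + q y z"
proof -
  have "q (x + y) z = cnj (q z (x + y))"
    using hermitian_onD(1)[OF assms(1)] assms cvec.subspace_add by blast
  also have "\<dots> = cnj (q z x) + cnj (q z y)"
    using functional_onD(1)[OF hermitian_onD(2)[OF assms(1,5,5)]] assms by simp
  also have "\<dots> = q x z + q y z"
    using hermitian_onD(1)[OF assms(1)] assms by metis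
  finally show ?thesis .
qed

lemma hermitian_on_scale_left:
  assumes "hermitian_on V q" "cvec.subspace V" "x \<in> V" "z \<in> V"
  shows "q (a *c x) z = cnj a * q x z"
proof -
  have "q (a *c x) z = cnj (q z (a *c x))"
    using hermitian_onD(1)[OF assms(1)] assms cvec.subspace_scale by blast
  also have "\<dots> = cnj a * cnj (q z x)"
    using functional_onD(2)[OF hermitian_onD(2)[OF assms(1,4,4)]] assms by simp
  also have "\<dots> = cnj a * q x z"
    using hermitian_onD(1)[OF assms(1)] assms by metis
  finally show ?thesis .
qed

lemma subspace_hermitian_left_kernel:
  assumes "hermitian_on V q" "cvec.subspace V" "z \<in> V"
  shows "cvec.subspace {x \<in> V. q x z = 0}"
proof -
  have "{x \<in> V. q x z = 0} = {x \<in> V. q z x = 0}"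
    using hermitian_onD(1)[OF assms(1)] assms(3) complex_cnj_zero_iff by metis
  then show ?thesis
    using subspace_kernel_functional[OF hermitian_onD(2)[OF assms(1,3,3)] assms(2)] by simp
qed

lemma hermitian_on_add_diag:
  assumes "hermitian_on V q" "cvec.subspace V" "x \<in> V" "y \<in> V"
  shows "Re (q (x + y) (x + y)) = Re (q x x) + 2 * Re (q x y) + Re (q y y)"
proof -
  have xy: "x + y \<in> V" using assms cvec.subspace_add by blast
  have "q (x + y) (x + y) = q x x + q x y + (q y x + q y y)"
    using functional_onD(1)[OF hermitian_onD(2)[OF assms(1,3,3)]]
      functional_onD(1)[OF hermitian_onD(2)[OF assms(1,4,4)]]
      hermitian_on_add_left[OF assms xy] assms by simp
  moreover have "q y x = cnj (q x y)" using hermitian_onD(1)[OF assms(1)] assms by blast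
  ultimately show ?thesis by simp
qed

lemma hermitian_on_scale_diag:
  assumes "hermitian_on V q" "cvec.subspace V" "x \<in> V"
  shows "Re (q (a *c x) (a *c x)) = (cmod a)\<^sup>2 * Re (q x x)"
proof -
  have "q (a *c x) (a *c x) = cnj a * (a * q x x)"
    using hermitian_on_scale_left[OF assms] functional_onD(2)[OF hermitian_onD(2)[OF assms(1,3,3)]]
      assms cvec.subspace_scale by metis
  also have "\<dots> = of_real ((cmod a)\<^sup>2) * q x x"
    by (metis complex_norm_square mult.assoc mult.commute)
  finally show ?thesis by simp
qed

section \<open>Dimension counts for subspaces and for common kernels of functionals\<close>

lemma finite_cdim_mono: "finite_cdim W \<Longrightarrow> V \<subseteq> W \<Longrightarrow> finite_cdim V"
  unfolding finite_cdim_def by blast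

lemma finite_cdim_span: "finite B \<Longrightarrow> finite_cdim (cvec.span B)"
  unfolding finite_cdim_def by blast

lemma independent_finite:
  assumes "finite_cdim V" "cvec.independent B" "B \<subseteq> V"
  shows "finite B"
proof -
  obtain T where "finite T" "V \<subseteq> cvec.span T" using assms(1) by (auto simp: finite_cdim_def)
  then show ?thesis using cvec.independent_span_bound[of T B] assms by blast
qed

lemma finite_basis_extend:
  assumes "finite_cdim V" "cvec.independent C" "C \<subseteq> V"
  obtains B where "finite B" "C \<subseteq> B" "B \<subseteq> V" "cvec.independent B" "V \<subseteq> cvec.span B"
    "card B = cvec.dim V"
proof -
  obtain B where B: "C \<subseteq> B" "B \<subseteq> V" "cvec.independent B" "V \<subseteq> cvec.span B"
    using cvec.maximal_independent_subset_extend[OF assms(3,2)] by blast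
  then show ?thesis
    using that independent_finite[OF assms(1)] cvec.basis_card_eq_dim by metis
qed

lemma finite_basis:
  assumes "finite_cdim V"
  obtains B where "finite B" "B \<subseteq> V" "cvec.independent B" "V \<subseteq> cvec.span B" "card B = cvec.dim V"
  using finite_basis_extend[OF assms cvec.independent_empty empty_subsetI] that by metis

lemma cdim_mono:
  assumes "finite_cdim W" "V \<subseteq> W"
  shows "cvec.dim V \<le> cvec.dim W"
proof -
  obtain B where "finite B" "W \<subseteq> cvec.span B" "card B = cvec.dim W"
    using finite_basis[OF assms(1)] by metis
  then show ?thesis using cvec.dim_le_card[of V B] assms(2) by fastforce
qed

lemma independent_card_le_cdim:
  assumes "finite_cdim V" "cvec.independent B" "B \<subseteq> V"
  shows "card B \<le> cvec.dim V"
  using cdim_mono[OF assms(1,3)] cvec.dim_eq_card_independent[OF assms(2)] by simp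

lemma cdim_eq_subspace:
  assumes "finite_cdim W" "cvec.subspace V" "V \<subseteq> W" "cvec.dim W \<le> cvec.dim V"
  shows "V = W"
proof (rule ccontr)
  assume "V \<noteq> W"
  then obtain x where x: "x \<in> W" "x \<notin> V" using assms(3) by blast
  obtain B where B: "finite B" "B \<subseteq> V" "cvec.independent B" "V \<subseteq> cvec.span B" "card B = cvec.dim V"
    using finite_basis[OF finite_cdim_mono[OF assms(1,3)]] by metis
  have "cvec.span B = V" using B assms(2) cvec.span_subspace by blast
  then have "x \<notin> cvec.span B" using x by simp
  then have "cvec.independent (insert x B)" "x \<notin> B"
    using B cvec.independent_insertI cvec.span_base by blast+
  then show False
    using independent_card_le_cdim[OF assms(1), of "insert x B"] B x assms by auto
qed

lemma independent_Un:
  assumes "finite C" "cvec.independent B" "cvec.independent C"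
    "cvec.span B \<inter> cvec.span C = {0}"
  shows "cvec.independent (B \<union> C) \<and> B \<inter> C = {}"
  using assms(1,3,4)
proof (induction C)
  case empty
  then show ?case using assms(2) by simp
next
  case (insert c C)
  have ind: "cvec.independent C" "c \<notin> cvec.span C"
    using insert.prems insert.hyps cvec.independent_insert[of c C] by auto
  have sub: "cvec.span C \<subseteq> cvec.span (insert c C)" by (intro cvec.span_mono) auto
  have IH: "cvec.independent (B \<union> C)" "B \<inter> C = {}"
    using insert.IH ind insert.prems(2) sub cvec.span_zero by blast+
  have "c \<notin> cvec.span (B \<union> C)"
  proof
    assume "c \<in> cvec.span (B \<union> C)"
    then obtain b w where bw: "c = b + w" "b \<in> cvec.span B" "w \<in> cvec.span C"
      by (auto simp: cvec.span_Un)
    have "c - w \<in> cvec.span (insert c C)"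
      using bw sub by (meson cvec.span_base cvec.span_diff insertI1 subsetD)
    then have "c - w = 0" using bw insert.prems(2) by auto
    then show False using ind bw by simp
  qed
  then show ?case using IH cvec.independent_insertI cvec.span_base
    by (metis Int_insert_right Un_iff Un_insert_right)
qed

lemma cdim_direct_sum:
  assumes "finite_cdim U" "finite_cdim W" "cvec.subspace U" "cvec.subspace W" "U \<inter> W \<subseteq> {0}"
  shows "finite_cdim {u + w | u w. u \<in> U \<and> w \<in> W}"
    and "cvec.dim {u + w | u w. u \<in> U \<and> w \<in> W} = cvec.dim U + cvec.dim W"
proof -
  obtain B where B: "finite B" "B \<subseteq> U" "cvec.independent B" "U \<subseteq> cvec.span B" "card B = cvec.dim U"
    using finite_basis[OF assms(1)] by metis
  obtain C where C: "finite C" "C \<subseteq> W" "cvec.independent C" "W \<subseteq> cvec.span C" "card C = cvec.dim W"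
    using finite_basis[OF assms(2)] by metis
  have s: "cvec.span B = U" "cvec.span C = W" using B C assms cvec.span_subspace by blast+
  have "cvec.span B \<inter> cvec.span C = {0}"
    using s assms(5) cvec.subspace_0[OF assms(3)] cvec.subspace_0[OF assms(4)] by auto
  then have i: "cvec.independent (B \<union> C)" "B \<inter> C = {}"
    using independent_Un[OF C(1) B(3) C(3)] by simp_all
  have "{u + w | u w. u \<in> U \<and> w \<in> W} = cvec.span (B \<union> C)"
    by (simp add: cvec.span_Un s)
  then show "finite_cdim {u + w | u w. u \<in> U \<and> w \<in> W}"
    and "cvec.dim {u + w | u w. u \<in> U \<and> w \<in> W} = cvec.dim U + cvec.dim W"
    using B C i cvec.dim_eq_card_independent[OF i(1)]
    by (simp_all add: finite_cdim_span card_Un_disjoint)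
qed

lemma cdim_disjoint_sum_le:
  assumes "finite_cdim Z" "cvec.subspace Z" "U \<subseteq> Z" "W \<subseteq> Z"
    and "cvec.subspace U" "cvec.subspace W" "U \<inter> W \<subseteq> {0}"
  shows "cvec.dim U + cvec.dim W \<le> cvec.dim Z"
proof -
  have "{u + w | u w. u \<in> U \<and> w \<in> W} \<subseteq> Z" using assms cvec.subspace_add by blast
  then have "cvec.dim {u + w | u w. u \<in> U \<and> w \<in> W} \<le> cvec.dim Z" by (rule cdim_mono[OF assms(1)])
  then show ?thesis
    using cdim_direct_sum(2)[OF finite_cdim_mono[OF assms(1,3)] finite_cdim_mono[OF assms(1,4)] assms(5-7)]
    by simp
qed

lemma cdim_kernel_functional:
  assumes "finite_cdim V" "cvec.subspace V" "functional_on V \<phi>"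
  shows "cvec.dim V \<le> cvec.dim {x \<in> V. \<phi> x = 0} + 1"
proof (cases "\<forall>x \<in> V. \<phi> x = 0")
  case True
  then have "{x \<in> V. \<phi> x = 0} = V" by auto
  then show ?thesis by simp
next
  case False
  then obtain v where v: "v \<in> V" "\<phi> v \<noteq> 0" by auto
  let ?K = "{x \<in> V. \<phi> x = 0}"
  obtain B where B: "finite B" "?K \<subseteq> cvec.span B" "card B = cvec.dim ?K"
    using finite_basis[OF finite_cdim_mono[OF assms(1), of ?K]] by (metis (no_types, lifting) mem_Collect_eq subsetI)
  have "V \<subseteq> cvec.span (insert v B)"
  proof
    fix x assume x: "x \<in> V"
    let ?c = "\<phi> x / \<phi> v"
    have cv: "?c *c v \<in> V" using v assms(2) cvec.subspace_scale by blast
    have "\<phi> (x - ?c *c v) = 0"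
      using functional_on_diff[OF assms(3,2) x cv] functional_onD(2)[OF assms(3) v(1)] v by simp
    then have "x - ?c *c v \<in> ?K" using x cv assms(2) cvec.subspace_diff by blast
    then show "x \<in> cvec.span (insert v B)" using B cvec.span_breakdown_eq by blast
  qed
  then have "cvec.dim V \<le> card (insert v B)" using B by (intro cvec.dim_le_card) auto
  then show ?thesis using B card_insert_le_m1 by (metis (no_types, lifting) Suc_eq_plus1 card_insert_if le_SucI)
qed

lemma cdim_common_kernel:
  assumes "finite \<Phi>" "finite_cdim V" "cvec.subspace V" "\<And>\<phi>. \<phi> \<in> \<Phi> \<Longrightarrow> functional_on V \<phi>"
  shows "cvec.subspace {x \<in> V. \<forall>\<phi> \<in> \<Phi>. \<phi> x = 0} \<and>
    cvec.dim V \<le> cvec.dim {x \<in> V. \<forall>\<phi> \<in> \<Phi>. \<phi> x = 0} + card \<Phi>"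
  using assms(1,4)
proof (induction \<Phi>)
  case empty
  then show ?case using assms by simp
next
  case (insert \<phi> \<Phi>)
  let ?K = "{x \<in> V. \<forall>\<phi> \<in> \<Phi>. \<phi> x = 0}"
  have IH: "cvec.subspace ?K" "cvec.dim V \<le> cvec.dim ?K + card \<Phi>" using insert by auto
  have f: "functional_on ?K \<phi>" using insert.prems functional_on_mono[of V \<phi> ?K] by blast
  have e: "{x \<in> V. \<forall>\<phi> \<in> insert \<phi> \<Phi>. \<phi> x = 0} = {x \<in> ?K. \<phi> x = 0}" by auto
  show ?case unfolding e
    using cdim_kernel_functional[OF finite_cdim_mono[OF assms(2), of ?K] IH(1) f] IH(2)
      subspace_kernel_functional[OF f IH(1)] insert.hyps by auto
qed

text \<open>The counting device behind most existence claims below: orthogonal projections for a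
  form, vectors omega-orthogonal to a proper subspace, and finally the pair (f, y) itself.\<close>

lemma common_kernel_nontrivial:
  assumes "finite \<Phi>" "finite_cdim V" "cvec.subspace V" "\<And>\<phi>. \<phi> \<in> \<Phi> \<Longrightarrow> functional_on V \<phi>"
    and "card \<Phi> < cvec.dim V"
  obtains x where "x \<in> V" "x \<noteq> 0" "\<And>\<phi>. \<phi> \<in> \<Phi> \<Longrightarrow> \<phi> x = 0"
proof -
  let ?K = "{x \<in> V. \<forall>\<phi> \<in> \<Phi>. \<phi> x = 0}"
  have "0 < cvec.dim ?K" using cdim_common_kernel[OF assms(1-4)] assms(5) by linarith
  then have "\<not> ?K \<subseteq> {0}" using cvec.dim_le_card[of ?K "{}"] by auto
  then show ?thesis using that by blast
qed

section \<open>Hermitian forms: projections, null vectors, maximal negative subspaces\<close>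

lemma hermitian_projection:
  assumes q: "hermitian_on Z q" "cvec.subspace Z"
    and W: "cvec.subspace W" "finite_cdim W" "W \<subseteq> Z" "\<And>w. w \<in> W \<Longrightarrow> w \<noteq> 0 \<Longrightarrow> q w w \<noteq> 0"
    and x: "x \<in> Z"
  obtains z where "z \<in> W" "\<And>w. w \<in> W \<Longrightarrow> q w (x - z) = 0"
proof (cases "x \<in> W")
  case True
  have "q w (x - x) = 0" if "w \<in> W" for w
  proof -
    have "w \<in> Z" using that W(3) by blast
    then show ?thesis
      using functional_on_zero[OF hermitian_onD(2)[OF q(1)] cvec.subspace_0[OF q(2)]] by simp
  qed
  then show ?thesis using that True by blast
next
  case False
  obtain B where B: "finite B" "B \<subseteq> W" "cvec.independent B" "W \<subseteq> cvec.span B" "card B = cvec.dim W"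
    using finite_basis[OF W(2)] by metis
  have sB: "cvec.span B = W" using B W cvec.span_subspace by blast
  let ?U = "cvec.span (insert x B)"
  have UZ: "?U \<subseteq> Z" using x B(2) W(3) q(2) by (intro cvec.span_minimal) auto
  have "cvec.independent (insert x B)" "x \<notin> B"
    using False B sB cvec.independent_insertI by blast+
  then have dU: "cvec.dim ?U = card B + 1"
    using B(1) by (simp add: cvec.dim_eq_card_independent)
  have fU: "functional_on ?U (q b)" if "b \<in> B" for b
    using hermitian_onD(2)[OF q(1), of b b] functional_on_mono UZ that B(2) W(3) by blast
  \<comment> \<open>\<open>card B\<close> orthogonality conditions on a space of dimension
    \<open>card B + 1\<close> leave a nonzero s. Since q does not vanish on nonzero diagonal
    elements of W, s is not in W, so its x-coefficient k is nonzero; dividing by k turns s into x -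
    z.\<close>
  have "card (q ` B) < cvec.dim ?U" using dU card_image_le[OF B(1), of q] by simp
  then obtain s where s: "s \<in> ?U" "s \<noteq> 0" "\<And>b. b \<in> B \<Longrightarrow> q b s = 0"
    by (rule common_kernel_nontrivial[of "q ` B" ?U, rotated 4])
      (use fU B(1) finite_cdim_span[of "insert x B"] in auto)
  have sZ: "s \<in> Z" using s UZ by blast
  have "cvec.span B \<subseteq> {w \<in> Z. q w s = 0}"
    using B W s by (intro cvec.span_minimal subspace_hermitian_left_kernel[OF q sZ]) auto
  then have qs: "q w s = 0" if "w \<in> W" for w using that sB by blast
  obtain k where k: "s - k *c x \<in> W" using s(1) sB cvec.span_breakdown_eq by blast
  have k0: "k \<noteq> 0"
  proof
    assume "k = 0"
    then have "s \<in> W" using k by simp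
    then show False using qs W(4) s(2) by blast
  qed
  define z where "z = - (inverse k *c (s - k *c x))"
  have zW: "z \<in> W" unfolding z_def using k W(1) cvec.subspace_neg cvec.subspace_scale by blast
  have xz: "x - z = inverse k *c s"
    unfolding z_def using k0 by (simp add: cvec.scale_right_diff_distrib)
  have "q w (x - z) = 0" if "w \<in> W" for w
    unfolding xz using functional_onD(2)[OF hermitian_onD(2)[OF q(1)], of w w s] qs[OF that] that W(3) sZ
    by auto
  then show ?thesis using that zW by blast
qed

text \<open>A degenerate case of Cauchy-Schwarz: if q y x were nonzero, a small step from y in a
  suitable multiple of x would make the form negative.\<close>

lemma hermitian_null_vector:
  assumes q: "hermitian_on V q" "cvec.subspace V"
    and U: "cvec.subspace U" "U \<subseteq> V" "\<And>x. x \<in> U \<Longrightarrow> 0 \<le> Re (q x x)"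
    and y: "y \<in> U" "Re (q y y) = 0" and x: "x \<in> U"
  shows "q y x = 0"
proof (rule ccontr)
  assume ne: "q y x \<noteq> 0"
  \<comment> \<open>With the c below, the value at y + c x is \<epsilon> |q y x|^2 (\<epsilon> q x x
    - 2); this \<epsilon> keeps \<epsilon> q x x below 1, whatever the size of q x x.\<close>
  define \<epsilon> where "\<epsilon> = 1 / (\<bar>Re (q x x)\<bar> + 1)"
  define c where "c = - (of_real \<epsilon> * cnj (q y x))"
  have \<epsilon>: "0 < \<epsilon>" "\<epsilon> * Re (q x x) < 1" unfolding \<epsilon>_def by (auto simp: divide_simps)
  have V: "x \<in> V" "y \<in> V" "c *c x \<in> V" using x y U cvec.subspace_scale q(2) by blast+
  have "y + c *c x \<in> U" using x y U cvec.subspace_add cvec.subspace_scale by blast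
  then have "0 \<le> Re (q (y + c *c x) (y + c *c x))" by (rule U(3))
  also have "\<dots> = 2 * Re (c * q y x) + (cmod c)\<^sup>2 * Re (q x x)"
    using hermitian_on_add_diag[OF q V(2,3)] hermitian_on_scale_diag[OF q V(1), of c] y(2)
      functional_onD(2)[OF hermitian_onD(2)[OF q(1) V(2,2)] V(1), of c] by simp
  also have "c * q y x = - of_real (\<epsilon> * (cmod (q y x))\<^sup>2)"
    unfolding c_def using complex_norm_square[of "q y x"] by (simp add: mult.commute)
  also have "(cmod c)\<^sup>2 = \<epsilon> * \<epsilon> * (cmod (q y x))\<^sup>2"
    unfolding c_def using \<epsilon>(1) by (simp add: norm_mult power2_eq_square)
  finally have "0 \<le> (\<epsilon> * (cmod (q y x))\<^sup>2) * (\<epsilon> * Re (q x x) - 2)" by (simp add: algebra_simps)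
  moreover have "0 < \<epsilon> * (cmod (q y x))\<^sup>2" using \<epsilon>(1) ne by simp
  ultimately show False using \<epsilon>(2) by (simp add: zero_le_mult_iff)
qed

text \<open>W attains the maximum in \<open>n_minus\<close>. A vector orthogonal to W with negative
  value could be adjoined to W, which would contradict maximality; hence the nonnegativity in the
  last clause.\<close>

lemma n_minus_witness:
  assumes q: "hermitian_on V q" "cvec.subspace V" "finite_cdim V"
  obtains W where "cvec.subspace W" "W \<subseteq> V" "cvec.dim W = n_minus V q"
    "\<And>u. u \<in> W \<Longrightarrow> u \<noteq> 0 \<Longrightarrow> Re (q u u) < 0"
    "\<And>x. x \<in> V \<Longrightarrow> (\<And>w. w \<in> W \<Longrightarrow> q w x = 0) \<Longrightarrow> 0 \<le> Re (q x x)"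
proof -
  let ?P = "\<lambda>W. cvec.subspace W \<and> W \<subseteq> V \<and> (\<forall>u \<in> W. u \<noteq> 0 \<longrightarrow> Re (q u u) < 0)"
  let ?D = "{cvec.dim W | W. ?P W}"
  have fin: "finite ?D"
    by (rule finite_subset[of _ "{..cvec.dim V}"]) (auto intro: cdim_mono[OF q(3)])
  have "?P {0}" using q(2) cvec.subspace_0 by auto
  then have ne: "?D \<noteq> {}" by blast
  have nm: "n_minus V q = Max ?D" unfolding n_minus_def by (rule arg_cong[of _ _ Max]) blast
  obtain W where W: "?P W" "cvec.dim W = n_minus V q"
    using Max_in[OF fin ne] nm by fastforce
  have sW: "cvec.subspace W" and WV: "W \<subseteq> V" using W(1) by simp_all
  have "0 \<le> Re (q x x)" if x: "x \<in> V" "\<And>w. w \<in> W \<Longrightarrow> q w x = 0" for x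
  proof (rule ccontr)
    assume neg: "\<not> 0 \<le> Re (q x x)"
    have xW: "x \<notin> W" using x(2)[of x] neg by force
    obtain B where B: "finite B" "B \<subseteq> W" "cvec.independent B" "W \<subseteq> cvec.span B" "card B = cvec.dim W"
      using finite_basis[OF finite_cdim_mono[OF q(3) WV]] by metis
    have sB: "cvec.span B = W" using cvec.span_subspace[OF B(2,4) sW] .
    let ?U = "cvec.span (insert x B)"
    have "cvec.independent (insert x B)" "x \<notin> B"
      using xW B sB cvec.independent_insertI by blast+
    then have dU: "cvec.dim ?U = cvec.dim W + 1"
      using B(1,5) by (simp add: cvec.dim_eq_card_independent)
    have UV: "?U \<subseteq> V" using x(1) B(2) W(1) q(2) by (intro cvec.span_minimal) auto
    have "Re (q u u) < 0" if u: "u \<in> ?U" "u \<noteq> 0" for u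
    proof -
      obtain k where k: "u - k *c x \<in> W" using u(1) sB cvec.span_breakdown_eq by blast
      let ?w = "u - k *c x"
      have kx: "k *c x \<in> V" using x(1) q(2) cvec.subspace_scale by blast
      have wV: "?w \<in> V" using k W(1) by blast
      have "q ?w (k *c x) = 0"
        using functional_onD(2)[OF hermitian_onD(2)[OF q(1) wV wV] x(1)] x(2)[OF k] by simp
      then have e: "Re (q u u) = Re (q ?w ?w) + (cmod k)\<^sup>2 * Re (q x x)"
        using hermitian_on_add_diag[OF q(1,2) wV kx] hermitian_on_scale_diag[OF q(1,2) x(1)] by simp
      show ?thesis
      proof (cases "k = 0")
        case True
        then show ?thesis using W(1) k u(2) by auto
      next
        case False
        then have "(cmod k)\<^sup>2 * Re (q x x) < 0" using neg by (simp add: mult_less_0_iff)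
        moreover have "Re (q ?w ?w) \<le> 0"
        proof (cases "?w = 0")
          case True
          then show ?thesis using functional_on_zero[OF hermitian_onD(2)[OF q(1) wV wV]] q(2) cvec.subspace_0 by force
        next
          case False
          then show ?thesis using W(1) k by force
        qed
        ultimately show ?thesis using e by linarith
      qed
    qed
    then have "?P ?U" using UV by blast
    then have "cvec.dim ?U \<in> ?D" by (intro CollectI exI[of _ ?U] conjI[OF refl])
    then show False using Max_ge[OF fin] nm W(2) dU by fastforce
  qed
  then show ?thesis using that[of W] W by blast
qed

lemma finite_cdim_Times:
  fixes V :: "'a::complex_vector set" and W :: "'b::complex_vector set"
  assumes "finite_cdim V" "finite_cdim W" "cvec.subspace V" "cvec.subspace W"
  shows "finite_cdim (V \<times> W)" "cvec.subspace (V \<times> W)"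
    "cvec.dim V + cvec.dim W = cvec.dim (V \<times> W)"
proof -
  have image: "finite_cdim (f ` U) \<and> cvec.subspace (f ` U) \<and> cvec.dim (f ` U) = cvec.dim U"
    if U: "finite_cdim U" "cvec.subspace U"
      and f: "Vector_Spaces.linear scaleC scaleC f" "inj f"
    for U :: "'c::complex_vector set" and f :: "'c \<Rightarrow> 'a \<times> 'b"
  proof -
    interpret f: Vector_Spaces.linear scaleC scaleC f by (rule f(1))
    obtain B where B: "finite B" "B \<subseteq> U" "cvec.independent B" "U \<subseteq> cvec.span B" "card B = cvec.dim U"
      using finite_basis[OF U(1)] by metis
    have sB: "cvec.span B = U" using B U cvec.span_subspace by blast
    have i: "inj_on f X" for X using f(2) using inj_on_subset by blast
    have "cvec.independent (f ` B)" using f.independent_injective_image[OF B(3) i] .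
    moreover have "f ` U = cvec.span (f ` B)" using f.span_image sB by blast
    ultimately show ?thesis
      using B(1,5) card_image[OF i] by (auto simp: finite_cdim_span cvec.dim_eq_card_independent)
  qed
  have l: "Vector_Spaces.linear scaleC scaleC (\<lambda>v::'a. (v, 0::'b))"
    "Vector_Spaces.linear scaleC scaleC (\<lambda>w::'b. (0::'a, w))"
    by (auto simp: Vector_Spaces.linear_iff scaleC_prod_def cvec.vector_space_axioms)
  have i: "inj (\<lambda>v::'a. (v, 0::'b))" "inj (\<lambda>w::'b. (0::'a, w))" by (auto intro: injI)
  have e: "V \<times> W = {u + w | u w. u \<in> (\<lambda>v. (v, 0)) ` V \<and> w \<in> (\<lambda>w. (0, w)) ` W}"
    by (auto simp: image_iff)
  let ?V = "(\<lambda>v::'a. (v, 0::'b)) ` V" and ?W = "(\<lambda>w::'b. (0::'a, w)) ` W"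
  have V: "finite_cdim ?V" "cvec.subspace ?V" "cvec.dim ?V = cvec.dim V"
    and W: "finite_cdim ?W" "cvec.subspace ?W" "cvec.dim ?W = cvec.dim W"
    using image[OF assms(1,3) l(1) i(1)] image[OF assms(2,4) l(2) i(2)] by blast+
  have "?V \<inter> ?W \<subseteq> {0}" by (auto simp: zero_prod_def)
  then show "finite_cdim (V \<times> W)" "cvec.dim V + cvec.dim W = cvec.dim (V \<times> W)"
    unfolding e using cdim_direct_sum[OF V(1) W(1) V(2) W(2)] V(3) W(3) by simp_all
  show "cvec.subspace (V \<times> W)"
    using assms(3,4) by (simp add: cvec.subspace_def scaleC_prod_def mem_Times_iff)
qed

section \<open>Lagrangian planes\<close>

lemma cinner_commute': "cnj (cinner y x) = cinner x y"
  using cinner_commute[of x y] by simp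

lemma cinner_add_left: "cinner (x + y) z = cinner x z + cinner y z"
  using cinner_commute[of "x + y" z] cinner_commute[of x z] cinner_commute[of y z]
  by (simp add: cinner_add_right)

lemma cinner_scaleC_left: "cinner (a *c x) y = cnj a * cinner x y"
  using cinner_commute[of "a *c x" y] cinner_commute[of x y] by (simp add: cinner_scaleC_right)

lemma cinner_zero_right [simp]: "cinner x 0 = 0"
  using cinner_add_right[of x 0 0] by simp

lemma cinner_zero_left [simp]: "cinner 0 x = 0"
  using cinner_add_left[of 0 0 x] by simp

lemma cinner_minus_right [simp]: "cinner x (- y) = - cinner x y"
  using cinner_add_right[of x y "- y"] by (simp add: eq_neg_iff_add_eq_0 add.commute)

lemma cinner_minus_left [simp]: "cinner (- x) y = - cinner x y"
  using cinner_add_left[of x "- x" y] by (simp add: eq_neg_iff_add_eq_0 add.commute)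

lemma cinner_diff_right: "cinner x (y - z) = cinner x y - cinner x z"
  using cinner_add_right[of x y "- z"] by simp

lemma cinner_diff_left: "cinner (x - y) z = cinner x z - cinner y z"
  using cinner_add_left[of x "- y" z] by simp

lemma cinner_scaleR_right: "cinner x (r *\<^sub>R y) = of_real r * cinner x y"
  by (metis cinner_scaleC_right scaleC_of_real)

lemma cinner_scaleR_left: "cinner (r *\<^sub>R x) y = of_real r * cinner x y"
  by (metis cinner_scaleC_left scaleC_of_real complex_cnj_complex_of_real)

lemma cinner_self: "cinner x x = of_real ((norm x)\<^sup>2)"
proof (rule complex_eqI)
  show "Re (cinner x x) = Re (of_real ((norm x)\<^sup>2))"
    by (simp add: inner_eq_Re_cinner[symmetric] power2_norm_eq_inner)
  have "Im (cinner x x) = Im (cnj (cinner x x))" by (rule arg_cong[OF cinner_commute])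
  then show "Im (cinner x x) = Im (of_real ((norm x)\<^sup>2))" by simp
qed

lemma cinner_self_eq_0_iff [simp]: "cinner x x = 0 \<longleftrightarrow> x = 0"
  by (simp add: cinner_self)

lemma hermitian_on_cinner: "hermitian_on V cinner"
  unfolding hermitian_on_def functional_on_def
  using cinner_commute by (auto simp: cinner_add_right cinner_scaleC_right)

lemma scaleC_fst [simp]: "fst (a *c u) = a *c fst u" and scaleC_snd [simp]: "snd (a *c u) = a *c snd u"
  by (simp_all add: scaleC_prod_def)

lemma omega_add_right: "omega u (v + w) = omega u v + omega u w"
  by (simp add: omega_def cinner_add_right)

lemma omega_scaleC_right: "omega u (a *c v) = a * omega u v"
  by (simp add: omega_def cinner_scaleC_right right_diff_distrib)

lemma omega_commute: "omega u v = - cnj (omega v u)"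
  by (simp add: omega_def cinner_commute')

lemma omega_add_left: "omega (u + v) w = omega u w + omega v w"
  by (simp add: omega_def cinner_add_left)

lemma omega_scaleC_left: "omega (a *c u) v = cnj a * omega u v"
  by (simp add: omega_def cinner_scaleC_left right_diff_distrib)

lemma omega_minus_right: "omega u (- v) = - omega u v"
  by (simp add: omega_def)

lemma omega_minus_left: "omega (- u) v = - omega u v"
  by (simp add: omega_def)

lemma omega_diff_right: "omega u (v - w) = omega u v - omega u w"
  using omega_add_right[of u v "- w"] by (simp add: omega_minus_right)

lemma omega_zero [simp]: "omega u 0 = 0" "omega 0 u = 0"
  by (simp_all add: omega_def)

lemmas omega_simps = omega_add_right omega_add_left omega_scaleC_right omega_scaleC_left
  omega_minus_right omega_minus_left omega_diff_right

lemma omega_eq_0_commute: "omega u v = 0 \<longleftrightarrow> omega v u = 0"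
  using omega_commute[of u v] by simp

text \<open>Expresses the inner product of the doubled boundary space through \<open>omega\<close>,
  so that orthogonality to u can be imposed by a functional of the same kind as the symplectic
  conditions.\<close>

lemma omega_rotate: "omega (snd u, - fst u) v = cinner (fst u) (fst v) + cinner (snd u) (snd v)"
  by (simp add: omega_def)

lemma omega_rotate_self: "omega (snd u, - fst u) u = 0 \<Longrightarrow> u = 0"
proof -
  assume "omega (snd u, - fst u) u = 0"
  then have "complex_of_real ((norm (fst u))\<^sup>2 + (norm (snd u))\<^sup>2) = 0"
    by (simp add: omega_rotate cinner_self)
  then have "(norm (fst u))\<^sup>2 + (norm (snd u))\<^sup>2 = 0" using of_real_eq_0_iff by blast
  then show "u = 0" by (simp add: sum_power2_eq_zero_iff prod_eq_iff)
qed

lemma functional_on_omega: "functional_on V (omega u)"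
  by (simp add: functional_on_def omega_simps)

lemma subspace_omega_left_kernel: "cvec.subspace {u. omega u v = 0}"
  by (rule cvec.subspaceI) (simp_all add: omega_simps)

section \<open>Transversal Lagrangian planes and their graph maps\<close>

lemma lagrangian_subspace: "lagrangian L \<Longrightarrow> cvec.subspace L"
  by (simp add: lagrangian_def)

lemma lagrangian_omega: "lagrangian L \<Longrightarrow> u \<in> L \<Longrightarrow> v \<in> L \<Longrightarrow> omega u v = 0"
  unfolding lagrangian_def by blast

lemma lagrangianD: "lagrangian L \<Longrightarrow> (\<And>v. v \<in> L \<Longrightarrow> omega u v = 0) \<Longrightarrow> u \<in> L"
  unfolding lagrangian_def by blast

text \<open>If the sum of the planes were proper, a dimension count would give a nonzero v that is
  omega-orthogonal to both planes; being Lagrangian, both would contain v.\<close>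

lemma lagrangian_decompose:
  fixes L M :: "('k::chilbert_space \<times> 'k) set"
  assumes fin: "finite_cdim (UNIV :: 'k set)"
    and L: "lagrangian L" and M: "lagrangian M" and LM: "L \<inter> M \<subseteq> {0}"
  obtains u w where "u \<in> L" "w \<in> M" "x = u + w"
proof -
  let ?U = "{u + w | u w. u \<in> L \<and> w \<in> M}"
  have finK: "finite_cdim (UNIV :: ('k \<times> 'k) set)"
    using finite_cdim_Times(1)[OF fin fin] by simp
  have sL: "cvec.subspace L" "cvec.subspace M" using L M lagrangian_subspace by auto
  then have sU: "cvec.subspace ?U" by (rule cvec.subspace_sums)
  have LU: "L \<subseteq> ?U"
  proof
    fix u assume "u \<in> L"
    then show "u \<in> ?U" using cvec.subspace_0[OF sL(2)] by (intro CollectI exI[of _ u] exI[of _ 0]) simp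
  qed
  have MU: "M \<subseteq> ?U"
  proof
    fix u assume "u \<in> M"
    then show "u \<in> ?U" using cvec.subspace_0[OF sL(1)] by (intro CollectI exI[of _ 0] exI[of _ u]) simp
  qed
  have "?U = UNIV"
  proof (rule ccontr)
    assume "?U \<noteq> UNIV"
    then have less: "cvec.dim ?U < cvec.dim (UNIV :: ('k \<times> 'k) set)"
      using cdim_eq_subspace[OF finK sU] by (meson not_le subset_UNIV)
    obtain B where B: "finite B" "B \<subseteq> ?U" "?U \<subseteq> cvec.span B" "card B = cvec.dim ?U"
      using finite_basis[OF finite_cdim_mono[OF finK subset_UNIV[of ?U]]] by (metis (no_types, lifting))
    have "card (omega ` B) < cvec.dim (UNIV :: ('k \<times> 'k) set)"
      using card_image_le[OF B(1), of omega] B(4) less by simp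
    then obtain v where v: "v \<noteq> 0" "\<And>\<phi>. \<phi> \<in> omega ` B \<Longrightarrow> \<phi> v = 0"
      by (rule common_kernel_nontrivial[of "omega ` B" UNIV, rotated 4])
        (use B(1) finK functional_on_omega in auto)
    have "cvec.span B \<subseteq> {u. omega u v = 0}"
      by (intro cvec.span_minimal subspace_omega_left_kernel) (use v in auto)
    then have "?U \<subseteq> {u. omega u v = 0}" using B(3) by (rule subset_trans[rotated])
    then have z: "omega v u = 0" if "u \<in> ?U" for u
      using that omega_eq_0_commute[of v u] by blast
    have "v \<in> L" by (rule lagrangianD[OF L z[OF subsetD[OF LU]]])
    moreover have "v \<in> M" by (rule lagrangianD[OF M z[OF subsetD[OF MU]]])
    ultimately
    show False using LM v(1) by blast
  qed
  then have "x \<in> ?U" by blast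
  then show ?thesis using that by blast
qed

lemma graph_map_unique:
  assumes "lagrangian \<beta>" "lagrangian \<gamma>" "\<beta> \<inter> \<gamma> \<subseteq> {0}" "w \<in> \<beta>" "u + w \<in> \<gamma>"
  shows "graph_map \<alpha> \<beta> \<gamma> u = w"
  unfolding graph_map_def
proof (rule the_equality)
  show "w \<in> \<beta> \<and> u + w \<in> \<gamma>" using assms by blast
next
  fix w' assume w': "w' \<in> \<beta> \<and> u + w' \<in> \<gamma>"
  have "w' - w \<in> \<beta>" using assms w' lagrangian_subspace cvec.subspace_diff by blast
  moreover have "(u + w') - (u + w) \<in> \<gamma>" using assms w' lagrangian_subspace cvec.subspace_diff by blast
  ultimately have "w' - w = 0" using assms(3) by auto
  then show "w' = w" by simp
qed

locale transversal_planes =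
  fixes \<alpha> \<beta> \<gamma> :: "('k::chilbert_space \<times> 'k) set"
  assumes fin: "finite_cdim (UNIV :: 'k set)"
    and lag: "lagrangian \<alpha>" "lagrangian \<beta>" "lagrangian \<gamma>"
    and disj: "\<beta> \<inter> \<alpha> \<subseteq> {0}" "\<beta> \<inter> \<gamma> \<subseteq> {0}"
begin

text \<open>Writing u = f + w with f in \<gamma> and w in \<beta>, the map sends u to -w: it is the
  negative of the projection onto \<beta> along \<gamma>. Hence it is defined and linear on the
  whole space and not only on \<alpha>.\<close>

lemma graph_map_mem:
  "graph_map \<alpha> \<beta> \<gamma> u \<in> \<beta>" "u + graph_map \<alpha> \<beta> \<gamma> u \<in> \<gamma>"
proof -
  obtain f w where fw: "f \<in> \<gamma>" "w \<in> \<beta>" "u = f + w"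
    using lagrangian_decompose[OF fin lag(3,2)] disj(2) by blast
  have "- w \<in> \<beta>" "u + - w \<in> \<gamma>"
    using fw cvec.subspace_neg[OF lagrangian_subspace[OF lag(2)]] by auto
  moreover from this have "graph_map \<alpha> \<beta> \<gamma> u = - w"
    by (intro graph_map_unique lag disj)
  ultimately show "graph_map \<alpha> \<beta> \<gamma> u \<in> \<beta>" "u + graph_map \<alpha> \<beta> \<gamma> u \<in> \<gamma>" by auto
qed

lemma graph_map_add: "graph_map \<alpha> \<beta> \<gamma> (u + v) = graph_map \<alpha> \<beta> \<gamma> u + graph_map \<alpha> \<beta> \<gamma> v"
proof (intro graph_map_unique lag disj)
  show "graph_map \<alpha> \<beta> \<gamma> u + graph_map \<alpha> \<beta> \<gamma> v \<in> \<beta>"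
    using graph_map_mem cvec.subspace_add lagrangian_subspace lag by blast
  have "(u + graph_map \<alpha> \<beta> \<gamma> u) + (v + graph_map \<alpha> \<beta> \<gamma> v) \<in> \<gamma>"
    using graph_map_mem cvec.subspace_add lagrangian_subspace lag by blast
  then show "u + v + (graph_map \<alpha> \<beta> \<gamma> u + graph_map \<alpha> \<beta> \<gamma> v) \<in> \<gamma>" by (simp add: algebra_simps)
qed

lemma graph_map_scaleC: "graph_map \<alpha> \<beta> \<gamma> (a *c u) = a *c graph_map \<alpha> \<beta> \<gamma> u"
proof (intro graph_map_unique lag disj)
  show "a *c graph_map \<alpha> \<beta> \<gamma> u \<in> \<beta>"
    using graph_map_mem cvec.subspace_scale lagrangian_subspace lag by blast
  have "a *c (u + graph_map \<alpha> \<beta> \<gamma> u) \<in> \<gamma>"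
    using graph_map_mem cvec.subspace_scale lagrangian_subspace lag by blast
  then show "a *c u + a *c graph_map \<alpha> \<beta> \<gamma> u \<in> \<gamma>" by (simp add: scaleC_add_right)
qed

lemma graph_map_zero: "graph_map \<alpha> \<beta> \<gamma> 0 = 0"
  using graph_map_scaleC[of 0 0] by simp

text \<open>\<gamma> is isotropic; of the four terms of \<open>omega\<close> on two of its elements,
  the two inside \<alpha> and inside \<beta> vanish. The remaining identity is the Hermitian
  symmetry of \<open>Q_form\<close>.\<close>

lemma omega_graph_map_swap:
  assumes "u \<in> \<alpha>" "v \<in> \<alpha>"
  shows "omega (graph_map \<alpha> \<beta> \<gamma> u) v = - omega u (graph_map \<alpha> \<beta> \<gamma> v)"
proof -
  have "omega (u + graph_map \<alpha> \<beta> \<gamma> u) (v + graph_map \<alpha> \<beta> \<gamma> v) = 0"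
    using graph_map_mem lagrangian_omega[OF lag(3)] by blast
  moreover have "omega u v = 0" "omega (graph_map \<alpha> \<beta> \<gamma> u) (graph_map \<alpha> \<beta> \<gamma> v) = 0"
    using lagrangian_omega[OF lag(1) assms] lagrangian_omega[OF lag(2)] graph_map_mem by blast+
  ultimately show ?thesis by (simp add: omega_simps eq_neg_iff_add_eq_0 add.commute)
qed

lemma hermitian_on_Q_form: "hermitian_on \<alpha> (Q_form \<alpha> \<beta> \<gamma>)"
  unfolding hermitian_on_def functional_on_def Q_form_def
proof (intro conjI ballI)
  fix u v assume "u \<in> \<alpha>" "v \<in> \<alpha>"
  then show "omega u (graph_map \<alpha> \<beta> \<gamma> v) = cnj (omega v (graph_map \<alpha> \<beta> \<gamma> u))"
    using omega_graph_map_swap[of u v] omega_commute[of "graph_map \<alpha> \<beta> \<gamma> u" v] by simp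
qed (simp_all add: graph_map_add graph_map_scaleC omega_simps)

end

text \<open>The graphs of real multiples of the identity are the candidates for the auxiliary plane
  of the index.\<close>

lemma lagrangian_slope:
  fixes s :: real
  shows "lagrangian {(x :: 'k::chilbert_space, of_real s *c x) | x. True}" (is "lagrangian ?M")
  unfolding lagrangian_def
proof (intro conjI equalityI subsetI)
  show "cvec.subspace ?M"
  proof (rule cvec.subspaceI)
    show "0 \<in> ?M" by (auto simp: zero_prod_def)
  qed (auto simp: scaleC_prod_def scaleC_add_right mult.commute)
next
  fix u assume "u \<in> ?M"
  then show "u \<in> {u. \<forall>v \<in> ?M. omega u v = 0}"
    by (auto simp: omega_def cinner_scaleC_left cinner_scaleC_right)
next
  fix u :: "'k \<times> 'k" assume u: "u \<in> {u. \<forall>v \<in> ?M. omega u v = 0}"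
  \<comment> \<open>Testing u against the element of the plane over ?d yields exactly the squared
    norm of ?d, the defect of u from lying in the plane.\<close>
  let ?d = "of_real s *c fst u - snd u"
  have "omega u (?d, of_real s *c ?d) = 0" using u by blast
  then have "cinner ?d ?d = 0"
    by (simp add: omega_def cinner_diff_left cinner_scaleC_right cinner_scaleC_left)
  then show "u \<in> ?M" by (auto intro!: exI[of _ "fst u"] prod_eqI)
qed

text \<open>Slopes behave like eigenvalues of L regarded as a self-adjoint relation:
  \<open>omega\<close> of (x, r x) and (y, s y) is (s - r) times the inner product of x and y, so
  vectors with distinct slopes are orthogonal. A slope outside the finite exceptional sets gives a
  transversal plane.\<close>

lemma lagrangian_finite_slopes:
  fixes L :: "('k::chilbert_space \<times> 'k) set"
  assumes fin: "finite_cdim (UNIV :: 'k set)" and L: "lagrangian L"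
  shows "finite {s :: real. \<exists>x. x \<noteq> 0 \<and> (x, of_real s *c x) \<in> L}" (is "finite ?E")
proof -
  obtain X where X: "\<And>s. s \<in> ?E \<Longrightarrow> X s \<noteq> 0 \<and> (X s, of_real s *c X s) \<in> L"
    using bchoice[of ?E "\<lambda>s x. x \<noteq> 0 \<and> (x, of_real s *c x) \<in> L"] by auto
  have orth: "cinner (X r) (X s) = 0" if "r \<in> ?E" "s \<in> ?E" "r \<noteq> s" for r s
  proof -
    have "omega (X r, of_real r *c X r) (X s, of_real s *c X s) = 0"
      using X that(1,2) lagrangian_omega[OF L] by blast
    then have "(of_real s - of_real r) * cinner (X r) (X s) = 0"
      by (simp add: omega_def cinner_scaleC_left cinner_scaleC_right left_diff_distrib)
    then show ?thesis using that(3) by simp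
  qed
  have inj: "inj_on X ?E" using orth X by (metis (no_types, lifting) cinner_self_eq_0_iff inj_onI)
  have "X r \<notin> cvec.span (X ` ?E - {X r})" if r: "r \<in> ?E" for r
  proof
    assume m: "X r \<in> cvec.span (X ` ?E - {X r})"
    have "cvec.span (X ` ?E - {X r}) \<subseteq> {x \<in> UNIV. cinner (X r) x = 0}"
    proof (intro cvec.span_minimal subspace_kernel_functional)
      show "X ` ?E - {X r} \<subseteq> {x \<in> UNIV. cinner (X r) x = 0}" using orth r by auto
    qed (simp_all add: functional_on_def cinner_add_right cinner_scaleC_right)
    then show False using m X[OF r] by auto
  qed
  then have "cvec.independent (X ` ?E)" unfolding cvec.dependent_def by auto
  then have "finite (X ` ?E)" using independent_finite[OF fin] by blast
  then show ?thesis using inj finite_imageD by blast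
qed

lemma transversal_lagrangian_exists:
  fixes \<A> :: "('k::chilbert_space \<times> 'k) set set"
  assumes fin: "finite_cdim (UNIV :: 'k set)" and "finite \<A>" and "\<And>L. L \<in> \<A> \<Longrightarrow> lagrangian L"
  shows "\<exists>M. lagrangian M \<and> (\<forall>L \<in> \<A>. M \<inter> L = {0})"
proof -
  let ?E = "\<lambda>L. {s :: real. \<exists>x :: 'k. x \<noteq> 0 \<and> (x, of_real s *c x) \<in> L}"
  have "finite (\<Union>L \<in> \<A>. ?E L)" using assms lagrangian_finite_slopes by blast
  then obtain s where s: "s \<notin> (\<Union>L \<in> \<A>. ?E L)" using ex_new_if_finite infinite_UNIV_char_0 by blast
  let ?M = "{(x :: 'k, of_real s *c x) | x. True}"
  have "?M \<inter> L = {0}" if "L \<in> \<A>" for L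
  proof
    show "?M \<inter> L \<subseteq> {0}" using s that by (force simp: zero_prod_def)
    show "{0} \<subseteq> ?M \<inter> L"
      using cvec.subspace_0[OF lagrangian_subspace[OF lagrangian_slope[of s]]]
        cvec.subspace_0[OF lagrangian_subspace[OF assms(3)[OF that]]] by blast
  qed
  then show ?thesis using lagrangian_slope by blast
qed

text \<open>Existence of a plane transversal to all three ensures that the \<open>SOME\<close> in
  the index selects such a plane.\<close>

lemma duistermaat_index_witness:
  fixes L\<^sub>1 L\<^sub>2 L\<^sub>3 :: "('k::chilbert_space \<times> 'k) set"
  assumes "finite_cdim (UNIV :: 'k set)" "lagrangian L\<^sub>1" "lagrangian L\<^sub>2" "lagrangian L\<^sub>3"
  obtains M where "lagrangian M" "M \<inter> L\<^sub>1 = {0}" "M \<inter> L\<^sub>2 = {0}" "M \<inter> L\<^sub>3 = {0}"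
    "duistermaat_index L\<^sub>1 L\<^sub>2 L\<^sub>3
      = int (n_minus_Q L\<^sub>2 M L\<^sub>3) - int (n_minus_Q L\<^sub>1 M L\<^sub>3) + int (n_minus_Q L\<^sub>1 M L\<^sub>2)"
proof -
  let ?P = "\<lambda>M. lagrangian M \<and> M \<inter> L\<^sub>1 = {0} \<and> M \<inter> L\<^sub>2 = {0} \<and> M \<inter> L\<^sub>3 = {0}"
  have "\<exists>M. ?P M" using transversal_lagrangian_exists[of "{L\<^sub>1, L\<^sub>2, L\<^sub>3}"] assms by auto
  then have "?P (SOME M. ?P M)" by (rule someI_ex)
  then show ?thesis using that[of "SOME M. ?P M"] unfolding duistermaat_index_def Let_def by blast
qed

text \<open>With \<open>L\<^sub>1\<close> and \<open>F\<close> written as graphs of \<open>A\<close> and \<open>B\<close> over \<open>L\<^sub>2\<close> and \<open>\<langle>\<cdot>, A \<cdot>\<rangle>\<close>, \<open>\<langle>\<cdot>, B \<cdot>\<rangle>\<close>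
  denoting the associated forms \<open>a\<close>, \<open>b\<close>, the counting is the comparison of inertia of
  \<open>\<Phi>(u, y) = a(u + y) + (b - a)(y)\<close>, read once as a sum of squares and once as a Schur complement
  with respect to \<open>y\<close>.\<close>

lemma duistermaat_count:
  fixes L\<^sub>1 L\<^sub>2 F :: "('k::chilbert_space \<times> 'k) set"
    and V :: "'a::complex_vector set" and \<Gamma> :: "'a \<Rightarrow> 'k \<times> 'k"
  assumes fin: "finite_cdim (UNIV :: 'k set)"
    and lag: "lagrangian L\<^sub>1" "lagrangian L\<^sub>2" "lagrangian F"
    and V: "cvec.subspace V" "finite_cdim V"
    and \<Gamma>: "clinear_on V \<Gamma>" "\<And>f. f \<in> V \<Longrightarrow> \<Gamma> f \<in> L\<^sub>1"
    and \<Psi>: "finite \<Psi>" "\<And>\<psi>. \<psi> \<in> \<Psi> \<Longrightarrow> functional_on V \<psi>"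
    and large: "int (card \<Psi>) + duistermaat_index L\<^sub>2 L\<^sub>1 F < int (cvec.dim V)"
  obtains f p r where "f \<in> V" "f \<noteq> 0" "\<And>\<psi>. \<psi> \<in> \<Psi> \<Longrightarrow> \<psi> f = 0"
    "p \<in> L\<^sub>2" "r \<in> F" "\<Gamma> f = p + r" "0 \<le> Re (omega p r)"
proof -
  obtain M where M: "lagrangian M" "M \<inter> L\<^sub>2 = {0}" "M \<inter> L\<^sub>1 = {0}" "M \<inter> F = {0}"
    and index: "duistermaat_index L\<^sub>2 L\<^sub>1 F
      = int (n_minus_Q L\<^sub>1 M F) - int (n_minus_Q L\<^sub>2 M F) + int (n_minus_Q L\<^sub>2 M L\<^sub>1)"
    using duistermaat_index_witness[OF fin lag(2,1,3)] by metis
  interpret A: transversal_planes L\<^sub>2 M L\<^sub>1 using fin lag M by unfold_locales auto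
  interpret B: transversal_planes L\<^sub>2 M F using fin lag M by unfold_locales auto
  interpret C: transversal_planes L\<^sub>1 M F using fin lag M by unfold_locales auto
  interpret D: transversal_planes L\<^sub>1 M L\<^sub>2 using fin lag M by unfold_locales auto
  define A where "A = graph_map L\<^sub>2 M L\<^sub>1"
  define B where "B = graph_map L\<^sub>2 M F"
  define C where "C = graph_map L\<^sub>1 M F"
  define D where "D = graph_map L\<^sub>1 M L\<^sub>2"
  define a where "a = Q_form L\<^sub>2 M L\<^sub>1"
  define b where "b = Q_form L\<^sub>2 M F"
  define c where "c = Q_form L\<^sub>1 M F"
  have a: "a u v = omega u (A v)" and b: "b u v = omega u (B v)" and c: "c u v = omega u (C v)" for u v
    by (simp_all add: a_def b_def c_def A_def B_def C_def Q_form_def)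
  have ha: "hermitian_on L\<^sub>2 a" and hb: "hermitian_on L\<^sub>2 b" and hc: "hermitian_on L\<^sub>1 c"
    unfolding a_def b_def c_def
    by (rule A.hermitian_on_Q_form B.hermitian_on_Q_form C.hermitian_on_Q_form)+
  note sL = lag[THEN lagrangian_subspace] M(1)[THEN lagrangian_subspace]
  have finKK: "finite_cdim (UNIV :: ('k \<times> 'k) set)" using finite_cdim_Times(1)[OF fin fin] by simp
  have finL: "finite_cdim U" for U :: "('k \<times> 'k) set" using finite_cdim_mono[OF finKK] by blast
  have lin: "A (u + v) = A u + A v" "A (k *c u) = k *c A u" "A 0 = 0"
      "B (u + v) = B u + B v" "B (k *c u) = k *c B u" "B 0 = 0"
      "C (u + v) = C u + C v" "C (k *c u) = k *c C u" "C 0 = 0"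
      "D (u + v) = D u + D v" "D (k *c u) = k *c D u" "D 0 = 0" for u v k
    unfolding A_def B_def C_def D_def
    by (rule A.graph_map_add A.graph_map_scaleC A.graph_map_zero B.graph_map_add B.graph_map_scaleC
        B.graph_map_zero C.graph_map_add C.graph_map_scaleC C.graph_map_zero D.graph_map_add
        D.graph_map_scaleC D.graph_map_zero)+
  have mem: "A u \<in> M" "u + A u \<in> L\<^sub>1" "B u \<in> M" "u + B u \<in> F" "C u \<in> M" "D u \<in> M" "u + D u \<in> L\<^sub>2" for u
    unfolding A_def B_def C_def D_def
    by (rule A.graph_map_mem B.graph_map_mem C.graph_map_mem D.graph_map_mem)+
  have MM: "omega u v = 0" if "u \<in> M" "v \<in> M" for u v using lagrangian_omega[OF M(1)] that .
  have LL: "omega u v = 0" if "u \<in> L\<^sub>2" "v \<in> L\<^sub>2" for u v using lagrangian_omega[OF lag(2)] that .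
  have swapA: "omega (A u) v = - omega u (A v)" and swapB: "omega (B u) v = - omega u (B v)"
    if "u \<in> L\<^sub>2" "v \<in> L\<^sub>2" for u v
    unfolding A_def B_def using A.omega_graph_map_swap B.omega_graph_map_swap that by blast+
  \<comment> \<open>\<open>u + D u\<close> is the coordinate in \<open>L\<^sub>2\<close> of the
    point u of \<open>L\<^sub>1\<close>: adding A of it leads back to u.\<close>
  have AD: "A (u + D u) = - D u" if "u \<in> L\<^sub>1" for u
    unfolding A_def
  proof (rule graph_map_unique[OF M(1) lag(1)])
    show "- D u \<in> M" using mem(6) cvec.subspace_neg[OF sL(4)] by blast
  qed (use M that in auto)
  \<comment> \<open>In the coordinate y of \<open>L\<^sub>2\<close>, the form c becomes b - a, so
    all three indices concern forms on the same plane.\<close>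
  have CA: "C (y + A y) = B y - A y" for y
    unfolding C_def
  proof (rule graph_map_unique[OF M(1) lag(3)])
    show "B y - A y \<in> M" using mem cvec.subspace_diff[OF sL(4)] by blast
    show "y + A y + (B y - A y) \<in> F" using mem(4)[of y] by simp
  qed (use M in auto)
  \<comment> \<open>M and \<open>L\<^sub>2\<close> are transversal, so elements of M may be compared
    by testing them against \<open>L\<^sub>2\<close>.\<close>
  have ann: "w = 0" if "w \<in> M" "\<And>x. x \<in> L\<^sub>2 \<Longrightarrow> omega x w = 0" for w
  proof -
    have "w \<in> L\<^sub>2" using that(2) omega_eq_0_commute by (intro lagrangianD[OF lag(2)]) blast
    then show ?thesis using that(1) M(2) by blast
  qed
  \<comment> \<open>\<open>n_minus\<close> of a and of c enters the index with a plus sign: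
    orthogonality to \<open>W\<^sub>a\<close> and \<open>W\<^sub>c\<close> is paid for, and
    nonnegativity is gained. For b the sign is minus: the negativity on \<open>W\<^sub>b\<close>
    itself is used and saves conditions.\<close>
  obtain W\<^sub>a where Wa: "cvec.subspace W\<^sub>a" "W\<^sub>a \<subseteq> L\<^sub>2" "cvec.dim W\<^sub>a = n_minus_Q L\<^sub>2 M L\<^sub>1"
    "\<And>u. u \<in> W\<^sub>a \<Longrightarrow> u \<noteq> 0 \<Longrightarrow> Re (a u u) < 0"
    "\<And>x. x \<in> L\<^sub>2 \<Longrightarrow> (\<And>w. w \<in> W\<^sub>a \<Longrightarrow> a w x = 0) \<Longrightarrow> 0 \<le> Re (a x x)"
    using n_minus_witness[OF ha sL(2) finL] unfolding n_minus_Q_def a_def by metis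
  obtain W\<^sub>b where Wb: "cvec.subspace W\<^sub>b" "W\<^sub>b \<subseteq> L\<^sub>2" "cvec.dim W\<^sub>b = n_minus_Q L\<^sub>2 M F"
    "\<And>u. u \<in> W\<^sub>b \<Longrightarrow> u \<noteq> 0 \<Longrightarrow> Re (b u u) < 0"
    using n_minus_witness[OF hb sL(2) finL] unfolding n_minus_Q_def b_def by metis
  obtain W\<^sub>c where Wc: "cvec.subspace W\<^sub>c" "W\<^sub>c \<subseteq> L\<^sub>1" "cvec.dim W\<^sub>c = n_minus_Q L\<^sub>1 M F"
    "\<And>x. x \<in> L\<^sub>1 \<Longrightarrow> (\<And>w. w \<in> W\<^sub>c \<Longrightarrow> c w x = 0) \<Longrightarrow> 0 \<le> Re (c x x)"
    using n_minus_witness[OF hc sL(1) finL] unfolding n_minus_Q_def c_def by metis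
  obtain E\<^sub>a where Ea: "finite E\<^sub>a" "E\<^sub>a \<subseteq> W\<^sub>a" "W\<^sub>a \<subseteq> cvec.span E\<^sub>a" "card E\<^sub>a = cvec.dim W\<^sub>a"
    using finite_basis[OF finL[of W\<^sub>a]] by metis
  obtain E\<^sub>c where Ec: "finite E\<^sub>c" "E\<^sub>c \<subseteq> W\<^sub>c" "W\<^sub>c \<subseteq> cvec.span E\<^sub>c" "card E\<^sub>c = cvec.dim W\<^sub>c"
    using finite_basis[OF finL[of W\<^sub>c]] by metis
  define X where "X = {x \<in> L\<^sub>2. \<forall>w \<in> W\<^sub>b. b x w = 0}"
  \<comment> \<open>For e in N the condition \<open>omega e (A u + B y) = 0\<close> holds
    automatically, and N is also where y could hide if f = 0. The basis of X is therefore chosen to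
    extend one of N, and the idle conditions belonging to N are exchanged, at no extra cost, for
    orthogonality of y to N.\<close>
  define N where "N = {x \<in> L\<^sub>2. A x = 0 \<and> B x = 0}"
  have sX: "cvec.subspace X"
  proof -
    have "X = L\<^sub>2 \<inter> (\<Inter>w \<in> W\<^sub>b. {x. omega x (B w) = 0})" unfolding X_def b by blast
    then show ?thesis
      by (simp only:) (intro cvec.subspace_inter cvec.subspace_Int sL(2) subspace_omega_left_kernel)
  qed
  have sN: "cvec.subspace N"
    unfolding N_def by (rule cvec.subspaceI)
      (use sL(2) lin in \<open>simp_all add: cvec.subspace_0 cvec.subspace_add cvec.subspace_scale\<close>)
  have NX: "N \<subseteq> X"
  proof
    fix x assume x: "x \<in> N"
    have "b x w = 0" if "w \<in> W\<^sub>b" for w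
      using swapB[of x w] x that Wb(2) unfolding N_def b by auto
    then show "x \<in> X" using x unfolding X_def N_def by blast
  qed
  obtain E\<^sub>0 where E0: "finite E\<^sub>0" "E\<^sub>0 \<subseteq> N" "cvec.independent E\<^sub>0" "N \<subseteq> cvec.span E\<^sub>0"
    using finite_basis[OF finL[of N]] by metis
  obtain E where E: "finite E" "E\<^sub>0 \<subseteq> E" "E \<subseteq> X" "X \<subseteq> cvec.span E" "card E = cvec.dim X"
    using finite_basis_extend[OF finL[of X] E0(3)] E0(2) NX by (metis subset_trans)
  have "X \<inter> W\<^sub>b \<subseteq> {0}" using Wb(4) unfolding X_def by force
  \<comment> \<open>The term with the minus sign in the index: y contributes the dimension of
    \<open>L\<^sub>2\<close>, while X imposes at most that many conditions less the dimension of
    \<open>W\<^sub>b\<close>.\<close>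
  then have card_E: "card E + cvec.dim W\<^sub>b \<le> cvec.dim L\<^sub>2"
    using cdim_disjoint_sum_le[OF finL sL(2) _ Wb(2) sX Wb(1)] E(5) X_def by auto
  \<comment> \<open>The coordinate in \<open>L\<^sub>2\<close> of the boundary value, so that
    \<Gamma> f = u f + A (u f) on V.\<close>
  define u where "u f = \<Gamma> f + D (\<Gamma> f)" for f
  have uL: "u f \<in> L\<^sub>2" for f unfolding u_def by (rule mem)
  have Au: "A (u f) = - D (\<Gamma> f)" if "f \<in> V" for f unfolding u_def by (rule AD[OF \<Gamma>(2)[OF that]])
  have u_add: "u (f + g) = u f + u g" if "f \<in> V" "g \<in> V" for f g
    using \<Gamma>(1) that by (simp add: u_def clinear_on_def lin)
  have u_scale: "u (k *c f) = k *c u f" if "f \<in> V" for f k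
    using \<Gamma>(1) that by (simp add: u_def clinear_on_def lin scaleC_add_right)
  define \<phi> where "\<phi> e = (\<lambda>p. if e \<in> E\<^sub>0 then omega (snd e, - fst e) (snd p) else omega e (A (u (fst p)) + B (snd p)))" for e
  define \<Phi> where "\<Phi> = (\<lambda>\<psi>. \<lambda>p. \<psi> (fst p)) ` \<Psi> \<union> (\<lambda>e. \<lambda>p. a e (u (fst p) + snd p)) ` E\<^sub>a
    \<union> (\<lambda>e. \<lambda>p. c e (snd p + A (snd p))) ` E\<^sub>c \<union> \<phi> ` E"
  have fin\<Phi>: "finite \<Phi>" unfolding \<Phi>_def using \<Psi>(1) Ea(1) Ec(1) E(1) by blast
  have "card \<Phi> \<le> card \<Psi> + card E\<^sub>a + card E\<^sub>c + card E"
    unfolding \<Phi>_def using \<Psi>(1) Ea(1) Ec(1) E(1)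
    by (intro order_trans[OF card_Un_le] add_mono card_image_le)
  then have card: "card \<Phi> < cvec.dim (V \<times> L\<^sub>2)"
    using large index card_E Ea(4) Ec(4) Wa(3) Wb(3) Wc(3)
      finite_cdim_Times(3)[OF V(2) finL[of L\<^sub>2] V(1) sL(2)] by linarith
  have fun\<Phi>: "functional_on (V \<times> L\<^sub>2) \<theta>" if "\<theta> \<in> \<Phi>" for \<theta>
  proof -
    have 1: "functional_on (V \<times> L\<^sub>2) (\<lambda>p. \<psi> (fst p))" if "\<psi> \<in> \<Psi>" for \<psi>
      using functional_onD[OF \<Psi>(2)[OF that]] by (simp add: functional_on_def mem_Times_iff)
    have 2: "functional_on (V \<times> L\<^sub>2) (\<lambda>p. a e (u (fst p) + snd p))" for e
      by (simp add: functional_on_def mem_Times_iff a lin omega_simps u_add u_scale algebra_simps)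
    have 3: "functional_on (V \<times> L\<^sub>2) (\<lambda>p. c e (snd p + A (snd p)))" for e
      by (simp add: functional_on_def mem_Times_iff c lin omega_simps algebra_simps)
    have 4: "functional_on (V \<times> L\<^sub>2) (\<phi> e)" for e
      by (simp add: functional_on_def mem_Times_iff \<phi>_def lin omega_simps u_add u_scale algebra_simps)
    show ?thesis using that 1 2 3 4 unfolding \<Phi>_def by blast
  qed
  obtain z\<^sub>0 where z0: "z\<^sub>0 \<in> V \<times> L\<^sub>2" "z\<^sub>0 \<noteq> 0" "\<And>\<theta>. \<theta> \<in> \<Phi> \<Longrightarrow> \<theta> z\<^sub>0 = 0"
    using common_kernel_nontrivial[OF fin\<Phi> finite_cdim_Times(1,2)[OF V(2) finL[of L\<^sub>2] V(1) sL(2)] fun\<Phi> card]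
    by blast
  obtain f y where fy: "z\<^sub>0 = (f, y)" by (cases z\<^sub>0)
  have f: "f \<in> V" and y: "y \<in> L\<^sub>2" and ne: "\<not> (f = 0 \<and> y = 0)"
    using z0(1,2) fy by (auto simp: zero_prod_def)
  have \<psi>0: "\<psi> f = 0" if "\<psi> \<in> \<Psi>" for \<psi>
    using z0(3)[of "\<lambda>p. \<psi> (fst p)"] that fy unfolding \<Phi>_def by auto
  have a0: "a e (u f + y) = 0" if "e \<in> E\<^sub>a" for e
    using z0(3)[of "\<lambda>p. a e (u (fst p) + snd p)"] that fy unfolding \<Phi>_def by auto
  have c0: "c e (y + A y) = 0" if "e \<in> E\<^sub>c" for e
    using z0(3)[of "\<lambda>p. c e (snd p + A (snd p))"] that fy unfolding \<Phi>_def by auto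
  have e0: "\<phi> e (f, y) = 0" if "e \<in> E" for e
    using z0(3)[of "\<phi> e"] that fy unfolding \<Phi>_def by auto
  let ?u = "u f"
  have uyL: "?u + y \<in> L\<^sub>2" using uL y cvec.subspace_add[OF sL(2)] by blast
  have orth_a: "a w (?u + y) = 0" if "w \<in> W\<^sub>a" for w
  proof -
    have "cvec.span E\<^sub>a \<subseteq> {w. omega w (A (?u + y)) = 0}"
      using a0 unfolding a by (intro cvec.span_minimal subspace_omega_left_kernel) blast
    then show ?thesis using that Ea(3) unfolding a by blast
  qed
  have orth_c: "c w (y + A y) = 0" if "w \<in> W\<^sub>c" for w
  proof -
    have "cvec.span E\<^sub>c \<subseteq> {w. omega w (C (y + A y)) = 0}"
      using c0 unfolding c by (intro cvec.span_minimal subspace_omega_left_kernel) blast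
    then show ?thesis using that Ec(3) unfolding c by blast
  qed
  have orth_X: "omega x (A ?u + B y) = 0" if "x \<in> X" for x
  proof -
    have "omega e (A ?u + B y) = 0" if e: "e \<in> E" for e
    proof (cases "e \<in> E\<^sub>0")
      case True
      then have "e \<in> L\<^sub>2" "A e = 0" "B e = 0" using E0(2) unfolding N_def by auto
      then show ?thesis using swapA[of e ?u] swapB[of e y] uL y by (simp add: omega_simps)
    next
      case False
      then show ?thesis using e0[OF e] by (simp add: \<phi>_def)
    qed
    then have "cvec.span E \<subseteq> {w. omega w (A ?u + B y) = 0}"
      by (intro cvec.span_minimal subspace_omega_left_kernel) blast
    then show ?thesis using that E(4) by blast
  qed
  have orth_N: "y = 0" if "y \<in> N"
  proof -
    have "omega (snd e, - fst e) y = 0" if "e \<in> E\<^sub>0" for e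
      using e0[of e] that E(2) by (auto simp: \<phi>_def)
    moreover have "cvec.subspace {e. omega (snd e, - fst e) y = 0}"
      by (rule cvec.subspaceI)
        (simp_all add: omega_rotate cinner_add_left cinner_scaleC_left distrib_left[symmetric] algebra_simps
          add_eq_0_iff)
    ultimately have "cvec.span E\<^sub>0 \<subseteq> {e. omega (snd e, - fst e) y = 0}"
      by (intro cvec.span_minimal) blast
    then show "y = 0" using that E0(4) omega_rotate_self by blast
  qed
  \<comment> \<open>Elements of \<open>L\<^sub>2\<close> split into a part in
    \<open>W\<^sub>b\<close> and a part in X. The functional given by A u + B y vanishes on X, and
    on \<open>W\<^sub>b\<close> it is represented by some z because b is definite there.\<close>
  have "\<exists>z \<in> W\<^sub>b. A ?u + B y = B z"
  proof -
    obtain B\<^sub>b where Bb: "finite B\<^sub>b" "B\<^sub>b \<subseteq> W\<^sub>b" "W\<^sub>b \<subseteq> cvec.span B\<^sub>b" "card B\<^sub>b = cvec.dim W\<^sub>b"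
      using finite_basis[OF finL[of W\<^sub>b]] by metis
    show ?thesis
    proof (cases "A ?u + B y = 0")
      case True
      then show ?thesis using lin(6) cvec.subspace_0[OF Wb(1)] by force
    next
      case False
      \<comment> \<open>The representing z comes from another count: the pairs in ?S have one
        dimension more than there are conditions, and definiteness of b keeps the coefficient k of
        ?m away from 0, so z is the first component divided by k.\<close>
      let ?m = "A ?u + B y" and ?S = "W\<^sub>b \<times> cvec.span {A ?u + B y}"
      let ?\<Theta> = "(\<lambda>e. \<lambda>p. omega e (B (fst p)) - omega e (snd p)) ` B\<^sub>b"
      have S: "finite_cdim ?S" "cvec.subspace ?S" "cvec.dim ?S = cvec.dim W\<^sub>b + 1"
        using finite_cdim_Times[OF finL[of W\<^sub>b] finL Wb(1) cvec.subspace_span, of "{?m}"]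
          cvec.dim_eq_card_independent[of "{?m}"] False by auto
      have "functional_on ?S \<theta>" if "\<theta> \<in> ?\<Theta>" for \<theta>
      proof -
        from that obtain e where "\<theta> = (\<lambda>p. omega e (B (fst p)) - omega e (snd p))" by (rule imageE)
        then show ?thesis by (simp add: functional_on_def lin omega_simps algebra_simps)
      qed
      moreover have "card ?\<Theta> < cvec.dim ?S" 
        by (rule order_le_less_trans[OF card_image_le[OF Bb(1)]]) (simp add: Bb(4) S(3))
      ultimately obtain t where t: "t \<in> ?S" "t \<noteq> 0" "\<And>\<theta>. \<theta> \<in> ?\<Theta> \<Longrightarrow> \<theta> t = 0"
        using common_kernel_nontrivial[of ?\<Theta> ?S] S(1,2) Bb(1) by blast
      obtain z\<^sub>1 k where zk: "t = (z\<^sub>1, k *c ?m)" "z\<^sub>1 \<in> W\<^sub>b"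
        using t(1) by (auto simp: cvec.span_singleton)
      have "omega e (B z\<^sub>1 - k *c ?m) = 0" if "e \<in> B\<^sub>b" for e
        using t(3)[of "\<lambda>p. omega e (B (fst p)) - omega e (snd p)"] that zk by (auto simp: omega_diff_right)
      then have "cvec.span B\<^sub>b \<subseteq> {w. omega w (B z\<^sub>1 - k *c ?m) = 0}"
        by (intro cvec.span_minimal subspace_omega_left_kernel) blast
      then have eq: "omega w (B z\<^sub>1) = k * omega w ?m" if "w \<in> W\<^sub>b" for w
        using that Bb(3) by (auto simp: omega_diff_right omega_scaleC_right)
      have k: "k \<noteq> 0"
      proof
        assume "k = 0"
        then have "b z\<^sub>1 z\<^sub>1 = 0" "z\<^sub>1 \<noteq> 0" using eq[OF zk(2)] t(2) zk(1) unfolding b by (auto simp: zero_prod_def)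
        then show False using Wb(4)[OF zk(2)] by simp
      qed
      define z where "z = inverse k *c z\<^sub>1"
      have zW: "z \<in> W\<^sub>b" unfolding z_def using zk(2) cvec.subspace_scale[OF Wb(1)] by blast
      have zL: "z \<in> L\<^sub>2" using zW Wb(2) by blast
      have eqz: "omega w (B z) = omega w ?m" if "w \<in> W\<^sub>b" for w
        using eq[OF that] k by (simp add: z_def lin omega_scaleC_right)
      have "?m - B z = 0"
      proof (rule ann)
        show "?m - B z \<in> M"
          by (intro cvec.subspace_diff[OF sL(4)] cvec.subspace_add[OF sL(4)] mem)
        fix x assume x: "x \<in> L\<^sub>2"
        have nz: "b w w \<noteq> 0" if "w \<in> W\<^sub>b" "w \<noteq> 0" for w using Wb(4)[OF that] by auto
        obtain w where w: "w \<in> W\<^sub>b" "\<And>w'. w' \<in> W\<^sub>b \<Longrightarrow> b w' (x - w) = 0"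
          using hermitian_projection[OF hb sL(2) Wb(1) finL Wb(2) nz x] by blast
        have xwL: "x - w \<in> L\<^sub>2" using x w(1) Wb(2) cvec.subspace_diff[OF sL(2)] by blast
        have q0: "b (x - w) w' = 0" if "w' \<in> W\<^sub>b" for w'
          using w(2)[OF that] hermitian_onD(1)[OF hb xwL, of w'] that Wb(2) by auto
        then have "x - w \<in> X" using xwL unfolding X_def by simp
        moreover have "b (x - w) z = 0" by (rule q0[OF zW])
        ultimately have "omega (x - w) (?m - B z) = 0" using orth_X unfolding b by (simp add: omega_diff_right)
        moreover have "omega w (?m - B z) = 0" using eqz[OF w(1)] by (simp add: omega_diff_right)
        ultimately show "omega x (?m - B z) = 0" using omega_add_left[of "x - w" w "?m - B z"] by simp
      qed
      then show ?thesis using zW by auto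
    qed
  qed
  then obtain z where z: "z \<in> W\<^sub>b" "A ?u + B y = B z" by blast
  have zL: "z \<in> L\<^sub>2" using z(1) Wb(2) by blast
  have bz: "Re (omega z (B z)) \<le> 0"
    using Wb(4)[OF z(1)] unfolding b by (cases "z = 0") (auto intro: less_imp_le)
  have sym: "Re (omega v (A w)) = Re (omega w (A v))" "Re (omega v (B w)) = Re (omega w (B v))"
    if "v \<in> L\<^sub>2" "w \<in> L\<^sub>2" for v w
    using hermitian_onD(1)[OF ha that] hermitian_onD(1)[OF hb that] unfolding a b by simp_all
  have pos_a: "0 \<le> Re (omega (?u + y) (A (?u + y)))"
    using Wa(5)[OF uyL orth_a] unfolding a .
  have "0 \<le> Re (c (y + A y) (y + A y))" using Wc(4)[OF mem(2) orth_c] .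
  then have pos_c: "Re (omega y (A y)) \<le> Re (omega y (B y))"
    unfolding c CA using MM[OF mem(1) mem(3)] MM[OF mem(1) mem(1)]
    by (simp add: omega_add_left omega_diff_right)
  have Az: "A ?u = B z - B y" using z(2) by (simp add: eq_diff_eq)
  \<comment> \<open>If f = 0 then u = 0, and a(y) \<ge> 0, a(y) \<le> b(y), b(y) = b(z) \<le> 0
    force z = 0, B y = 0 and a(y) = 0. Then y is a null vector of a on the complement of
    \<open>W\<^sub>a\<close>, so A y = 0 and y is in N; the exchanged conditions give y = 0.\<close>
  have "f \<noteq> 0"
  proof
    assume f0: "f = 0"
    have "?u = 0" using u_scale[of f 0] f f0 by simp
    then have e: "B z = B y" "0 \<le> Re (omega y (A y))" using Az lin(3) pos_a by auto
    have "Re (omega y (B y)) = Re (omega z (B z))" using sym(2)[OF y zL] e(1) by simp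
    then have bz0: "Re (b z z) \<ge> 0" "Re (omega y (A y)) \<le> Re (omega z (B z))"
      using pos_c e(2) unfolding b by auto
    then have "z = 0" using Wb(4)[OF z(1)] by fastforce
    then have By: "B y = 0" and ay: "Re (a y y) = 0" using e bz0 lin(6) unfolding a by auto
    let ?U = "{x \<in> L\<^sub>2. \<forall>w \<in> W\<^sub>a. a w x = 0}"
    have sU: "cvec.subspace ?U"
      by (rule cvec.subspaceI)
        (use sL(2) in \<open>simp_all add: a lin omega_simps cvec.subspace_0 cvec.subspace_add cvec.subspace_scale\<close>)
    have yU: "y \<in> ?U" using y orth_a \<open>?u = 0\<close> by simp
    have "A y = 0"
    proof (rule ann[OF mem(1)])
      fix x assume x: "x \<in> L\<^sub>2"
      have nz: "a w w \<noteq> 0" if "w \<in> W\<^sub>a" "w \<noteq> 0" for w using Wa(4)[OF that] by auto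
      obtain w where w: "w \<in> W\<^sub>a" "\<And>w'. w' \<in> W\<^sub>a \<Longrightarrow> a w' (x - w) = 0"
        using hermitian_projection[OF ha sL(2) Wa(1) finL Wa(2) nz x] by blast
      have xw: "x - w \<in> L\<^sub>2" using x w(1) Wa(2) cvec.subspace_diff[OF sL(2)] by blast
      have "a y (x - w) = 0"
        by (rule hermitian_null_vector[OF ha sL(2) sU _ _ yU ay]) (use Wa(5) w xw in auto)
      then have "a (x - w) y = 0" using hermitian_onD(1)[OF ha xw y] by simp
      moreover have "a w y = 0" using yU w(1) by blast
      ultimately show "omega x (A y) = 0" using omega_add_left[of "x - w" w "A y"] unfolding a by simp
    qed
    then have "y \<in> N" using y By unfolding N_def by blast
    then show False using orth_N ne f0 by blast
  qed
  \<comment> \<open>The splitting is p = u + (y - z) and r = - ((y - z) + B (y - z)). The choice of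
    z gives B (y - z) = - A u, whence p + r = u + A u = \<Gamma> f.\<close>
  moreover have "?u + (y - z) \<in> L\<^sub>2"
    using uL y zL cvec.subspace_add[OF sL(2)] cvec.subspace_diff[OF sL(2)] by blast
  moreover have "- ((y - z) + B (y - z)) \<in> F" using mem(4) cvec.subspace_neg[OF sL(3)] by blast
  moreover have Byz: "B (y - z) = - A ?u" using lin(4)[of "y - z" z] Az by (simp add: algebra_simps)
  have "\<Gamma> f = ?u + A ?u" using Au[OF f] unfolding u_def by simp
  then have "\<Gamma> f = (?u + (y - z)) + - ((y - z) + B (y - z))" using Byz by simp
  \<comment> \<open>The real part equals a(u + y) + (b(y) - a(y)) - b(z), a sum of three terms
    already known to be nonnegative.\<close>
  moreover have "0 \<le> Re (omega (?u + (y - z)) (- ((y - z) + B (y - z))))"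
  proof -
    have yz: "y - z \<in> L\<^sub>2" using y zL cvec.subspace_diff[OF sL(2)] by blast
    have "omega (?u + (y - z)) (- ((y - z) + B (y - z))) = omega ?u (A ?u) + omega (y - z) (A ?u)"
      using LL[OF uL yz] LL[OF yz yz] by (simp add: Byz omega_simps)
    moreover have "omega (y - z) (A ?u) = omega y (B z) - omega y (B y) - omega z (B z) + omega z (B y)"
      unfolding Az using omega_add_left[of "y - z" z] by (simp add: omega_diff_right algebra_simps)
    moreover have "Re (omega z (B y)) = Re (omega y (B z))" by (rule sym(2)[OF zL y])
    moreover have "Re (omega (?u + y) (A (?u + y))) = Re (omega ?u (A ?u)) + 2 * Re (omega y (A ?u)) + Re (omega y (A y))"
      using sym(1)[OF uL y] by (simp add: lin omega_simps)
    moreover have "omega y (A ?u) = omega y (B z) - omega y (B y)" by (simp add: Az omega_diff_right)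
    ultimately show ?thesis using pos_a pos_c bz by simp
  qed
  ultimately show thesis using that f \<psi>0 by blast
qed

section \<open>Self-adjoint operators below the essential spectrum\<close>

lemma orthogonal_projection:
  fixes U :: "'h::chilbert_space set"
  assumes U: "closed U" "cvec.subspace U"
  obtains p where "p \<in> U" "\<And>u. u \<in> U \<Longrightarrow> cinner u (x - p) = 0"
proof -
  let ?d = "Inf ((\<lambda>u. (norm (x - u))\<^sup>2) ` U)"
  have bdd: "bdd_below ((\<lambda>u. (norm (x - u))\<^sup>2) ` U)" by (intro bdd_belowI[of _ 0]) auto
  have ne: "(\<lambda>u. (norm (x - u))\<^sup>2) ` U \<noteq> {}" using cvec.subspace_0[OF U(2)] by blast
  have d: "?d \<le> (norm (x - u))\<^sup>2" if "u \<in> U" for u using bdd that by (intro cInf_lower) auto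
  have "\<exists>u \<in> U. (norm (x - u))\<^sup>2 < ?d + 1 / real (Suc k)" for k
    using cInf_lessD[OF ne, of "?d + 1 / real (Suc k)"] by auto
  then obtain w where w: "\<And>k. w k \<in> U" "\<And>k. (norm (x - w k))\<^sup>2 < ?d + 1 / real (Suc k)" by metis
  have half: "(1/2) *\<^sub>R (u + v) \<in> U" if "u \<in> U" "v \<in> U" for u v
    using that cvec.subspace_add[OF U(2)] cvec.subspace_scale[OF U(2)] scaleC_of_real by metis
  \<comment> \<open>Parallelogram identity; the midpoint of w k and w l lies in U, so its squared
    distance to x is at least ?d, which cancels the contributions of ?d.\<close>
  have diff: "(norm (w k - w l))\<^sup>2 \<le> 2 / real (Suc k) + 2 / real (Suc l)" for k l
  proof -
    have "(norm (w k - w l))\<^sup>2 = 2 * (norm (x - w k))\<^sup>2 + 2 * (norm (x - w l))\<^sup>2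
        - 4 * (norm (x - (1/2) *\<^sub>R (w k + w l)))\<^sup>2"
      by (simp add: power2_norm_eq_inner inner_diff_left inner_diff_right inner_add_left inner_add_right
          inner_commute field_simps)
    then show ?thesis using d[OF half[OF w(1) w(1)], of k l] w(2)[of k] w(2)[of l] by linarith
  qed
  have "Cauchy w"
  proof (rule CauchyI)
    fix e :: real assume e: "0 < e"
    obtain K where K: "4 / e\<^sup>2 < real K" using reals_Archimedean2 by blast
    have "norm (w k - w l) < e" if "K \<le> k" "K \<le> l" for k l
    proof -
      have "4 < real K * e\<^sup>2" using K e by (simp add: divide_simps)
      then have K0: "0 < real K" by (cases "K = 0") auto
      have "2 / real (Suc k) + 2 / real (Suc l) \<le> 2 / real K + 2 / real K"
        using that K0 by (intro add_mono divide_left_mono) auto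
      also have "\<dots> < e\<^sup>2" using \<open>4 < real K * e\<^sup>2\<close> K0 by (simp add: divide_simps mult.commute)
      finally have "(norm (w k - w l))\<^sup>2 < e\<^sup>2" using diff[of k l] by linarith
      then show ?thesis using e by (simp add: power2_less_imp_less)
    qed
    then show "\<exists>M. \<forall>m\<ge>M. \<forall>n\<ge>M. norm (w m - w n) < e" by blast
  qed
  then obtain p where p: "w \<longlonglongrightarrow> p" using Cauchy_convergent convergent_def by blast
  have pU: "p \<in> U" using closed_sequentially[OF U(1)] w(1) p by blast
  have "(\<lambda>k. ?d + 1 / real (Suc k)) \<longlonglongrightarrow> ?d + 0"
    by (intro tendsto_add tendsto_const LIMSEQ_inverse_real_of_nat[unfolded inverse_eq_divide])
  moreover have "(\<lambda>k. (norm (x - w k))\<^sup>2) \<longlonglongrightarrow> (norm (x - p))\<^sup>2" by (intro tendsto_intros p)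
  ultimately have dp: "(norm (x - p))\<^sup>2 \<le> ?d"
    using LIMSEQ_le[of "\<lambda>k. (norm (x - w k))\<^sup>2" "(norm (x - p))\<^sup>2" "\<lambda>k. ?d + 1 / real (Suc k)" "?d + 0"]
      w(2) less_imp_le by auto
  have re: "Re (cinner u (x - p)) = 0" if u: "u \<in> U" for u
  proof (cases "u = 0")
    case False
    define s where "s = inner u (x - p) / (norm u)\<^sup>2"
    have "p + s *\<^sub>R u \<in> U"
      using pU u cvec.subspace_add[OF U(2)] cvec.subspace_scale[OF U(2)] scaleC_of_real by metis
    then have "(norm (x - p))\<^sup>2 \<le> (norm (x - (p + s *\<^sub>R u)))\<^sup>2" by (rule order_trans[OF dp d])
    also have "\<dots> = (norm (x - p))\<^sup>2 - 2 * s * inner u (x - p) + s\<^sup>2 * (norm u)\<^sup>2"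
      by (simp add: power2_norm_eq_inner inner_diff_left inner_diff_right inner_add_left inner_add_right
          inner_commute power2_eq_square[of s] algebra_simps)
    also have "s\<^sup>2 * (norm u)\<^sup>2 = s * inner u (x - p)" using False by (simp add: s_def power2_eq_square)
    finally have "s * inner u (x - p) \<le> 0" by simp
    then have "(inner u (x - p))\<^sup>2 / (norm u)\<^sup>2 \<le> 0" by (simp add: s_def power2_eq_square)
    then show ?thesis using False by (simp add: divide_le_0_iff inner_eq_Re_cinner)
  qed simp
  have "cinner u (x - p) = 0" if u: "u \<in> U" for u
  proof (rule complex_eqI)
    have "\<i> *c u \<in> U" using u U(2) cvec.subspace_scale by blast
    then show "Im (cinner u (x - p)) = Im 0" using re[of "\<i> *c u"] by (simp add: cinner_scaleC_left)
  qed (use re[OF u] in simp)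
  then show ?thesis using pU that by blast
qed

lemma finite_orthogonal_projection:
  fixes V :: "'h::chilbert_space set"
  assumes "cvec.subspace V" "finite_cdim V"
  obtains p where "p \<in> V" "\<And>v. v \<in> V \<Longrightarrow> cinner v (x - p) = 0"
  using hermitian_projection[OF hermitian_on_cinner cvec.subspace_UNIV assms subset_UNIV, of x] by auto

lemma norm_add_orthogonal:
  fixes u v :: "'h::chilbert_space"
  assumes "cinner u v = 0"
  shows "(norm (u + v))\<^sup>2 = (norm u)\<^sup>2 + (norm v)\<^sup>2"
  using assms inner_eq_Re_cinner[of u v]
  by (simp add: power2_norm_eq_inner inner_add_left inner_add_right inner_commute)

text \<open>Multiplying y by a unimodular constant makes the product real and nonnegative, which
  reduces the claim to the real Cauchy-Schwarz inequality.\<close>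

lemma cinner_norm_le: "cmod (cinner x y) \<le> norm x * norm (y :: 'h::chilbert_space)"
proof (cases "cinner x y = 0")
  case False
  define c where "c = cnj (cinner x y) / of_real (cmod (cinner x y))"
  have c: "cmod c = 1" using False by (simp add: c_def norm_divide)
  have "c * cinner x y = of_real (cmod (cinner x y))"
    using False complex_norm_square[of "cinner x y"]
    by (simp add: c_def power2_eq_square mult.commute divide_eq_eq)
  then have "cmod (cinner x y) = inner x (c *c y)" by (simp add: inner_eq_Re_cinner cinner_scaleC_right)
  also have "\<dots> \<le> norm x * norm (c *c y)" by (rule norm_cauchy_schwarz)
  also have "norm (c *c y) = norm y"
  proof -
    have "complex_of_real ((norm (c *c y))\<^sup>2) = (cnj c * c) * of_real ((norm y)\<^sup>2)"
      by (simp only: cinner_self[symmetric] cinner_scaleC_left cinner_scaleC_right mult.assoc mult.left_commute)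
    also have "cnj c * c = 1" using complex_norm_square[of c] c by (simp add: mult.commute)
    finally have "(norm (c *c y))\<^sup>2 = (norm y)\<^sup>2" by (metis mult_1 of_real_eq_iff)
    then show ?thesis by simp
  qed
  finally show ?thesis .
qed simp

text \<open>Uniform boundedness via Baire: some \<open>F k\<close> contains a ball, and moving from
  its centre in the direction of u itself bounds the norm of u.\<close>

lemma weakly_bounded_imp_bounded:
  fixes A :: "'a::{real_inner, complete_space} set"
  assumes "\<And>y. \<exists>K. \<forall>u \<in> A. \<bar>inner u y\<bar> \<le> K"
  obtains K where "\<And>u. u \<in> A \<Longrightarrow> norm u \<le> K"
proof -
  define F where "F k = {y. \<forall>u \<in> A. \<bar>inner u y\<bar> \<le> real k}" for k :: nat
  have closed: "closed (F k)" for k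
  proof -
    have "F k = (\<Inter>u \<in> A. {y. \<bar>inner u y\<bar> \<le> real k})" unfolding F_def by auto
    moreover have "closed {y. \<bar>inner u y\<bar> \<le> real k}" for u
      by (intro closed_Collect_le continuous_intros)
    ultimately show ?thesis by auto
  qed
  have "\<Union>(range F) = UNIV"
  proof -
    have "y \<in> \<Union>(range F)" for y
    proof -
      obtain K where K: "\<forall>u \<in> A. \<bar>inner u y\<bar> \<le> K" using assms by blast
      obtain k :: nat where "K \<le> real k" using real_arch_simple by blast
      then have "y \<in> F k" using K unfolding F_def by force
      then show ?thesis by blast
    qed
    then show ?thesis by blast
  qed
  then have "\<not> (\<forall>k. interior (F k) = {})"
    using Met_TC.metric_Baire_category_alt[of "range F"] closed complete_UNIV
    by (auto simp: interior_of_def interior_def)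
  then obtain k y\<^sub>0 where "y\<^sub>0 \<in> interior (F k)" by blast
  then obtain r where r: "0 < r" "cball y\<^sub>0 r \<subseteq> F k" using mem_interior_cball by blast
  have "norm u \<le> 2 * real k / r" if u: "u \<in> A" for u
  proof (cases "u = 0")
    case False
    let ?v = "(r / norm u) *\<^sub>R u"
    have "y\<^sub>0 + ?v \<in> F k" "y\<^sub>0 \<in> F k" using r False by (auto simp: dist_norm subset_iff)
    then have "\<bar>inner u (y\<^sub>0 + ?v)\<bar> \<le> real k" "\<bar>inner u y\<^sub>0\<bar> \<le> real k" using u unfolding F_def by blast+
    then have "inner u ?v \<le> 2 * real k" by (simp add: inner_add_right)
    also have "inner u ?v = r * norm u"
      using False by (simp add: power2_norm_eq_inner[symmetric] power2_eq_square)
    finally show ?thesis using r(1) by (simp add: pos_le_divide_eq mult.commute)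
  qed (use r in auto)
  then show ?thesis using that by blast
qed

text \<open>Stated for indexed families, where a repeated value already counts as a
  dependence.\<close>

lemma family_dependent:
  fixes v :: "nat \<Rightarrow> 'a::complex_vector"
  assumes fin: "finite_cdim (UNIV :: 'a set)" and d: "cvec.dim (UNIV :: 'a set) < d"
  obtains c i where "i < d" "c i \<noteq> 0" "(\<Sum>i<d. c i *c v i) = 0"
proof (cases "inj_on v {..<d}")
  case True
  have "cvec.dependent (v ` {..<d})"
    using independent_card_le_cdim[OF fin, of "v ` {..<d}"] card_image[OF True] d by auto
  then obtain u where u: "\<exists>x \<in> v ` {..<d}. u x \<noteq> 0" "(\<Sum>x \<in> v ` {..<d}. u x *c x) = 0"
    using cvec.dependent_finite[of "v ` {..<d}"] by auto
  then obtain i where "i < d" "(u \<circ> v) i \<noteq> 0" by auto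
  moreover have "(\<Sum>i<d. (u \<circ> v) i *c v i) = 0" using u(2) by (simp add: sum.reindex[OF True])
  ultimately show ?thesis by (rule that)
next
  case False
  then obtain i j where ij: "i < d" "j < d" "i \<noteq> j" "v i = v j" unfolding inj_on_def by auto
  let ?c = "\<lambda>k. (if k = i then 1 else 0) - (if k = j then 1 else 0 :: complex)"
  have "(\<Sum>k<d. ?c k *c v k) = (\<Sum>k<d. (if k = i then v i else 0) - (if k = j then v j else 0))"
    by (intro sum.cong) (auto simp: cvec.scale_left_diff_distrib)
  also have "\<dots> = 0" using ij by (simp add: sum_subtractf)
  finally show ?thesis using that[of i ?c] ij by simp
qed

text \<open>\<open>max\<close> says that the adjoint is contained in T. It also forces D to be
  dense: a vector h orthogonal to D satisfies its premise with g = 0, so h = T 0 = 0.\<close>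

locale selfadjoint =
  fixes D :: "'h::chilbert_space set" and T :: "'h \<Rightarrow> 'h"
  assumes D: "cvec.subspace D"
    and T_add: "f \<in> D \<Longrightarrow> g \<in> D \<Longrightarrow> T (f + g) = T f + T g"
    and T_scale: "f \<in> D \<Longrightarrow> T (a *c f) = a *c T f"
    and sym: "f \<in> D \<Longrightarrow> g \<in> D \<Longrightarrow> cinner f (T g) = cinner (T f) g"
    and max: "(\<And>f. f \<in> D \<Longrightarrow> cinner g (T f) = cinner h f) \<Longrightarrow> g \<in> D \<and> T g = h"
begin

definition eig :: "real \<Rightarrow> 'h set" where
  "eig \<mu> = {f \<in> D. T f = of_real \<mu> *c f}"

definition form :: "'h \<Rightarrow> real" where
  "form f = Re (cinner f (T f))"

text \<open>\<open>R\<close> will be the range of \<open>S - s\<close>.\<close>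

definition fredholm_at :: "real \<Rightarrow> bool" where
  "fredholm_at s \<longleftrightarrow> (\<exists>R W. closed R \<and> cvec.subspace R \<and> R \<subseteq> (\<lambda>f. T f - of_real s *c f) ` D \<and>
     finite_cdim W \<and> (\<forall>h. \<exists>r \<in> R. \<exists>w \<in> W. h = r + w))"

lemma T_zero: "T 0 = 0"
  using T_scale[OF cvec.subspace_0[OF D], of 0] by simp

lemma T_diff: "f \<in> D \<Longrightarrow> g \<in> D \<Longrightarrow> T (f - g) = T f - T g"
  using T_add[of "f - g" g] cvec.subspace_diff[OF D] by (simp add: algebra_simps)

lemma form_add: "f \<in> D \<Longrightarrow> g \<in> D \<Longrightarrow> form (f + g) = form f + 2 * Re (cinner g (T f)) + form g"
  using sym[of f g] cinner_commute[of "T f" g]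
  by (simp add: form_def T_add cinner_add_left cinner_add_right)

lemma form_scaleR: "f \<in> D \<Longrightarrow> form (r *\<^sub>R f) = r\<^sup>2 * form f"
  using T_scale[of f "of_real r"]
  by (simp add: form_def scaleC_of_real cinner_scaleR_left cinner_scaleR_right power2_eq_square)

lemma eig_subspace: "cvec.subspace (eig \<mu>)"
  unfolding eig_def
  by (rule cvec.subspaceI)
    (use D in \<open>auto simp: T_zero T_add T_scale scaleC_add_right mult.commute
      intro: cvec.subspace_0 cvec.subspace_add cvec.subspace_scale\<close>)

lemma eig_orthogonal:
  assumes "f \<in> eig \<mu>" "g \<in> eig \<nu>" "\<mu> \<noteq> \<nu>"
  shows "cinner f g = 0"
proof -
  have "of_real \<nu> * cinner f g = of_real \<mu> * cinner f g"
    using sym[of f g] assms(1,2) by (simp add: eig_def cinner_scaleC_left cinner_scaleC_right)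
  then show ?thesis using assms(3) by simp
qed

text \<open>Only the smaller range R is known to be closed. The full range is the sum of R and its
  part in the orthogonal complement N of R, and N is finite-dimensional, so the solvability question
  reduces to a projection inside N.\<close>

lemma fredholm_at_eig:
  assumes "fredholm_at s"
  shows "finite_cdim (eig s)"
    and "\<And>y. (\<And>k. k \<in> eig s \<Longrightarrow> cinner k y = 0) \<Longrightarrow> \<exists>x \<in> D. T x - of_real s *c x = y"
proof -
  obtain R W where R: "closed R" "cvec.subspace R" "R \<subseteq> (\<lambda>f. T f - of_real s *c f) ` D"
    and W: "finite_cdim W" "\<And>h. \<exists>r \<in> R. \<exists>w \<in> W. h = r + w"
    using assms unfolding fredholm_at_def by blast
  define N where "N = {k. \<forall>r \<in> R. cinner r k = 0}"
  have sN: "cvec.subspace N"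
    unfolding N_def by (rule cvec.subspaceI) (auto simp: cinner_add_right cinner_scaleC_right)
  have eig_orth: "cinner k (T f - of_real s *c f) = 0" if "k \<in> eig s" "f \<in> D" for k f
    using sym[of k f] that by (simp add: eig_def cinner_diff_right cinner_scaleC_left cinner_scaleC_right)
  have ker: "k \<in> eig s" if "\<And>f. f \<in> D \<Longrightarrow> cinner k (T f - of_real s *c f) = 0" for k
    using max[of k "of_real s *c k"] that
    by (simp add: eig_def cinner_diff_right cinner_scaleC_left cinner_scaleC_right)
  have eigN: "eig s \<subseteq> N"
  proof
    fix k assume k: "k \<in> eig s"
    have "cinner r k = 0" if "r \<in> R" for r
      using R(3) that eig_orth[OF k] cinner_commute[of r k] by auto
    then show "k \<in> N" by (simp add: N_def)
  qed
  have split: "\<exists>r \<in> R. \<exists>k \<in> N. y = r + k" for y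
  proof -
    obtain p where p: "p \<in> R" "\<And>r. r \<in> R \<Longrightarrow> cinner r (y - p) = 0"
      using orthogonal_projection[OF R(1,2)] by blast
    then have "y - p \<in> N" by (simp add: N_def)
    then show ?thesis using p(1) by (intro bexI[of _ p] bexI[of _ "y - p"]) auto
  qed
  \<comment> \<open>N meets R only in 0, and W spans everything modulo R. Hence the N-components P b
    of a finite spanning set B of W span N.\<close>
  have finN: "finite_cdim N"
  proof -
    obtain B where B: "finite B" "W \<subseteq> cvec.span B" using W(1) by (auto simp: finite_cdim_def)
    obtain P where P: "\<And>y. P y \<in> N \<and> y - P y \<in> R" using split by (metis add_diff_cancel_right')
    have "N \<subseteq> cvec.span (P ` B)"
    proof
      fix k assume k: "k \<in> N"
      obtain r w where rw: "r \<in> R" "w \<in> W" "k = r + w" using W(2) by blast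
      have "w \<in> cvec.span B" using rw B by blast
      then have "\<exists>r' \<in> R. w - r' \<in> cvec.span (P ` B)"
      proof (induction rule: cvec.span_induct_alt)
        case base
        then show ?case using cvec.subspace_0[OF R(2)] cvec.span_zero by (intro bexI[of _ 0]) simp_all
      next
        case (step c b y)
        then obtain r' where r': "r' \<in> R" "y - r' \<in> cvec.span (P ` B)" by blast
        have "c *c (b - P b) + r' \<in> R"
          using P r' cvec.subspace_add[OF R(2)] cvec.subspace_scale[OF R(2)] by blast
        moreover have "c *c P b + (y - r') \<in> cvec.span (P ` B)"
          using cvec.span_add[OF cvec.span_scale[OF cvec.span_base] r'(2), of "P b" c] step(1) by blast
        then have "(c *c b + y) - (c *c (b - P b) + r') \<in> cvec.span (P ` B)"
          by (simp add: cvec.scale_right_diff_distrib algebra_simps)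
        ultimately show ?case by blast
      qed
      then obtain r' where r': "r' \<in> R" "w - r' \<in> cvec.span (P ` B)" by blast
      have "cvec.span (P ` B) \<subseteq> N" using P by (intro cvec.span_minimal sN) auto
      then have "k - (w - r') \<in> N" using k r'(2) cvec.subspace_diff[OF sN] by blast
      moreover have "k - (w - r') = r + r'" using rw(3) by simp
      moreover have "r + r' \<in> R" using rw(1) r'(1) cvec.subspace_add[OF R(2)] by blast
      ultimately have "cinner (r + r') (r + r') = 0" by (simp add: N_def)
      then have "k = w - r'" using rw(3) by (simp add: add_eq_0_iff)
      then show "k \<in> cvec.span (P ` B)" using r'(2) by simp
    qed
    then show ?thesis using B(1) unfolding finite_cdim_def by blast
  qed
  show "finite_cdim (eig s)" using finite_cdim_mono[OF finN eigN] .
  fix y assume y: "\<And>k. k \<in> eig s \<Longrightarrow> cinner k y = 0"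
  define Ran where "Ran = (\<lambda>f. T f - of_real s *c f) ` D"
  have sRan: "cvec.subspace Ran"
  proof (rule cvec.subspaceI)
    show "0 \<in> Ran" unfolding Ran_def using cvec.subspace_0[OF D] T_zero by force
    fix u v assume "u \<in> Ran" "v \<in> Ran"
    then obtain f g where "f \<in> D" "u = T f - of_real s *c f" "g \<in> D" "v = T g - of_real s *c g"
      unfolding Ran_def by blast
    then have "f + g \<in> D" "u + v = T (f + g) - of_real s *c (f + g)"
      using cvec.subspace_add[OF D] by (auto simp: T_add scaleC_add_right)
    then show "u + v \<in> Ran" unfolding Ran_def by blast
  next
    fix c u assume "u \<in> Ran"
    then obtain f where "f \<in> D" "u = T f - of_real s *c f" unfolding Ran_def by blast
    then have "c *c f \<in> D" "c *c u = T (c *c f) - of_real s *c (c *c f)"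
      using cvec.subspace_scale[OF D] by (auto simp: T_scale cvec.scale_right_diff_distrib mult.commute)
    then show "c *c u \<in> Ran" unfolding Ran_def by blast
  qed
  obtain r k where rk: "r \<in> R" "k \<in> N" "y = r + k" using split by blast
  have rRan: "r \<in> Ran" using rk(1) R(3) unfolding Ran_def by blast
  \<comment> \<open>z is the part of k that the range can reach. The rest k - z is orthogonal to the
    whole range, hence an eigenvector by \<open>max\<close>; it equals y - (r + z), and y and r + z
    are both orthogonal to it, so it vanishes.\<close>
  let ?N' = "Ran \<inter> N"
  have "cvec.subspace ?N'" "finite_cdim ?N'"
    using cvec.subspace_inter[OF sRan sN] finite_cdim_mono[OF finN] by auto
  then obtain z where z: "z \<in> ?N'" "\<And>v. v \<in> ?N' \<Longrightarrow> cinner v (k - z) = 0"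
    using finite_orthogonal_projection[of ?N' k] by blast
  have kzN: "k - z \<in> N" using z(1) rk(2) cvec.subspace_diff[OF sN] by blast
  have "cinner v (k - z) = 0" if v: "v \<in> Ran" for v
  proof -
    obtain r' k' where rk': "r' \<in> R" "k' \<in> N" "v = r' + k'" using split by blast
    have "k' = v - r'" using rk'(3) by simp
    then have "k' \<in> Ran" using v rk'(1) R(3) cvec.subspace_diff[OF sRan] unfolding Ran_def by blast
    then have "cinner k' (k - z) = 0" using z(2) rk'(2) by blast
    moreover have "cinner r' (k - z) = 0" using kzN rk'(1) by (simp add: N_def)
    ultimately show ?thesis using rk'(3) by (simp add: cinner_add_left)
  qed
  then have "cinner (k - z) v = 0" if "v \<in> Ran" for v
    using that cinner_commute[of "k - z" v] by simp
  then have kz: "k - z \<in> eig s" by (intro ker) (auto simp: Ran_def)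
  have "cinner (k - z) (r + z) = 0"
  proof -
    have "r + z \<in> Ran" using rRan z(1) cvec.subspace_add[OF sRan] by blast
    then show ?thesis using eig_orth[OF kz] unfolding Ran_def by auto
  qed
  moreover have "cinner (k - z) y = 0" using y[OF kz] .
  moreover have e: "k - z = y - (r + z)" using rk(3) by simp
  ultimately have "cinner (k - z) (y - (r + z)) = 0" by (simp only: cinner_diff_right diff_self)
  then have "y - (r + z) = 0" unfolding e by (simp only: cinner_self_eq_0_iff)
  then have "y = r + z" by simp
  then have "y \<in> Ran" using rRan z(1) cvec.subspace_add[OF sRan] by blast
  then show "\<exists>x \<in> D. T x - of_real s *c x = y" unfolding Ran_def by blast
qed

text \<open>Uniform boundedness applied to the vectors u orthogonal to the eigenspace with |(T - s)
  u| \<le> 1: solving (T - s) x = y - p, with p the eigenspace part of y, turns the product of u and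
  y into that of (T - s) u and x, which is at most |x|.\<close>

lemma fredholm_at_bounded_below:
  assumes s: "fredholm_at s"
  obtains c where "0 < c"
    "\<And>f. f \<in> D \<Longrightarrow> (\<And>k. k \<in> eig s \<Longrightarrow> cinner k f = 0) \<Longrightarrow> c * norm f \<le> norm (T f - of_real s *c f)"
proof -
  define A where "A = {f \<in> D. (\<forall>k \<in> eig s. cinner k f = 0) \<and> norm (T f - of_real s *c f) \<le> 1}"
  have "\<exists>K. \<forall>u \<in> A. \<bar>inner u y\<bar> \<le> K" for y
  proof -
    obtain p where p: "p \<in> eig s" "\<And>k. k \<in> eig s \<Longrightarrow> cinner k (y - p) = 0"
      using finite_orthogonal_projection[OF eig_subspace fredholm_at_eig(1)[OF s]] by blast
    obtain x where x: "x \<in> D" "T x - of_real s *c x = y - p" using fredholm_at_eig(2)[OF s p(2)] by blast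
    have "\<bar>inner u y\<bar> \<le> norm x" if u: "u \<in> A" for u
    proof -
      have uD: "u \<in> D" and "cinner p u = 0" and le: "norm (T u - of_real s *c u) \<le> 1"
        using u p(1) unfolding A_def by auto
      then have "cinner u p = 0" using cinner_commute[of u p] by simp
      then have "cinner u y = cinner u (T x - of_real s *c x)" using x(2) by (simp add: cinner_diff_right)
      also have "\<dots> = cinner (T u - of_real s *c u) x"
        using sym[OF uD x(1)] by (simp add: cinner_diff_right cinner_diff_left cinner_scaleC_left cinner_scaleC_right)
      finally have "inner u y = inner (T u - of_real s *c u) x" by (simp add: inner_eq_Re_cinner)
      also have "\<bar>\<dots>\<bar> \<le> norm (T u - of_real s *c u) * norm x" by (rule Cauchy_Schwarz_ineq2)
      also have "\<dots> \<le> norm x" using le by (simp add: mult_left_le_one_le)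
      finally show ?thesis .
    qed
    then show ?thesis by blast
  qed
  then obtain K where K: "\<And>u. u \<in> A \<Longrightarrow> norm u \<le> K" using weakly_bounded_imp_bounded by blast
  show ?thesis
  proof (rule that)
    show "0 < 1 / (\<bar>K\<bar> + 1)" by simp
    fix f assume f: "f \<in> D" "\<And>k. k \<in> eig s \<Longrightarrow> cinner k f = 0"
    let ?n = "norm (T f - of_real s *c f)"
    show "1 / (\<bar>K\<bar> + 1) * norm f \<le> ?n"
    proof (cases "?n = 0")
      case True
      then have "f \<in> eig s" using f(1) by (simp add: eig_def)
      then have "f = 0" using f(2)[of f] by simp
      then show ?thesis by simp
    next
      case False
      let ?u = "(1 / ?n) *\<^sub>R f"
      have "?u = of_real (1 / ?n) *c f" by (simp only: scaleC_of_real)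
      then have "T ?u - of_real s *c ?u = (1 / ?n) *\<^sub>R (T f - of_real s *c f)" "?u \<in> D"
        using T_scale[OF f(1), of "of_real (1 / ?n)"] cvec.subspace_scale[OF D f(1)]
        by (simp_all add: scaleC_of_real[symmetric] cvec.scale_right_diff_distrib mult.commute del: of_real_divide)
      then have "?u \<in> A" using f False unfolding A_def by (simp add: cinner_scaleR_right)
      then have "norm f / ?n \<le> K" using K[of ?u] by simp
      then have "norm f \<le> K * ?n" using False by (simp add: divide_simps split: if_splits)
      also have "\<dots> \<le> (\<bar>K\<bar> + 1) * ?n" by (intro mult_right_mono) auto
      finally show ?thesis by (simp add: divide_simps mult.commute)
    qed
  qed
qed

end

section \<open>Semiboundedness, discreteness of the eigenvalues and the spectral gap\<close>

context selfadjoint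
begin

text \<open>The clause on vectors orthogonal to all eigenspaces drives the induction: it makes the
  next eigenspace orthogonal to the V built so far, so that dimensions and form values add.\<close>

lemma eig_sum:
  assumes "finite E" "\<And>\<mu>. \<mu> \<in> E \<Longrightarrow> finite_cdim (eig \<mu>)" "\<And>\<mu>. \<mu> \<in> E \<Longrightarrow> \<mu> \<le> t"
  shows "\<exists>V. cvec.subspace V \<and> finite_cdim V \<and> cvec.dim V = (\<Sum>\<mu>\<in>E. cvec.dim (eig \<mu>)) \<and> V \<subseteq> D \<and>
    T ` V \<subseteq> V \<and> (\<forall>x. (\<forall>\<mu> \<in> E. \<forall>k \<in> eig \<mu>. cinner k x = 0) \<longrightarrow> (\<forall>f \<in> V. cinner f x = 0)) \<and>
    (\<forall>\<mu> \<in> E. eig \<mu> \<subseteq> V) \<and> (\<forall>f \<in> V. form f \<le> t * (norm f)\<^sup>2)"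
  using assms
proof (induction E rule: finite_induct)
  case empty
  have "finite_cdim {0 :: 'h}" unfolding finite_cdim_def by (intro exI[of _ "{}"]) auto
  moreover have "cvec.dim {0 :: 'h} = 0" using cvec.dim_le_card[of "{0 :: 'h}" "{}"] by simp
  ultimately show ?case
    using T_zero cvec.subspace_0[OF D] by (intro exI[of _ "{0}"]) (simp add: form_def)
next
  case (insert \<mu> E)
  obtain V where V: "cvec.subspace V" "finite_cdim V" "cvec.dim V = (\<Sum>\<mu>\<in>E. cvec.dim (eig \<mu>))" "V \<subseteq> D"
    "T ` V \<subseteq> V" "\<And>x f. (\<And>\<mu> k. \<mu> \<in> E \<Longrightarrow> k \<in> eig \<mu> \<Longrightarrow> cinner k x = 0) \<Longrightarrow> f \<in> V \<Longrightarrow> cinner f x = 0"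
    "\<And>\<mu>. \<mu> \<in> E \<Longrightarrow> eig \<mu> \<subseteq> V" "\<And>f. f \<in> V \<Longrightarrow> form f \<le> t * (norm f)\<^sup>2"
    using insert.IH[OF insert.prems] by force
  have orth: "cinner f k = 0" if "f \<in> V" "k \<in> eig \<mu>" for f k
    using V(6)[OF _ that(1), of k] eig_orthogonal that(2) insert.hyps(2) by metis
  have disj: "V \<inter> eig \<mu> \<subseteq> {0}" using orth by fastforce
  let ?V = "{u + w | u w. u \<in> V \<and> w \<in> eig \<mu>}"
  have fm: "finite_cdim (eig \<mu>)" and \<mu>: "\<mu> \<le> t" using insert.prems by auto
  have eD: "w \<in> D" "T w = of_real \<mu> *c w" if "w \<in> eig \<mu>" for w using that by (auto simp: eig_def)
  note ds = cdim_direct_sum[OF V(2) fm V(1) eig_subspace disj]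
  have VD: "?V \<subseteq> D" using V(4) eD(1) cvec.subspace_add[OF D] by blast
  have TV: "T ` ?V \<subseteq> ?V"
  proof (rule image_subsetI)
    fix x assume "x \<in> ?V"
    then obtain u w where uw: "x = u + w" "u \<in> V" "w \<in> eig \<mu>" by blast
    then have "T x = T u + of_real \<mu> *c w" using V(4) eD T_add by auto
    moreover have "T u \<in> V" "of_real \<mu> *c w \<in> eig \<mu>"
      using uw V(5) cvec.subspace_scale[OF eig_subspace] by blast+
    ultimately show "T x \<in> ?V" by blast
  qed
  have fm: "form x \<le> t * (norm x)\<^sup>2" if x: "x \<in> ?V" for x
  proof -
    obtain u w where uw: "x = u + w" "u \<in> V" "w \<in> eig \<mu>" using x by blast
    have uD: "u \<in> D" and "T u \<in> V" using uw(2) V(4,5) by blast+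
    then have "cinner (T u) w = 0" using orth uw(3) by blast
    then have "cinner w (T u) = 0" using cinner_commute[of w "T u"] by simp
    then have "form x = form u + form w" using form_add[OF uD eD(1)[OF uw(3)]] uw(1) by simp
    also have "form w = \<mu> * (norm w)\<^sup>2" by (simp add: form_def eD(2)[OF uw(3)] cinner_scaleC_right cinner_self)
    also have "form u + \<mu> * (norm w)\<^sup>2 \<le> t * (norm u)\<^sup>2 + t * (norm w)\<^sup>2"
      using V(8)[OF uw(2)] \<mu> by (intro add_mono mult_right_mono) auto
    also have "\<dots> = t * (norm x)\<^sup>2"
      using norm_add_orthogonal[OF orth[OF uw(2,3)]] uw(1) by (simp add: distrib_left)
    finally show ?thesis .
  qed
  have sub: "eig \<nu> \<subseteq> ?V" if "\<nu> \<in> insert \<mu> E" for \<nu>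
  proof (cases "\<nu> = \<mu>")
    case True
    show ?thesis
    proof
      fix w assume "w \<in> eig \<nu>"
      then show "w \<in> ?V" using cvec.subspace_0[OF V(1)] True
        by (intro CollectI exI[of _ 0] exI[of _ w]) simp
    qed
  next
    case False
    then have "eig \<nu> \<subseteq> V" using V(7) that by blast
    show ?thesis
    proof
      fix w assume "w \<in> eig \<nu>"
      then show "w \<in> ?V" using cvec.subspace_0[OF eig_subspace] \<open>eig \<nu> \<subseteq> V\<close>
        by (intro CollectI exI[of _ w] exI[of _ 0]) auto
    qed
  qed
  have ann: "cinner f x = 0" if x: "\<forall>\<nu> \<in> insert \<mu> E. \<forall>k \<in> eig \<nu>. cinner k x = 0" "f \<in> ?V" for x f
  proof -
    obtain u w where "f = u + w" "u \<in> V" "w \<in> eig \<mu>" using x(2) by blast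
    then show ?thesis using V(6)[of x u] x(1) by (simp add: cinner_add_left)
  qed
  have dim: "cvec.dim ?V = (\<Sum>\<mu>\<in>insert \<mu> E. cvec.dim (eig \<mu>))" using ds(2) V(3) insert.hyps by simp
  show ?case
    by (intro exI[of _ ?V] conjI ballI allI impI)
      (fact cvec.subspace_sums[OF V(1) eig_subspace] ds(1) dim VD TV | erule (1) ann sub fm | erule sub fm)+
qed

text \<open>If the form were unbounded below, Gram-Schmidt would produce arbitrarily long form-orthonormal
  negative families, and the kernel of \<open>G\<close> meets the span of a long one.\<close>

lemma semibounded_of_finite_codim:
  fixes G :: "'h \<Rightarrow> 'b::complex_vector"
  assumes fin: "finite_cdim (UNIV :: 'b set)" and G: "clinear_on D G"
    and m: "\<And>f. f \<in> D \<Longrightarrow> G f = 0 \<Longrightarrow> m * (norm f)\<^sup>2 \<le> form f"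
  shows "\<exists>C. \<forall>f \<in> D. C * (norm f)\<^sup>2 \<le> form f"
proof (rule ccontr)
  assume unbounded: "\<nexists>C. \<forall>f \<in> D. C * (norm f)\<^sup>2 \<le> form f"
  \<comment> \<open>The shift by m makes h nonnegative on the kernel of G; the aim is a vector of
    that kernel with h negative.\<close>
  define h where "h f g = cinner f (T g) - of_real m * cinner f g" for f g
  have h_add: "h f (g + g') = h f g + h f g'" if "g \<in> D" "g' \<in> D" for f g g'
    using that by (simp add: h_def T_add cinner_add_right algebra_simps)
  have h_scale: "h f (a *c g) = a * h f g" if "g \<in> D" for f g a
    using that by (simp add: h_def T_scale cinner_scaleC_right algebra_simps)
  have h_scale': "h (a *c f) g = cnj a * h f g" for f g a
    by (simp add: h_def cinner_scaleC_left algebra_simps)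
  have h_sum: "h f (\<Sum>i\<in>I. c i *c e i) = (\<Sum>i\<in>I. c i * h f (e i))"
    if "finite I" "\<And>i. i \<in> I \<Longrightarrow> e i \<in> D" for f c I and e :: "nat \<Rightarrow> 'h"
    using that
  proof (induction I rule: finite_induct)
    case empty
    then show ?case by (simp add: h_def T_zero)
  next
    case (insert i I)
    have "c i *c e i \<in> D" "(\<Sum>i\<in>I. c i *c e i) \<in> D" "e i \<in> D"
      using insert.prems D by (auto intro!: cvec.subspace_scale cvec.subspace_sum)
    then show ?case using insert h_add h_scale by simp
  qed
  have h_commute: "h f g = cnj (h g f)" if "f \<in> D" "g \<in> D" for f g
    using sym[OF that] by (simp add: h_def cinner_commute')
  have h_self: "h f f = of_real (form f - m * (norm f)\<^sup>2)" if "f \<in> D" for f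
  proof (rule complex_eqI)
    have "Im (h f f) = Im (cnj (h f f))" by (rule arg_cong[OF h_commute[OF that that]])
    then show "Im (h f f) = Im (of_real (form f - m * (norm f)\<^sup>2))" by simp
  qed (simp add: h_def form_def cinner_self)
  have family: "\<exists>e :: nat \<Rightarrow> 'h. \<forall>i < d. e i \<in> D \<and> (\<forall>j < d. h (e i) (e j) = (if i = j then - 1 else 0))" for d
  proof (induction d)
    case (Suc d)
    then obtain e where e: "\<And>i. i < d \<Longrightarrow> e i \<in> D"
      "\<And>i j. i < d \<Longrightarrow> j < d \<Longrightarrow> h (e i) (e j) = (if i = j then - 1 else 0)" by metis
    \<comment> \<open>Cauchy-Schwarz bounds the sum of the |\<kappa> j|^2 by C |f|^2, so a vector f
      with form below (m - C) |f|^2 stays negative for h after the correction by the earlier e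
      j.\<close>
    define C where "C = (\<Sum>j<d. (norm (T (e j) - of_real m *c e j))\<^sup>2)"
    obtain f where f: "f \<in> D" "form f < (m - C) * (norm f)\<^sup>2"
      using unbounded by (auto simp: not_le)
    define \<kappa> where "\<kappa> j = h (e j) f" for j
    \<comment> \<open>The sign is opposite to the usual one in Gram-Schmidt because h (e j) (e j) =
      - 1.\<close>
    define f' where "f' = f + (\<Sum>j<d. \<kappa> j *c e j)"
    have sD: "(\<Sum>j<d. \<kappa> j *c e j) \<in> D"
      using D e(1) by (auto intro!: cvec.subspace_scale cvec.subspace_sum)
    then have f'D: "f' \<in> D" unfolding f'_def using f(1) cvec.subspace_add[OF D] by blast
    have h_e: "h (e i) f' = 0" if i: "i < d" for i
    proof -
      have "h (e i) f' = \<kappa> i + (\<Sum>j<d. \<kappa> j * h (e i) (e j))"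
        unfolding f'_def using h_add[OF f(1) sD] h_sum[of "{..<d}" e] e(1) by (simp add: \<kappa>_def)
      also have "(\<Sum>j<d. \<kappa> j * h (e i) (e j)) = (\<Sum>j<d. if i = j then - \<kappa> j else 0)"
        using e(2) i by (intro sum.cong) auto
      finally show ?thesis using i by simp
    qed
    have h_e': "h f' (e i) = 0" if "i < d" for i
      using h_e[OF that] h_commute[OF f'D e(1)[OF that]] by simp
    have "h f' f' = h f' f"
      unfolding f'_def[THEN arg_cong[of _ _ "h f'"]]
      using h_add[OF f(1) sD, of f'] h_sum[of "{..<d}" e f' \<kappa>] e(1) h_e' by simp
    also have "\<dots> = cnj (h f f')" by (rule h_commute[OF f'D f(1)])
    also have "h f f' = h f f + (\<Sum>j<d. \<kappa> j * cnj (\<kappa> j))"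
      unfolding f'_def using h_add[OF f(1) sD, of f] h_sum[of "{..<d}" e f \<kappa>] e(1)
        h_commute[OF f(1) e(1)] by (simp add: \<kappa>_def)
    also have "(\<Sum>j<d. \<kappa> j * cnj (\<kappa> j)) = of_real (\<Sum>j<d. (cmod (\<kappa> j))\<^sup>2)"
      by (simp only: of_real_sum complex_norm_square)
    finally have hf': "h f' f' = of_real (form f - m * (norm f)\<^sup>2 + (\<Sum>j<d. (cmod (\<kappa> j))\<^sup>2))"
      by (simp add: h_self[OF f(1)])
    have "(\<Sum>j<d. (cmod (\<kappa> j))\<^sup>2) \<le> (\<Sum>j<d. (norm (T (e j) - of_real m *c e j))\<^sup>2 * (norm f)\<^sup>2)"
    proof (rule sum_mono)
      fix j assume "j \<in> {..<d}"
      then have "\<kappa> j = cinner (T (e j) - of_real m *c e j) f"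
        using sym[OF e(1) f(1), of j] by (simp add: \<kappa>_def h_def cinner_diff_left cinner_scaleC_left)
      then have "cmod (\<kappa> j) \<le> norm (T (e j) - of_real m *c e j) * norm f" using cinner_norm_le by simp
      then have "(cmod (\<kappa> j))\<^sup>2 \<le> (norm (T (e j) - of_real m *c e j) * norm f)\<^sup>2" by (rule power_mono) simp
      then show "(cmod (\<kappa> j))\<^sup>2 \<le> (norm (T (e j) - of_real m *c e j))\<^sup>2 * (norm f)\<^sup>2"
        by (simp add: power_mult_distrib)
    qed
    also have "\<dots> = C * (norm f)\<^sup>2" by (simp add: C_def sum_distrib_right)
    finally have neg: "form f - m * (norm f)\<^sup>2 + (\<Sum>j<d. (cmod (\<kappa> j))\<^sup>2) < 0"
      using f(2) by (simp add: algebra_simps)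
    define \<rho> where "\<rho> = sqrt (- (form f - m * (norm f)\<^sup>2 + (\<Sum>j<d. (cmod (\<kappa> j))\<^sup>2)))"
    have \<rho>2: "\<rho>\<^sup>2 = - (form f - m * (norm f)\<^sup>2 + (\<Sum>j<d. (cmod (\<kappa> j))\<^sup>2))"
      unfolding \<rho>_def using neg by (intro real_sqrt_pow2) simp
    have \<rho>: "0 < \<rho>" "h f' f' = - of_real (\<rho>\<^sup>2)"
      using neg unfolding hf' \<rho>2 by (simp_all add: \<rho>_def)
    define f'' where "f'' = of_real (1 / \<rho>) *c f'"
    have f''D: "f'' \<in> D" unfolding f''_def using f'D cvec.subspace_scale[OF D] by blast
    have "h f'' f'' = of_real (1 / \<rho>) * (of_real (1 / \<rho>) * h f' f')"
      using h_scale[OF f'D] h_scale' unfolding f''_def by simp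
    also have "\<dots> = - 1" using \<rho> by (simp add: power2_eq_square)
    finally have h1: "h f'' f'' = - 1" .
    have h2: "h (e i) f'' = 0" "h f'' (e i) = 0" if "i < d" for i
      unfolding f''_def using h_scale[OF f'D] h_scale' h_e[OF that] h_e'[OF that] by simp_all
    show ?case
      by (intro exI[of _ "e(d := f'')"]) (use e f''D h1 h2 in \<open>auto simp: less_Suc_eq\<close>)
  qed simp
  \<comment> \<open>One member more than the dimension of the target, so that G kills a nontrivial
    combination, on which h is minus a sum of squares.\<close>
  define d where "d = Suc (cvec.dim (UNIV :: 'b set))"
  obtain e where e: "\<And>i. i < d \<Longrightarrow> e i \<in> D"
    "\<And>i j. i < d \<Longrightarrow> j < d \<Longrightarrow> h (e i) (e j) = (if i = j then - 1 else 0)" using family[of d] by metis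
  obtain c i where c: "i < d" "c i \<noteq> 0" "(\<Sum>i<d. c i *c G (e i)) = 0"
    by (rule family_dependent[OF fin, of d "\<lambda>i. G (e i)"]) (simp add: d_def)
  let ?x = "\<Sum>i<d. c i *c e i"
  have G_sum: "G (\<Sum>i\<in>I. c i *c e i) = (\<Sum>i\<in>I. c i *c G (e i))" if "finite I" "I \<subseteq> {..<d}" for I
    using that
  proof (induction I rule: finite_induct)
    case empty
    have "G (0 *c 0) = 0 *c G 0" using G cvec.subspace_0[OF D] unfolding clinear_on_def by blast
    then show ?case by simp
  next
    case (insert i I)
    have "c i *c e i \<in> D" "(\<Sum>i\<in>I. c i *c e i) \<in> D" "e i \<in> D"
      using insert.prems D e(1) by (auto intro!: cvec.subspace_scale cvec.subspace_sum)
    then show ?case using insert G unfolding clinear_on_def by simp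
  qed
  have xD: "?x \<in> D" using D e(1) by (auto intro!: cvec.subspace_scale cvec.subspace_sum)
  have "h (e j) ?x = - c j" if "j < d" for j
  proof -
    have "h (e j) ?x = (\<Sum>i<d. c i * h (e j) (e i))" using h_sum[of "{..<d}" e] e(1) by simp
    also have "\<dots> = (\<Sum>i<d. if j = i then - c i else 0)" using e(2) that by (intro sum.cong) auto
    finally show ?thesis using that by simp
  qed
  then have hx: "h ?x (e j) = - cnj (c j)" if "j < d" for j
    using h_commute[OF xD e(1)[OF that]] that by simp
  have "h ?x ?x = (\<Sum>i<d. c i * h ?x (e i))" using h_sum[of "{..<d}" e] e(1) by simp
  also have "\<dots> = - of_real (\<Sum>i<d. (cmod (c i))\<^sup>2)"
    using hx by (simp add: sum_negf complex_norm_square del: of_real_power)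
  finally have "Re (h ?x ?x) = - (\<Sum>i<d. (cmod (c i))\<^sup>2)"
    by (simp only: uminus_complex.sel Re_complex_of_real)
  then have "form ?x - m * (norm ?x)\<^sup>2 = - (\<Sum>i<d. (cmod (c i))\<^sup>2)"
    by (simp only: h_self[OF xD] Re_complex_of_real)
  moreover have "0 < (\<Sum>i<d. (cmod (c i))\<^sup>2)"
    using c by (intro sum_pos2[of _ i]) auto
  ultimately show False using m[OF xD] G_sum[of "{..<d}"] c(3) by simp
qed

text \<open>A strict gap above t. Let m be the infimum of the form over unit vectors orthogonal to
  V. If m \<le> t, then T - m has a bounded inverse on the complement of V, which lifts the form
  there to at least m + c with c > 0, against the choice of m.\<close>

lemma spectral_gap:
  assumes C: "\<forall>f \<in> D. C * (norm f)\<^sup>2 \<le> form f"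
    and F: "\<forall>s \<le> t. fredholm_at s"
  shows "finite {\<mu>. \<mu> \<le> t \<and> eig \<mu> \<noteq> {0}}" (is "finite ?E")
    and "\<exists>V t'. cvec.subspace V \<and> finite_cdim V \<and> V \<subseteq> D \<and>
      cvec.dim V = (\<Sum>\<mu> | \<mu> \<le> t \<and> eig \<mu> \<noteq> {0}. cvec.dim (eig \<mu>)) \<and>
      (\<forall>f \<in> V. T f \<in> V) \<and> (\<forall>f \<in> V. form f \<le> t * (norm f)\<^sup>2) \<and> t < t' \<and>
      (\<forall>f \<in> D. (\<forall>v \<in> V. cinner v f = 0) \<longrightarrow> t' * (norm f)\<^sup>2 \<le> form f)"
proof -
  have "?E \<subseteq> {C..t}"
  proof
    fix \<mu> assume "\<mu> \<in> ?E"
    then obtain f where f: "f \<in> eig \<mu>" "f \<noteq> 0" "\<mu> \<le> t" using cvec.subspace_0[OF eig_subspace] by blast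
    have "form f = \<mu> * (norm f)\<^sup>2" using f(1) by (simp add: form_def eig_def cinner_scaleC_right cinner_self)
    then have "C * (norm f)\<^sup>2 \<le> \<mu> * (norm f)\<^sup>2" using bspec[OF C, of f] f(1) by (simp add: eig_def)
    then show "\<mu> \<in> {C..t}" using f(2,3) by simp
  qed
  show fin: "finite ?E"
  proof (rule ccontr)
    assume inf: "infinite ?E"
    \<comment> \<open>At an accumulation point s, eigenvectors for nearby \<mu> are orthogonal to
      \<open>eig s\<close> and are multiplied by \<mu> - s under T - s, which violates the lower
      bound c.\<close>
    then obtain s where s: "s \<in> {C..t}" "s islimpt ?E"
      using Heine_Borel_imp_Bolzano_Weierstrass[OF compact_Icc inf \<open>?E \<subseteq> {C..t}\<close>] by blast
    obtain c where c: "0 < c"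
      "\<And>f. f \<in> D \<Longrightarrow> (\<And>k. k \<in> eig s \<Longrightarrow> cinner k f = 0) \<Longrightarrow> c * norm f \<le> norm (T f - of_real s *c f)"
      using fredholm_at_bounded_below[of s] F s(1) by auto
    have "\<exists>\<mu> \<in> ?E. \<mu> \<noteq> s \<and> dist \<mu> s < c" using s(2) c(1) unfolding islimpt_approachable by blast
    then obtain \<mu> where \<mu>: "\<mu> \<in> ?E" "\<mu> \<noteq> s" "\<bar>\<mu> - s\<bar> < c" unfolding dist_real_def by blast
    obtain f where f: "f \<in> eig \<mu>" "f \<noteq> 0" using \<mu>(1) cvec.subspace_0[OF eig_subspace] by blast
    have e: "T f - of_real s *c f = (\<mu> - s) *\<^sub>R f"
      using f(1) by (simp add: eig_def scaleC_of_real scaleR_diff_left)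
    have "c * norm f \<le> norm (T f - of_real s *c f)"
      using f(1) \<mu>(2) eig_orthogonal by (intro c(2)) (auto simp: eig_def)
    then show False using f(2) \<mu>(3) by (simp add: e)
  qed
  have finE: "finite_cdim (eig \<mu>)" if "\<mu> \<in> ?E" for \<mu> using fredholm_at_eig(1) F that by blast
  obtain V where V: "cvec.subspace V" "finite_cdim V" "cvec.dim V = (\<Sum>\<mu>\<in>?E. cvec.dim (eig \<mu>))" "V \<subseteq> D"
    "T ` V \<subseteq> V" "\<forall>\<mu> \<in> ?E. eig \<mu> \<subseteq> V" "\<forall>f \<in> V. form f \<le> t * (norm f)\<^sup>2"
    using eig_sum[OF fin finE, of t] by (metis (no_types, lifting) mem_Collect_eq)
  define D' where "D' = {f \<in> D. \<forall>v \<in> V. cinner v f = 0}"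
  have TD': "cinner v (T f) = 0" if "f \<in> D'" "v \<in> V" for f v
  proof -
    have "f \<in> D" "v \<in> D" "T v \<in> V" using that V(4,5) by (auto simp: D'_def)
    then show ?thesis using sym[of v f] that(1) by (simp add: D'_def)
  qed
  have "\<exists>t' > t. \<forall>f \<in> D'. t' * (norm f)\<^sup>2 \<le> form f"
  proof (cases "D' \<subseteq> {0}")
    case True
    then show ?thesis by (intro exI[of _ "t + 1"]) (auto simp: form_def)
  next
    case False
    let ?A = "form ` {f \<in> D'. norm f = 1}"
    have scale: "(1 / norm f) *\<^sub>R f \<in> {f \<in> D'. norm f = 1}" if "f \<in> D'" "f \<noteq> 0" for f
    proof -
      have "(1 / norm f) *\<^sub>R f \<in> D"
        using that cvec.subspace_scale[OF D, of f "of_real (1 / norm f)"]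
        unfolding scaleC_of_real by (simp add: D'_def)
      then show ?thesis using that by (auto simp: D'_def cinner_scaleR_right)
    qed
    have ne: "?A \<noteq> {}" using False scale by blast
    have bdd: "bdd_below ?A" using C unfolding D'_def by (intro bdd_belowI[of _ C]) force
    define m where "m = Inf ?A"
    have ge: "m * (norm f)\<^sup>2 \<le> form f" if f: "f \<in> D'" for f
    proof (cases "f = 0")
      case False
      have "m \<le> form ((1 / norm f) *\<^sub>R f)"
        unfolding m_def using bdd scale[OF f False] by (intro cInf_lower) blast
      also have "\<dots> = form f / (norm f)\<^sup>2"
        using form_scaleR[of f "1 / norm f"] f by (simp add: D'_def power_divide)
      finally show ?thesis using False by (simp add: pos_le_divide_eq)
    qed (simp add: form_def)
    have "t < m"
    proof (rule ccontr)
      assume "\<not> t < m"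
      then have mt: "m \<le> t" by simp
      obtain c where c: "0 < c"
        "\<And>f. f \<in> D \<Longrightarrow> (\<And>k. k \<in> eig m \<Longrightarrow> cinner k f = 0) \<Longrightarrow> c * norm f \<le> norm (T f - of_real m *c f)"
        using fredholm_at_bounded_below[of m] F mt by blast
      have eigV: "eig m \<subseteq> V"
      proof (cases "eig m = {0}")
        case True
        then show ?thesis using cvec.subspace_0[OF V(1)] by simp
      next
        case False
        then show ?thesis using V(6) mt by blast
      qed
      have gap: "m + c \<le> form f" if f: "f \<in> D'" "norm f = 1" for f
      proof -
        have fD: "f \<in> D" using f(1) by (simp add: D'_def)
        have "\<And>k. k \<in> eig m \<Longrightarrow> cinner k f = 0" using f(1) eigV by (auto simp: D'_def)
        then obtain x where x: "x \<in> D" "T x - of_real m *c x = f"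
          using fredholm_at_eig(2)[of m] F mt by blast
        obtain p where p: "p \<in> V" "\<And>v. v \<in> V \<Longrightarrow> cinner v (x - p) = 0"
          using finite_orthogonal_projection[OF V(1,2)] by blast
        define g where "g = x - p"
        have pD: "p \<in> D" using p(1) V(4) by blast
        have gD: "g \<in> D" unfolding g_def using x(1) pD cvec.subspace_diff[OF D] by blast
        have g: "g \<in> D'" using gD p(2) by (simp add: D'_def g_def)
        \<comment> \<open>Dropping the V-part p of x does not spoil the equation: ?q = (T - m) p
          lies in V and is orthogonal to both f and (T - m) g, hence is 0.\<close>
        let ?q = "T p - of_real m *c p"
        have qV: "?q \<in> V"
          using p(1) V(5) cvec.subspace_scale[OF V(1)] cvec.subspace_diff[OF V(1)] by blast
        have Tg: "T g - of_real m *c g = f - ?q"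
          using x T_diff[OF x(1) pD] by (simp add: g_def cvec.scale_right_diff_distrib algebra_simps)
        have "cinner ?q (T g - of_real m *c g) = 0"
          using TD'[OF g qV] g qV by (simp add: cinner_diff_right cinner_scaleC_right D'_def)
        moreover have "cinner ?q f = 0" using f(1) qV by (simp add: D'_def)
        ultimately have "cinner ?q ?q = 0" unfolding Tg by (simp add: cinner_diff_right[of _ f])
        then have Tg: "T g - of_real m *c g = f" using Tg by simp
        have "\<And>k. k \<in> eig m \<Longrightarrow> cinner k g = 0" using g eigV by (auto simp: D'_def)
        then have ng: "c * norm g \<le> 1" using c(2)[OF gD] Tg f(2) by simp
        define b where "b = inner g f"
        have b: "c * b \<le> 1"
        proof -
          have "b \<le> norm g" unfolding b_def using norm_cauchy_schwarz[of g f] f(2) by simp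
          then show ?thesis using ng c(1) by (meson mult_left_mono order_trans less_imp_le)
        qed
        have Tgf: "T g = f + m *\<^sub>R g" using Tg by (simp add: scaleC_of_real algebra_simps)
        have fg: "inner f (T g) = 1 + m * b"
          using f(2) by (simp add: Tgf inner_add_right b_def inner_commute norm_eq_1)
        have gg: "form g = b + m * (norm g)\<^sup>2"
          by (simp add: form_def inner_eq_Re_cinner[symmetric] Tgf inner_add_right b_def power2_norm_eq_inner)
        \<comment> \<open>For h = form - m |.|^2 the test vector f - c g with (T - m) g = f gives 0
          \<le> h(f) - 2 c + c^2 b, where b is the inner product of g and f. As c b \<le> 1, it
          follows that h(f) \<ge> c.\<close>
        let ?w = "f + (- c) *\<^sub>R g"
        have cgD: "(- c) *\<^sub>R g \<in> D" using gD cvec.subspace_scale[OF D, of g "of_real (- c)"] by (simp only: scaleC_of_real)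
        have wD: "?w \<in> D'"
          using f(1) g cgD cvec.subspace_add[OF D fD cgD]
          by (simp add: D'_def cinner_add_right cinner_scaleR_right cinner_diff_right)
        have "form ?w = form f + 2 * (- c) * inner f (T g) + c\<^sup>2 * form g"
        proof -
          have "form ?w = form f + 2 * Re (cinner ((- c) *\<^sub>R g) (T f)) + form ((- c) *\<^sub>R g)"
            by (rule form_add[OF fD cgD])
          also have "Re (cinner ((- c) *\<^sub>R g) (T f)) = - c * inner g (T f)"
            by (simp only: inner_eq_Re_cinner[symmetric] inner_scaleR_left)
          also have "inner g (T f) = inner f (T g)"
            using sym[OF gD fD] by (metis inner_commute inner_eq_Re_cinner)
          finally show ?thesis using form_scaleR[OF gD, of "- c"] by simp
        qed
        moreover have "(norm ?w)\<^sup>2 = 1 - 2 * c * b + c\<^sup>2 * (norm g)\<^sup>2"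
          using f(2) by (simp add: power2_norm_eq_inner inner_add_left inner_add_right inner_diff_left inner_diff_right
              inner_commute b_def power2_eq_square[of c] norm_eq_1 algebra_simps)
        ultimately have "m * (1 - 2 * c * b + c\<^sup>2 * (norm g)\<^sup>2)
            \<le> form f - 2 * c * (1 + m * b) + c\<^sup>2 * (b + m * (norm g)\<^sup>2)"
          using ge[OF wD] fg gg by simp
        then have "m + 2 * c - c * (c * b) \<le> form f" by (simp add: algebra_simps power2_eq_square)
        moreover have "c * (c * b) \<le> c * 1" using b c(1) by (intro mult_left_mono) auto
        ultimately show ?thesis by linarith
      qed
      have "m + c \<le> Inf ?A" using gap ne by (intro cInf_greatest) auto
      then show False using c(1) by (simp add: m_def)
    qed
    then show ?thesis using ge by blast
  qed
  then obtain t' where "t < t'" "\<forall>f \<in> D'. t' * (norm f)\<^sup>2 \<le> form f" by blast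
  then show "\<exists>V t'. cvec.subspace V \<and> finite_cdim V \<and> V \<subseteq> D \<and>
      cvec.dim V = (\<Sum>\<mu>\<in>?E. cvec.dim (eig \<mu>)) \<and>
      (\<forall>f \<in> V. T f \<in> V) \<and> (\<forall>f \<in> V. form f \<le> t * (norm f)\<^sup>2) \<and> t < t' \<and>
      (\<forall>f \<in> D. (\<forall>v \<in> V. cinner v f = 0) \<longrightarrow> t' * (norm f)\<^sup>2 \<le> form f)"
    using V by (intro exI[of _ V] exI[of _ t']) (auto simp: D'_def)
qed

text \<open>Applied with \<open>x\<close> converging in the form norm, this extends the lower bound to the form domain.\<close>

lemma form_lower_bound_limit:
  assumes V: "cvec.subspace V" "finite_cdim V" "V \<subseteq> D" "\<And>v. v \<in> V \<Longrightarrow> T v \<in> V"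
    and C: "\<And>f. f \<in> D \<Longrightarrow> C * (norm f)\<^sup>2 \<le> form f"
    and gap: "\<And>f. f \<in> D \<Longrightarrow> (\<And>v. v \<in> V \<Longrightarrow> cinner v f = 0) \<Longrightarrow> t * (norm f)\<^sup>2 \<le> form f"
    and x: "\<And>k. x k \<in> D" "x \<longlonglongrightarrow> f" "(\<lambda>k. form (x k)) \<longlonglongrightarrow> \<eta>"
    and f: "\<And>v. v \<in> V \<Longrightarrow> cinner v f = 0"
  shows "t * (norm f)\<^sup>2 \<le> \<eta>"
proof -
  have "\<exists>p \<in> V. \<forall>v \<in> V. cinner v (x k - p) = 0" for k
    by (rule finite_orthogonal_projection[OF V(1,2), of "x k"]) blast
  then have "\<forall>k. \<exists>p. p \<in> V \<and> (\<forall>v \<in> V. cinner v (x k - p) = 0)" by blast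
  then have "\<exists>p. \<forall>k. p k \<in> V \<and> (\<forall>v \<in> V. cinner v (x k - p k) = 0)" by (rule choice)
  then obtain p where p: "\<And>k. p k \<in> V" "\<And>k v. v \<in> V \<Longrightarrow> cinner v (x k - p k) = 0" by blast
  \<comment> \<open>f is orthogonal to V, so the V-part of x k is that of x k - f and tends to 0.
    Invariance of V removes the mixed term of the form, and C then controls the vanishing
    V-part.\<close>
  have p_le: "norm (p k) \<le> norm (x k - f)" for k
  proof -
    have "cinner (p k) (p k) = cinner (p k) (x k - f)"
      using p(2)[OF p(1), of k k] f[OF p(1), of k] by (simp add: cinner_diff_right)
    then have "(norm (p k))\<^sup>2 = inner (p k) (x k - f)"
      by (simp only: power2_norm_eq_inner inner_eq_Re_cinner)
    also have "\<dots> \<le> norm (p k) * norm (x k - f)" by (rule norm_cauchy_schwarz)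
    finally show ?thesis by (cases "p k = 0") (auto simp: power2_eq_square)
  qed
  have "(\<lambda>k. norm (x k - f)) \<longlonglongrightarrow> 0" using x(2) by (simp add: LIM_zero tendsto_norm_zero)
  then have "(\<lambda>k. norm (p k)) \<longlonglongrightarrow> 0"
    by (rule tendsto_sandwich[rotated 2, OF tendsto_const]) (use p_le in auto)
  then have "(\<lambda>k. C * (norm (p k))\<^sup>2 + t * ((norm (x k))\<^sup>2 - (norm (p k))\<^sup>2))
      \<longlonglongrightarrow> C * 0\<^sup>2 + t * ((norm f)\<^sup>2 - 0\<^sup>2)"
    by (intro tendsto_intros x(2))
  moreover have "C * (norm (p k))\<^sup>2 + t * ((norm (x k))\<^sup>2 - (norm (p k))\<^sup>2) \<le> form (x k)" for k
  proof -
    let ?y = "x k - p k"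
    have pD: "p k \<in> D" using p(1) V(3) by blast
    have yD: "?y \<in> D" using x(1) pD cvec.subspace_diff[OF D] by blast
    have "cinner (T (p k)) ?y = 0" using p V(4) by blast
    then have "cinner ?y (T (p k)) = 0" using cinner_commute[of ?y] by simp
    then have "form (x k) = form (p k) + form ?y" using form_add[OF pD yD] by simp
    moreover have "(norm (x k))\<^sup>2 = (norm (p k))\<^sup>2 + (norm ?y)\<^sup>2"
      using norm_add_orthogonal[OF p(2)[OF p(1), of k k]] by simp
    ultimately show ?thesis using C[OF pD] gap[OF yD p(2)] by simp
  qed
  ultimately have "C * 0\<^sup>2 + t * ((norm f)\<^sup>2 - 0\<^sup>2) \<le> \<eta>" using x(3) by (intro LIMSEQ_le[OF _ x(3)]) auto
  then show ?thesis by simp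
qed

end

section \<open>Extensions of a symmetric operator\<close>

text \<open>One map serves all extensions, each being its restriction to a domain; this is why
  \<open>selfadjoint\<close> takes domain and map separately. The \<open>THE\<close> is determined
  on the domain of the adjoint once S is densely defined.\<close>

definition adjoint_map :: "('h::chilbert_space \<times> 'h) set \<Rightarrow> 'h \<Rightarrow> 'h" where
  "adjoint_map S f = (THE g. (f, g) \<in> adjoint_op S)"

lemma subspace_adjoint_op: "cvec.subspace (adjoint_op S)"
proof (rule cvec.subspaceI)
  show "0 \<in> adjoint_op S" by (auto simp: adjoint_op_def zero_prod_def)
qed (auto simp: adjoint_op_def scaleC_prod_def cinner_add_left cinner_scaleC_left split: prod.splits; fastforce)+

lemma adjoint_op_unique:
  assumes "densely_defined S" "(f, g) \<in> adjoint_op S" "(f, g') \<in> adjoint_op S"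
  shows "g = g'"
proof -
  have "Domain S \<subseteq> {x. inner (g - g') x = 0}"
    using assms(2,3) by (auto simp: adjoint_op_def inner_eq_Re_cinner cinner_diff_left split: prod.splits; fastforce)
  moreover have "closed {x. inner (g - g') x = 0}" by (intro closed_Collect_eq continuous_intros)
  ultimately have "closure (Domain S) \<subseteq> {x. inner (g - g') x = 0}" by (rule closure_minimal)
  then have "inner (g - g') (g - g') = 0" using assms(1) unfolding densely_defined_def by blast
  then show ?thesis by simp
qed

lemma adjoint_map_eq: "densely_defined S \<Longrightarrow> (f, g) \<in> adjoint_op S \<Longrightarrow> adjoint_map S f = g"
  unfolding adjoint_map_def using adjoint_op_unique by blast

lemma adjoint_map_mem: "densely_defined S \<Longrightarrow> f \<in> Domain (adjoint_op S) \<Longrightarrow> (f, adjoint_map S f) \<in> adjoint_op S"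
  using adjoint_map_eq by blast

lemma extension_subset_adjoint: "self_adjoint_extension S H \<Longrightarrow> H \<subseteq> adjoint_op S"
  unfolding self_adjoint_extension_def self_adjoint_def adjoint_op_def by blast

lemma extension_graph:
  assumes "densely_defined S" "self_adjoint_extension S H"
  shows "(f, g) \<in> H \<longleftrightarrow> f \<in> Domain H \<and> g = adjoint_map S f"
  using adjoint_map_eq[OF assms(1)] extension_subset_adjoint[OF assms(2)] by blast

lemma selfadjoint_extension:
  assumes S: "densely_defined S" and H: "self_adjoint_extension S H"
  shows "selfadjoint (Domain H) (adjoint_map S)"
proof -
  note gr = extension_graph[OF S H]
  have sub: "cvec.subspace H" and adj: "adjoint_op H = H"
    using H by (auto simp: self_adjoint_extension_def self_adjoint_def linear_operator_def)
  have mem: "(f, adjoint_map S f) \<in> H" if "f \<in> Domain H" for f using gr that by blast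
  have add: "(f + g, adjoint_map S f + adjoint_map S g) \<in> H" if "f \<in> Domain H" "g \<in> Domain H" for f g
    using cvec.subspace_add[OF sub mem[OF that(1)] mem[OF that(2)]] by simp
  have scale: "(a *c f, a *c adjoint_map S f) \<in> H" if "f \<in> Domain H" for f a
    using cvec.subspace_scale[OF sub mem[OF that], of a] by (simp add: scaleC_prod_def)
  show ?thesis
  proof
    show "cvec.subspace (Domain H)"
    proof (rule cvec.subspaceI)
      show "0 \<in> Domain H" using cvec.subspace_0[OF sub] by (auto simp: zero_prod_def)
    qed (use add scale in blast)+
    fix f g assume fg: "f \<in> Domain H" "g \<in> Domain H"
    show "adjoint_map S (f + g) = adjoint_map S f + adjoint_map S g" using add[OF fg] gr by metis
    have "(f, adjoint_map S f) \<in> adjoint_op H" using mem fg adj by blast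
    then show "cinner f (adjoint_map S g) = cinner (adjoint_map S f) g"
      using mem[OF fg(2)] unfolding adjoint_op_def by blast
  next
    fix f a assume "f \<in> Domain H"
    then show "adjoint_map S (a *c f) = a *c adjoint_map S f" using scale gr by metis
  next
    fix g h assume "\<And>f. f \<in> Domain H \<Longrightarrow> cinner g (adjoint_map S f) = cinner h f"
    then have "(g, h) \<in> adjoint_op H" unfolding adjoint_op_def using gr by auto
    then show "g \<in> Domain H \<and> adjoint_map S g = h" using adj gr by metis
  qed
qed

text \<open>The Cauchy condition alone does not identify the limit of the forms; membership of f in
  the domain of the adjoint does. For fixed k the mixed term a k l tends to
  \<open>inner g (u k)\<close>, so s k + s l is close to twice \<open>inner f g\<close> once k is
  large and l is large depending on k.\<close>

lemma form_closure_approx: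
  assumes S: "symmetric_operator S" and f: "f \<in> form_closure_dom S" "(f, g) \<in> adjoint_op S"
  obtains u v where "\<And>k. (u k, v k) \<in> S" "u \<longlonglongrightarrow> f" "(\<lambda>k. inner (u k) (v k)) \<longlonglongrightarrow> inner f g"
proof -
  obtain u v where uv: "\<And>k. (u k, v k) \<in> S" "u \<longlonglongrightarrow> f"
    and cauchy: "((\<lambda>(k, l). cinner (u k - u l) (v k - v l)) \<longlongrightarrow> 0) (sequentially \<times>\<^sub>F sequentially)"
    using f(1) unfolding form_closure_dom_def by blast
  define s where "s k = inner (u k) (v k)" for k
  define a where "a k l = inner (v k) (u l)" for k l
  have sym: "inner (u k) (v l) = inner (v k) (u l)" for k l
    using S uv(1)[of k] uv(1)[of l] unfolding symmetric_operator_def by (fastforce simp: inner_eq_Re_cinner)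
  have diff: "Re (cinner (u k - u l) (v k - v l)) = s k + s l - 2 * a k l" for k l
    using sym[of k l] by (simp add: inner_eq_Re_cinner[symmetric] inner_diff_left inner_diff_right s_def a_def inner_commute)
  have "inner (v k) f = inner g (u k)" for k
    using f(2) uv(1)[of k] unfolding adjoint_op_def by (fastforce simp: inner_eq_Re_cinner[symmetric] inner_commute[of "v k" f] inner_eq_Re_cinner[of f])
  then have a_lim: "(\<lambda>l. a k l) \<longlonglongrightarrow> inner g (u k)" for k
    unfolding a_def using tendsto_inner[OF tendsto_const uv(2), of "v k"] by simp
  have b_lim: "(\<lambda>k. inner g (u k)) \<longlonglongrightarrow> inner f g"
    using tendsto_inner[OF tendsto_const uv(2), of g] by (simp add: inner_commute)
  have "s \<longlonglongrightarrow> inner f g"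
  proof (rule LIMSEQ_I)
    fix e :: real assume "0 < e"
    define \<epsilon> where "\<epsilon> = e / 8"
    have \<epsilon>: "0 < \<epsilon>" using \<open>0 < e\<close> by (simp add: \<epsilon>_def)
    have "\<forall>\<^sub>F p in sequentially \<times>\<^sub>F sequentially. dist ((\<lambda>(k, l). cinner (u k - u l) (v k - v l)) p) 0 < \<epsilon>"
      by (rule tendstoD[OF cauchy \<epsilon>])
    then obtain K where "\<And>k l. K \<le> k \<Longrightarrow> K \<le> l \<Longrightarrow> cmod (cinner (u k - u l) (v k - v l)) < \<epsilon>"
      unfolding eventually_prod_sequentially by auto
    then have K: "\<bar>s k + s l - 2 * a k l\<bar> < \<epsilon>" if "K \<le> k" "K \<le> l" for k l
      using that abs_Re_le_cmod[of "cinner (u k - u l) (v k - v l)"] unfolding diff by fastforce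
    obtain K' where K': "\<And>k. K' \<le> k \<Longrightarrow> \<bar>inner g (u k) - inner f g\<bar> < \<epsilon>"
      using LIMSEQ_D[OF b_lim \<epsilon>] by auto
    have near: "\<exists>L. \<forall>l \<ge> L. \<bar>s k + s l - 2 * inner f g\<bar> < 5 * \<epsilon>" if k: "K \<le> k" "K' \<le> k" for k
    proof -
      obtain L where L: "\<And>l. L \<le> l \<Longrightarrow> \<bar>a k l - inner g (u k)\<bar> < \<epsilon>"
        using LIMSEQ_D[OF a_lim \<epsilon>] by auto
      have "\<bar>s k + s l - 2 * inner f g\<bar> < 5 * \<epsilon>" if "max K L \<le> l" for l
        using K[of k l] K'[of k] L[of l] k that unfolding abs_less_iff by simp
      then show ?thesis by blast
    qed
    \<comment> \<open>The threshold for l depends on k, so three indices are chosen in succession.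
      Adding the pair sums containing s k and subtracting the third isolates 2 s k; the error of s k
      is below 15/2 \<epsilon>, hence below 8 \<epsilon> = e.\<close>
    have "norm (s k - inner f g) < e" if k: "max K K' \<le> k" for k
    proof -
      obtain L where L: "\<And>l. L \<le> l \<Longrightarrow> \<bar>s k + s l - 2 * inner f g\<bar> < 5 * \<epsilon>" using near[of k] k by auto
      define l where "l = max L k"
      have "K \<le> l" "K' \<le> l" using k by (auto simp: l_def)
      then obtain L' where L': "\<And>i. L' \<le> i \<Longrightarrow> \<bar>s l + s i - 2 * inner f g\<bar> < 5 * \<epsilon>"
        using near[of l] by blast
      have "\<bar>s k + s l - 2 * inner f g\<bar> < 5 * \<epsilon>" "\<bar>s k + s (max L L') - 2 * inner f g\<bar> < 5 * \<epsilon>"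
        "\<bar>s l + s (max L L') - 2 * inner f g\<bar> < 5 * \<epsilon>"
        using L[of l] L[of "max L L'"] L'[of "max L L'"] by (auto simp: l_def)
      then show ?thesis unfolding abs_less_iff real_norm_def by (simp add: \<epsilon>_def)
    qed
    then show "\<exists>no. \<forall>n\<ge>no. norm (s n - inner f g) < e" by blast
  qed
  then show ?thesis using that[of u v] uv unfolding s_def by blast
qed

lemma ker_shift_op: "f \<in> ker_op (shift_op H z) \<longleftrightarrow> (f, z *c f) \<in> H"
  by (auto simp: ker_op_def shift_op_def)

section \<open>Comparing two self-adjoint extensions through a boundary triplet\<close>

locale semibounded_triplet =
  fixes S :: "('h::chilbert_space \<times> 'h) set" and n :: nat
    and \<Gamma>\<^sub>0 \<Gamma>\<^sub>1 :: "'h \<Rightarrow> 'k::chilbert_space" and F :: "('k \<times> 'k) set"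
  assumes S: "symmetric_operator S" "densely_defined S" "bounded_from_below S"
    and triplet: "boundary_triplet S n \<Gamma>\<^sub>0 \<Gamma>\<^sub>1"
    and friedrichs: "corresponding_plane S \<Gamma>\<^sub>0 \<Gamma>\<^sub>1 (friedrichs_extension S) F"
begin

abbreviation T :: "'h \<Rightarrow> 'h" where
  "T \<equiv> adjoint_map S"

definition \<Gamma> :: "'h \<Rightarrow> 'k \<times> 'k" where
  "\<Gamma> f = (\<Gamma>\<^sub>0 f, \<Gamma>\<^sub>1 f)"

lemma finite_boundary: "finite_cdim (UNIV :: 'k set)"
  using triplet by (simp add: boundary_triplet_def)

lemma T_mem: "f \<in> Domain (adjoint_op S) \<Longrightarrow> (f, T f) \<in> adjoint_op S"
  by (rule adjoint_map_mem[OF S(2)])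

lemma clinear_\<Gamma>: "clinear_on (Domain (adjoint_op S)) \<Gamma>"
  using triplet by (simp add: boundary_triplet_def clinear_on_def \<Gamma>_def scaleC_prod_def)

lemma \<Gamma>_surj: obtains f where "f \<in> Domain (adjoint_op S)" "\<Gamma> f = p"
proof -
  have "p \<in> (\<lambda>f. (\<Gamma>\<^sub>0 f, \<Gamma>\<^sub>1 f)) ` Domain (adjoint_op S)" using triplet by (simp add: boundary_triplet_def)
  then show ?thesis using that by (auto simp: \<Gamma>_def)
qed

lemma green:
  assumes "f \<in> Domain (adjoint_op S)" "g \<in> Domain (adjoint_op S)"
  shows "cinner f (T g) - cinner (T f) g = omega (\<Gamma> f) (\<Gamma> g)"
  using triplet T_mem[OF assms(1)] T_mem[OF assms(2)]
  unfolding boundary_triplet_def omega_def \<Gamma>_def by fastforce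

lemma friedrichs_iff: "(f, g) \<in> friedrichs_extension S \<longleftrightarrow> (f, g) \<in> adjoint_op S \<and> \<Gamma> f \<in> F"
  using friedrichs by (auto simp: corresponding_plane_def \<Gamma>_def)

text \<open>0 lies in F, so the kernel of \<Gamma> lies in the Friedrichs domain, where the lower
  bound of S survives the limit of forms.\<close>

lemma kernel_form_bound:
  obtains m where "\<And>f. f \<in> Domain (adjoint_op S) \<Longrightarrow> \<Gamma> f = 0 \<Longrightarrow> m * (norm f)\<^sup>2 \<le> inner f (T f)"
proof -
  obtain m where m: "\<And>f g. (f, g) \<in> S \<Longrightarrow> m * (norm f)\<^sup>2 \<le> inner f g"
    using S(3) unfolding bounded_from_below_def by (auto simp: inner_eq_Re_cinner)
  have "m * (norm f)\<^sup>2 \<le> inner f (T f)" if f: "f \<in> Domain (adjoint_op S)" "\<Gamma> f = 0" for f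
  proof -
    have "0 \<in> F" using friedrichs lagrangian_subspace cvec.subspace_0 unfolding corresponding_plane_def by blast
    then have "(f, T f) \<in> friedrichs_extension S" using f T_mem friedrichs_iff by simp
    then have fc: "f \<in> form_closure_dom S" by (simp add: friedrichs_extension_def)
    obtain u v where uv: "\<And>k. (u k, v k) \<in> S" "u \<longlonglongrightarrow> f" "(\<lambda>k. inner (u k) (v k)) \<longlonglongrightarrow> inner f (T f)"
      using form_closure_approx[OF S(1) fc T_mem[OF f(1)]] by blast
    have "(\<lambda>k. m * (norm (u k))\<^sup>2) \<longlonglongrightarrow> m * (norm f)\<^sup>2" by (intro tendsto_intros uv(2))
    then show ?thesis using uv(3) m[OF uv(1)] by (intro LIMSEQ_le) auto
  qed
  then show ?thesis using that by blast
qed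

lemma extension_domain:
  assumes "corresponding_plane S \<Gamma>\<^sub>0 \<Gamma>\<^sub>1 H L"
  shows "f \<in> Domain H \<longleftrightarrow> f \<in> Domain (adjoint_op S) \<and> \<Gamma> f \<in> L"
  using assms by (auto simp: corresponding_plane_def \<Gamma>_def)

text \<open>H - s extends S - s, so the closed range of S - s, which has a finite-dimensional
  complement, can serve as the R of \<open>fredholm_at\<close>.\<close>

lemma extension_fredholm_at:
  assumes H: "self_adjoint_extension S H" and t: "below_spec_ess t S" "s \<le> t"
  shows "selfadjoint.fredholm_at (Domain H) T s"
proof -
  interpret selfadjoint "Domain H" T by (rule selfadjoint_extension[OF S(2) H])
  have "fredholm (shift_op S (of_real s))"
    using t unfolding below_spec_ess_def spec_ess_def by force
  then obtain W where W: "cvec.subspace (shift_op S (of_real s))" "closed (Range (shift_op S (of_real s)))"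
    "finite_cdim W" "\<forall>h. \<exists>r \<in> Range (shift_op S (of_real s)). \<exists>w \<in> W. h = r + w"
    unfolding fredholm_def linear_operator_def by blast
  let ?R = "Range (shift_op S (of_real s))"
  have "cvec.subspace ?R"
  proof (rule cvec.subspaceI)
    show "0 \<in> ?R" using cvec.subspace_0[OF W(1)] by (auto simp: zero_prod_def)
  next
    fix x y assume "x \<in> ?R" "y \<in> ?R"
    then obtain f g where "(f, x) \<in> shift_op S (of_real s)" "(g, y) \<in> shift_op S (of_real s)" by blast
    then have "(f + g, x + y) \<in> shift_op S (of_real s)" using cvec.subspace_add[OF W(1)] by fastforce
    then show "x + y \<in> ?R" by blast
  next
    fix c x assume "x \<in> ?R"
    then obtain f where "(f, x) \<in> shift_op S (of_real s)" by blast
    then have "(c *c f, c *c x) \<in> shift_op S (of_real s)"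
      using cvec.subspace_scale[OF W(1), of "(f, x)" c] by (simp add: scaleC_prod_def)
    then show "c *c x \<in> ?R" by blast
  qed
  moreover have "?R \<subseteq> (\<lambda>f. T f - of_real s *c f) ` Domain H"
  proof
    fix r assume "r \<in> ?R"
    then obtain f g where fg: "(f, g) \<in> S" "r = g - of_real s *c f" unfolding shift_op_def by blast
    then have "(f, g) \<in> H" using H by (auto simp: self_adjoint_extension_def)
    then have "f \<in> Domain H" "g = T f" using extension_graph[OF S(2) H] by blast+
    then show "r \<in> (\<lambda>f. T f - of_real s *c f) ` Domain H" using fg(2) by blast
  qed
  ultimately show ?thesis unfolding fredholm_at_def using W by blast
qed

lemma extension_semibounded:
  assumes H: "self_adjoint_extension S H"
  shows "\<exists>C. \<forall>f \<in> Domain H. C * (norm f)\<^sup>2 \<le> selfadjoint.form T f"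
proof -
  interpret selfadjoint "Domain H" T by (rule selfadjoint_extension[OF S(2) H])
  obtain m where m: "\<And>f. f \<in> Domain (adjoint_op S) \<Longrightarrow> \<Gamma> f = 0 \<Longrightarrow> m * (norm f)\<^sup>2 \<le> inner f (T f)"
    using kernel_form_bound by blast
  have sub: "Domain H \<subseteq> Domain (adjoint_op S)" using extension_subset_adjoint[OF H] by blast
  show ?thesis
  proof (rule semibounded_of_finite_codim[where G = \<Gamma> and m = m])
    show "finite_cdim (UNIV :: ('k \<times> 'k) set)"
      using finite_cdim_Times(1)[OF finite_boundary finite_boundary] by simp
    show "clinear_on (Domain H) \<Gamma>" using clinear_\<Gamma> sub unfolding clinear_on_def by blast
  qed (use m subsetD[OF sub] in \<open>simp add: form_def inner_eq_Re_cinner\<close>)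
qed

lemma multiplicity_extension:
  assumes H: "self_adjoint_extension S H"
  shows "multiplicity_op H \<mu> = cvec.dim (selfadjoint.eig (Domain H) T \<mu>)"
proof -
  interpret selfadjoint "Domain H" T by (rule selfadjoint_extension[OF S(2) H])
  have "ker_op (shift_op H (of_real \<mu>)) = eig \<mu>"
    unfolding eig_def set_eq_iff ker_shift_op extension_graph[OF S(2) H] by auto
  then show ?thesis by (simp add: multiplicity_op_def)
qed

text \<open>Dimension 0 could also mean infinite dimension under the convention for
  \<open>cvec.dim\<close>; the Fredholm property below the essential spectrum rules that
  out.\<close>

lemma multiplicity_support:
  assumes H: "self_adjoint_extension S H" and t: "below_spec_ess t S"
  shows "{\<mu> \<in> {..t}. multiplicity_op H \<mu> \<noteq> 0} = {\<mu>. \<mu> \<le> t \<and> selfadjoint.eig (Domain H) T \<mu> \<noteq> {0}}"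
proof -
  interpret selfadjoint "Domain H" T by (rule selfadjoint_extension[OF S(2) H])
  have dim0: "cvec.dim (eig \<mu>) = 0 \<longleftrightarrow> eig \<mu> = {0}" if "\<mu> \<le> t" for \<mu>
  proof
    assume "cvec.dim (eig \<mu>) = 0"
    moreover have "finite_cdim (eig \<mu>)" by (rule fredholm_at_eig(1)[OF extension_fredholm_at[OF H t that]])
    ultimately obtain B where "finite B" "eig \<mu> \<subseteq> cvec.span B" "card B = 0" using finite_basis by metis
    then show "eig \<mu> = {0}" using cvec.subspace_0[OF eig_subspace] by fastforce
  next
    assume "eig \<mu> = {0}"
    then show "cvec.dim (eig \<mu>) = 0" using cvec.dim_le_card[of "{0}" "{}"] by simp
  qed
  show ?thesis
  proof (rule Collect_cong)
    fix \<mu>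
    show "\<mu> \<in> {..t} \<and> multiplicity_op H \<mu> \<noteq> 0 \<longleftrightarrow> \<mu> \<le> t \<and> eig \<mu> \<noteq> {0}"
      using dim0[of \<mu>] multiplicity_extension[OF H, of \<mu>] by (cases "\<mu> \<le> t") simp_all
  qed
qed

lemma finite_multiplicity_support:
  assumes H: "self_adjoint_extension S H" and t: "below_spec_ess t S"
  shows "finite {\<mu> \<in> {..t}. multiplicity_op H \<mu> \<noteq> 0}"
proof -
  interpret selfadjoint "Domain H" T by (rule selfadjoint_extension[OF S(2) H])
  obtain C where C: "\<forall>f \<in> Domain H. C * (norm f)\<^sup>2 \<le> form f" using extension_semibounded[OF H] by blast
  have "\<forall>s \<le> t. fredholm_at s" using extension_fredholm_at[OF H t] by blast
  then show ?thesis unfolding multiplicity_support[OF H t] using spectral_gap(1)[OF C] by blast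
qed

lemma spectral_shift_le:
  assumes H: "self_adjoint_extension S H\<^sub>1" "self_adjoint_extension S H\<^sub>2"
    and L: "corresponding_plane S \<Gamma>\<^sub>0 \<Gamma>\<^sub>1 H\<^sub>1 L\<^sub>1" "corresponding_plane S \<Gamma>\<^sub>0 \<Gamma>\<^sub>1 H\<^sub>2 L\<^sub>2"
    and t: "below_spec_ess t S"
  shows "spectral_shift H\<^sub>1 H\<^sub>2 t \<le> duistermaat_index L\<^sub>2 L\<^sub>1 F"
proof (rule ccontr)
  assume "\<not> spectral_shift H\<^sub>1 H\<^sub>2 t \<le> duistermaat_index L\<^sub>2 L\<^sub>1 F"
  then have large: "int (eigenvalue_count H\<^sub>2 {..t}) + duistermaat_index L\<^sub>2 L\<^sub>1 F < int (eigenvalue_count H\<^sub>1 {..t})"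
    by (simp add: spectral_shift_def)
  interpret H1: selfadjoint "Domain H\<^sub>1" T by (rule selfadjoint_extension[OF S(2) H(1)])
  interpret H2: selfadjoint "Domain H\<^sub>2" T by (rule selfadjoint_extension[OF S(2) H(2)])
  obtain C\<^sub>1 where C1: "\<forall>f \<in> Domain H\<^sub>1. C\<^sub>1 * (norm f)\<^sup>2 \<le> H1.form f"
    using extension_semibounded[OF H(1)] by blast
  obtain C\<^sub>2 where C2: "\<forall>f \<in> Domain H\<^sub>2. C\<^sub>2 * (norm f)\<^sup>2 \<le> H2.form f"
    using extension_semibounded[OF H(2)] by blast
  have F1: "\<forall>s \<le> t. H1.fredholm_at s" and F2: "\<forall>s \<le> t. H2.fredholm_at s"
    using extension_fredholm_at[OF _ t] H by blast+
  have count: "eigenvalue_count H {..t} = (\<Sum>\<mu> | \<mu> \<le> t \<and> selfadjoint.eig (Domain H) T \<mu> \<noteq> {0}.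
      cvec.dim (selfadjoint.eig (Domain H) T \<mu>))" if "self_adjoint_extension S H" for H
    unfolding eigenvalue_count_def multiplicity_support[OF that t] by (simp add: multiplicity_extension[OF that])
  obtain V\<^sub>1 where V1: "cvec.subspace V\<^sub>1" "finite_cdim V\<^sub>1" "V\<^sub>1 \<subseteq> Domain H\<^sub>1"
    "cvec.dim V\<^sub>1 = eigenvalue_count H\<^sub>1 {..t}" "\<forall>f \<in> V\<^sub>1. H1.form f \<le> t * (norm f)\<^sup>2"
    using H1.spectral_gap(2)[OF C1 F1, folded count[OF H(1)]]
    by (elim exE conjE) (rule that; assumption)
  obtain V\<^sub>2 t' where V2: "cvec.subspace V\<^sub>2" "finite_cdim V\<^sub>2" "V\<^sub>2 \<subseteq> Domain H\<^sub>2"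
    "cvec.dim V\<^sub>2 = eigenvalue_count H\<^sub>2 {..t}" "\<forall>f \<in> V\<^sub>2. T f \<in> V\<^sub>2" "t < t'"
    "\<forall>f \<in> Domain H\<^sub>2. (\<forall>v \<in> V\<^sub>2. cinner v f = 0) \<longrightarrow> t' * (norm f)\<^sup>2 \<le> H2.form f"
    using H2.spectral_gap(2)[OF C2 F2, folded count[OF H(2)]]
    by (elim exE conjE) (rule that; assumption)
  obtain B where B: "finite B" "B \<subseteq> V\<^sub>2" "V\<^sub>2 \<subseteq> cvec.span B" "card B = cvec.dim V\<^sub>2"
    using finite_basis[OF V2(2)] by metis
  have lag: "lagrangian L\<^sub>1" "lagrangian L\<^sub>2" "lagrangian F"
    using L friedrichs by (auto simp: corresponding_plane_def)
  have V1S: "V\<^sub>1 \<subseteq> Domain (adjoint_op S)" using V1(3) extension_subset_adjoint[OF H(1)] by blast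
  have lin: "clinear_on V\<^sub>1 \<Gamma>" using clinear_\<Gamma> V1S unfolding clinear_on_def by blast
  have into: "\<And>f. f \<in> V\<^sub>1 \<Longrightarrow> \<Gamma> f \<in> L\<^sub>1" using V1(3) extension_domain[OF L(1)] by blast
  have fB: "functional_on V\<^sub>1 \<psi>" if "\<psi> \<in> cinner ` B" for \<psi>
    using that by (auto simp: functional_on_def cinner_add_right cinner_scaleC_right)
  have "int (card (cinner ` B)) + duistermaat_index L\<^sub>2 L\<^sub>1 F < int (cvec.dim V\<^sub>1)"
    using large card_image_le[OF B(1), of cinner] V1(4) V2(4) B(4) by linarith
  then obtain f p r where f: "f \<in> V\<^sub>1" "f \<noteq> 0" "\<And>\<psi>. \<psi> \<in> cinner ` B \<Longrightarrow> \<psi> f = 0"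
    and pr: "p \<in> L\<^sub>2" "r \<in> F" "\<Gamma> f = p + r" "0 \<le> Re (omega p r)"
    using duistermaat_count[OF finite_boundary lag V1(1,2) lin into finite_imageI[OF B(1)] fB] by blast
  have fV2: "cinner v f = 0" if "v \<in> V\<^sub>2" for v
  proof -
    have "cvec.subspace {v \<in> UNIV. cinner v f = 0}"
      by (rule subspace_hermitian_left_kernel[OF hermitian_on_cinner]) auto
    then have "cvec.span B \<subseteq> {v. cinner v f = 0}" using f(3) by (intro cvec.span_minimal) auto
    then show ?thesis using that B(3) by blast
  qed
  note sS = subspace_adjoint_op[of S]
  have fS: "f \<in> Domain (adjoint_op S)" using f(1) V1S by blast
  \<comment> \<open>Surjectivity of the boundary map realises p by an element of the domain of
    \<open>H\<^sub>2\<close>; what remains of f has boundary value r and so is a Friedrichs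
    element.\<close>
  obtain f\<^sub>2 where f2: "f\<^sub>2 \<in> Domain (adjoint_op S)" "\<Gamma> f\<^sub>2 = p" using \<Gamma>_surj by blast
  have f2D: "f\<^sub>2 \<in> Domain H\<^sub>2" using f2 pr(1) extension_domain[OF L(2)] by blast
  define g where "g = f - f\<^sub>2"
  have gT: "(g, T f - T f\<^sub>2) \<in> adjoint_op S"
    using cvec.subspace_diff[OF sS T_mem[OF fS] T_mem[OF f2(1)]] by (simp add: g_def)
  then have gS: "g \<in> Domain (adjoint_op S)" and Tg: "T g = T f - T f\<^sub>2"
    using adjoint_map_eq[OF S(2)] by blast+
  have "\<Gamma> (g + f\<^sub>2) = \<Gamma> g + \<Gamma> f\<^sub>2" using clinear_\<Gamma> gS f2(1) unfolding clinear_on_def by blast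
  then have \<Gamma>g: "\<Gamma> g = r" using pr(3) f2(2) by (simp add: g_def)
  then have "(g, T g) \<in> friedrichs_extension S" using friedrichs_iff T_mem[OF gS] pr(2) by simp
  then have gF: "g \<in> form_closure_dom S" by (simp add: friedrichs_extension_def)
  obtain u v where uv: "\<And>k. (u k, v k) \<in> S" "u \<longlonglongrightarrow> g" "(\<lambda>k. inner (u k) (v k)) \<longlonglongrightarrow> inner g (T g)"
    using form_closure_approx[OF S(1) gF T_mem[OF gS]] by blast
  have "(u k, v k) \<in> H\<^sub>2" for k using uv(1) H(2) unfolding self_adjoint_extension_def by blast
  then have uH: "u k \<in> Domain H\<^sub>2" "v k = T (u k)" for k using extension_graph[OF S(2) H(2)] by blast+
  \<comment> \<open>The value at f of the closed form of \<open>H\<^sub>2\<close>, obtained along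
    \<open>f\<^sub>2\<close> + u k. It differs from \<open>inner f (T f)\<close> by the boundary
    term of Green's identity for \<open>f\<^sub>2\<close> and g, which is
    \<open>Re (omega p r)\<close>.\<close>
  define \<eta> where "\<eta> = inner f\<^sub>2 (T f\<^sub>2) + 2 * inner g (T f\<^sub>2) + inner g (T g)"
  have form2: "H2.form (f\<^sub>2 + u k) = inner f\<^sub>2 (T f\<^sub>2) + 2 * inner (u k) (T f\<^sub>2) + inner (u k) (v k)" for k
    using H2.form_add[OF f2D uH(1), of k] by (simp add: H2.form_def inner_eq_Re_cinner uH(2))
  have "(\<lambda>k. H2.form (f\<^sub>2 + u k)) \<longlonglongrightarrow> \<eta>"
    unfolding form2 \<eta>_def by (intro tendsto_intros uv)
  moreover have "(\<lambda>k. f\<^sub>2 + u k) \<longlonglongrightarrow> f"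
    using tendsto_add[OF tendsto_const uv(2), of f\<^sub>2] by (simp add: g_def)
  moreover have "f\<^sub>2 + u k \<in> Domain H\<^sub>2" for k using f2D uH(1) cvec.subspace_add[OF H2.D] by blast
  ultimately have "t' * (norm f)\<^sup>2 \<le> \<eta>"
    using H2.form_lower_bound_limit[of V\<^sub>2 C\<^sub>2 t' "\<lambda>k. f\<^sub>2 + u k" f \<eta>] V2 C2 fV2 by blast
  also have "\<eta> \<le> inner f (T f)"
  proof -
    have "inner f\<^sub>2 (T g) - inner (T f\<^sub>2) g = Re (omega p r)"
      using green[OF f2(1) gS] by (simp add: inner_eq_Re_cinner f2(2) \<Gamma>g flip: minus_complex.sel)
    moreover have "inner f (T f) = inner (f\<^sub>2 + g) (T f\<^sub>2 + T g)" using Tg by (simp add: g_def)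
    ultimately show ?thesis using pr(4)
      by (simp add: \<eta>_def inner_add_left inner_add_right inner_commute[of "T f\<^sub>2" g])
  qed
  also have "\<dots> \<le> t * (norm f)\<^sup>2" using V1(5) f(1) by (simp add: H1.form_def inner_eq_Re_cinner)
  finally have "t' * (norm f)\<^sup>2 \<le> t * (norm f)\<^sup>2" .
  then show False using f(2) V2(6) by simp
qed

section \<open>From counting functions to labelled eigenvalues\<close>

lemma labelling_count:
  assumes H: "self_adjoint_extension S H" and l: "eigenvalue_labelling S H J l" and t: "below_spec_ess t S"
  shows "finite {k \<in> J. l k \<le> t}" "card {k \<in> J. l k \<le> t} = eigenvalue_count H {..t}"
proof -
  let ?M = "{\<mu> \<in> {..t}. multiplicity_op H \<mu> \<noteq> 0}"
  let ?K = "\<lambda>\<mu>. {k \<in> J. l k = \<mu>}"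
  have below: "below_spec_ess \<mu> S" if "\<mu> \<le> t" for \<mu>
    using t that unfolding below_spec_ess_def by force
  have K: "finite (?K \<mu>)" "card (?K \<mu>) = multiplicity_op H \<mu>" if "\<mu> \<le> t" for \<mu>
    using l below[OF that] unfolding eigenvalue_labelling_def by blast+
  have "l k \<in> ?M" if "k \<in> J" "l k \<le> t" for k
  proof -
    have "k \<in> ?K (l k)" using that(1) by blast
    then have "card (?K (l k)) \<noteq> 0" using K(1)[OF that(2)] by (metis card_0_eq empty_iff)
    then show ?thesis using K(2)[OF that(2)] that(2) by simp
  qed
  then have e: "{k \<in> J. l k \<le> t} = (\<Union>\<mu> \<in> ?M. ?K \<mu>)" by auto
  have fin: "finite ?M" by (rule finite_multiplicity_support[OF H t])
  show "finite {k \<in> J. l k \<le> t}" unfolding e using fin K(1) by blast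
  show "card {k \<in> J. l k \<le> t} = eigenvalue_count H {..t}"
    unfolding e eigenvalue_count_def using fin K by (subst card_UN_disjoint) auto
qed

text \<open>J is an initial segment of the positive integers, so by monotonicity the labels 1 to k
  all carry values at most l k. Multiplicity can make the inequality strict.\<close>

lemma labelling_index_le_count:
  assumes H: "self_adjoint_extension S H" and l: "eigenvalue_labelling S H J l" and k: "k \<in> J"
  shows "k \<le> eigenvalue_count H {..l k}"
proof -
  have t: "below_spec_ess (l k) S" and mono: "mono_on J l" using l k unfolding eigenvalue_labelling_def by auto
  have "{1..k} \<subseteq> {i \<in> J. l i \<le> l k}"
  proof
    fix i assume i: "i \<in> {1..k}"
    then have "i \<in> J" using l k unfolding eigenvalue_labelling_def by auto
    then show "i \<in> {i \<in> J. l i \<le> l k}" using mono_onD[OF mono _ k] i by auto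
  qed
  then have "card {1..k} \<le> card {i \<in> J. l i \<le> l k}" by (rule card_mono[OF labelling_count(1)[OF H l t]])
  then show ?thesis using labelling_count(2)[OF H l t] by simp
qed

lemma labelling_count_less_index:
  assumes H: "self_adjoint_extension S H" and l: "eigenvalue_labelling S H J l"
    and t: "below_spec_ess t S" and k: "k \<in> J" "t < l k"
  shows "eigenvalue_count H {..t} < k"
proof -
  have mono: "mono_on J l" and J: "J \<subseteq> {1..}" using l unfolding eigenvalue_labelling_def by auto
  have "{i \<in> J. l i \<le> t} \<subseteq> {1..<k}"
  proof
    fix i assume i: "i \<in> {i \<in> J. l i \<le> t}"
    have "\<not> k \<le> i" using mono_onD[OF mono k(1), of i] i k(2) by auto
    then show "i \<in> {1..<k}" using i J by auto
  qed
  then have "card {i \<in> J. l i \<le> t} \<le> card {1..<k}" by (intro card_mono) auto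
  moreover have "1 \<le> k" using k(1) J by auto
  ultimately show ?thesis using labelling_count(2)[OF H l t] by simp
qed

end

theorem theorem1p1:
  fixes S H\<^sub>1 H\<^sub>2 :: "('h::chilbert_space \<times> 'h) set"
    and \<Gamma>\<^sub>0 \<Gamma>\<^sub>1 :: "'h \<Rightarrow> 'k::chilbert_space"
    and L\<^sub>1 L\<^sub>2 F :: "('k \<times> 'k) set"
    and n :: nat and \<sigma>\<^sub>m \<sigma>\<^sub>p :: int
  assumes separable: "\<exists>D :: 'h set. countable D \<and> closure D = UNIV"
    and "symmetric_operator S" "closed S" "densely_defined S" "bounded_from_below S"
    and "defect_numbers S n n"
    and "boundary_triplet S n \<Gamma>\<^sub>0 \<Gamma>\<^sub>1"
    and "self_adjoint_extension S H\<^sub>1" "self_adjoint_extension S H\<^sub>2"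
    and "corresponding_plane S \<Gamma>\<^sub>0 \<Gamma>\<^sub>1 H\<^sub>1 L\<^sub>1"
    and "corresponding_plane S \<Gamma>\<^sub>0 \<Gamma>\<^sub>1 H\<^sub>2 L\<^sub>2"
    and "corresponding_plane S \<Gamma>\<^sub>0 \<Gamma>\<^sub>1 (friedrichs_extension S) F"
    and "\<sigma>\<^sub>m = duistermaat_index L\<^sub>1 L\<^sub>2 F"
    and "\<sigma>\<^sub>p = duistermaat_index L\<^sub>2 L\<^sub>1 F"
  shows "(\<forall>t. below_spec_ess t S \<longrightarrow>
            - \<sigma>\<^sub>m \<le> spectral_shift H\<^sub>1 H\<^sub>2 t \<and> spectral_shift H\<^sub>1 H\<^sub>2 t \<le> \<sigma>\<^sub>p) \<and>
         (\<forall>J\<^sub>1 l\<^sub>1 J\<^sub>2 l\<^sub>2.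
            eigenvalue_labelling S H\<^sub>1 J\<^sub>1 l\<^sub>1 \<and> eigenvalue_labelling S H\<^sub>2 J\<^sub>2 l\<^sub>2 \<longrightarrow>
            (\<forall>k \<in> J\<^sub>2. nat (int k - \<sigma>\<^sub>m) \<in> J\<^sub>1 \<longrightarrow> l\<^sub>1 (nat (int k - \<sigma>\<^sub>m)) \<le> l\<^sub>2 k) \<and>
            (\<forall>k \<in> J\<^sub>2. nat (int k + \<sigma>\<^sub>p) \<in> J\<^sub>1 \<longrightarrow> l\<^sub>2 k \<le> l\<^sub>1 (nat (int k + \<sigma>\<^sub>p))))"
proof -
  interpret semibounded_triplet S n \<Gamma>\<^sub>0 \<Gamma>\<^sub>1 F using assms by unfold_locales
  note H1 = assms(8) and H2 = assms(9)
  have shift: "- \<sigma>\<^sub>m \<le> spectral_shift H\<^sub>1 H\<^sub>2 t" "spectral_shift H\<^sub>1 H\<^sub>2 t \<le> \<sigma>\<^sub>p"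
    if "below_spec_ess t S" for t
  proof -
    have "spectral_shift H\<^sub>2 H\<^sub>1 t \<le> \<sigma>\<^sub>m"
      unfolding assms(13) by (rule spectral_shift_le[OF H2 H1 assms(11,10) that])
    then show "- \<sigma>\<^sub>m \<le> spectral_shift H\<^sub>1 H\<^sub>2 t" by (simp add: spectral_shift_def)
    show "spectral_shift H\<^sub>1 H\<^sub>2 t \<le> \<sigma>\<^sub>p"
      unfolding assms(14) by (rule spectral_shift_le[OF H1 H2 assms(10,11) that])
  qed
  have labels: "(\<forall>k \<in> J\<^sub>2. nat (int k - \<sigma>\<^sub>m) \<in> J\<^sub>1 \<longrightarrow> l\<^sub>1 (nat (int k - \<sigma>\<^sub>m)) \<le> l\<^sub>2 k) \<and>
      (\<forall>k \<in> J\<^sub>2. nat (int k + \<sigma>\<^sub>p) \<in> J\<^sub>1 \<longrightarrow> l\<^sub>2 k \<le> l\<^sub>1 (nat (int k + \<sigma>\<^sub>p)))"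
    if l1: "eigenvalue_labelling S H\<^sub>1 J\<^sub>1 l\<^sub>1" and l2: "eigenvalue_labelling S H\<^sub>2 J\<^sub>2 l\<^sub>2" for J\<^sub>1 l\<^sub>1 J\<^sub>2 l\<^sub>2
  proof (intro conjI ballI impI)
    have J1: "0 \<notin> J\<^sub>1" using l1 unfolding eigenvalue_labelling_def by auto
    have below1: "below_spec_ess (l\<^sub>1 k) S" if "k \<in> J\<^sub>1" for k
      using l1 that unfolding eigenvalue_labelling_def by blast
    have below2: "below_spec_ess (l\<^sub>2 k) S" if "k \<in> J\<^sub>2" for k
      using l2 that unfolding eigenvalue_labelling_def by blast
    fix k assume k: "k \<in> J\<^sub>2"
    {
      assume j: "nat (int k - \<sigma>\<^sub>m) \<in> J\<^sub>1" (is "?j \<in> _")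
      \<comment> \<open>A negative index is truncated by \<open>nat\<close> to 0, which is not a
        label since labels start at 1; membership therefore makes the subtraction exact.\<close>
      have ij: "int ?j = int k - \<sigma>\<^sub>m" using j J1 by (cases "0 \<le> int k - \<sigma>\<^sub>m") auto
      show "l\<^sub>1 ?j \<le> l\<^sub>2 k"
      proof (rule ccontr)
        assume "\<not> l\<^sub>1 ?j \<le> l\<^sub>2 k"
        \<comment> \<open>At the point \<open>l\<^sub>2 k\<close> the count for
          \<open>H\<^sub>1\<close> would be below \<open>k - \<sigma>\<^sub>m\<close>, while the
          count for \<open>H\<^sub>2\<close> is at least k; the shift would then be below
          \<open>- \<sigma>\<^sub>m\<close>.\<close>
        then have "eigenvalue_count H\<^sub>1 {..l\<^sub>2 k} < ?j"
          using labelling_count_less_index[OF H1 l1 below2[OF k] j] by simp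
        then show False
          using labelling_index_le_count[OF H2 l2 k] shift(1)[OF below2[OF k]] ij
          unfolding spectral_shift_def by linarith
      qed
    }
    {
      assume j: "nat (int k + \<sigma>\<^sub>p) \<in> J\<^sub>1" (is "?j \<in> _")
      have ij: "int ?j = int k + \<sigma>\<^sub>p" using j J1 by (cases "0 \<le> int k + \<sigma>\<^sub>p") auto
      show "l\<^sub>2 k \<le> l\<^sub>1 ?j"
      proof (rule ccontr)
        assume "\<not> l\<^sub>2 k \<le> l\<^sub>1 ?j"
        then have "eigenvalue_count H\<^sub>2 {..l\<^sub>1 ?j} < k"
          using labelling_count_less_index[OF H2 l2 below1[OF j] k] by simp
        then show False
          using labelling_index_le_count[OF H1 l1 j] shift(2)[OF below1[OF j]] ij
          unfolding spectral_shift_def by linarith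
      qed
    }
  qed
  show ?thesis
    by (rule conjI; intro allI impI) (simp add: shift, elim conjE, rule labels)
qed

end
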